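(* Let $U$ be the unitary operator on $\ell^2(\mathbb Z)$ built from real phases $\theta_k,\alpha_k,\gamma_k$ and real coefficients $t_k,r_k$ with $r_k^2+t_k^2=1$, $k\in\mathbb Z$, and assume $$\lim_{k\to\pm\infty}t_k=t_\pm,\qquad \lim_{k\to\pm\infty}r_k=r_\pm .$$ Let $U^{\pm}(t_\pm)$ be the operators on $\ell^2(\pm\mathbb N^* )$ with the same phases and with $t_k=t_\pm$, $r_k=r_\pm$ for all $k\in\pm\mathbb N^*$. Then $$\sigma_{ess}(U)=\sigma_{ess}(U^+(t_+))\cup\sigma_{ess}(U^-(t_-)).$$ If, furthermore, there exists $\epsilon>1/2$ such that $\sup_{j\in\mathbb N}\delta^{\pm}(j)\,j^{2\epsilon}<\infty$ (for both signs), then $$U_{a.c.}\simeq U^+_{a.c.}(t_+)\oplus U^-_{a.c.}(t_-),$$ where the subscript $a.c.$ denotes the restriction to the absolutely continuous subspace and $\simeq$ means unitary equivalence.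
   Context: Put $$S_k=e^{-i\theta_k}\begin{pmatrix} r_k e^{-i\alpha_k} & i t_k e^{i\gamma_k}\\ i t_k e^{-i\gamma_k} & r_k e^{i\alpha_k}\end{pmatrix},\qquad k\in\mathbb Z .$$ On $\ell^2(\mathbb Z)$ with canonical basis $(\varphi_k)_{k\in\mathbb Z}$: $U_e$ acts on each $\mathrm{span}\{\varphi_{2k},\varphi_{2k+1}\}$ by $S_{2k}$ in the ordered basis $(\varphi_{2k},\varphi_{2k+1})$, $U_o$ acts on each $\mathrm{span}\{\varphi_{2k+1},\varphi_{2k+2}\}$ by $S_{2k+1}$ in the ordered basis $(\varphi_{2k+1},\varphi_{2k+2})$, and $U=U_oU_e$. $\mathbb N^*=\{1,2,\dots\}$. On $\ell^2(\mathbb N^* )$: $U^+=U_o^+U_e^+$ with $U_e^+\varphi_1=e^{-i\theta_0}\varphi_1$, $U_e^+$ acting as $S_{2k}$ on $\mathrm{span}\{\varphi_{2k},\varphi_{2k+1}\}$ for $k\ge1$, and $U_o^+$ acting as $S_{2k+1}$ on $\mathrm{span}\{\varphi_{2k+1},\varphi_{2k+2}\}$ for $k\ge0$. On $\ell^2(-\mathbb N^* )$ (basis $(\varphi_k)_{k\le-1}$), similarly: $U^-=U_o^-U_e^-$ with $U_e^-$ acting as $S_{2k}$ on $\mathrm{span}\{\varphi_{2k},\varphi_{2k+1}\}$ for $k\le-1$, $U_o^-\varphi_{-1}=e^{-i\theta_{-1}}\varphi_{-1}$, and $U_o^-$ acting as $S_{2k+1}$ on $\mathrm{span}\{\varphi_{2k+1},\varphi_{2k+2}\}$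 for $k\le-2$. For $j\in\mathbb N$, $$\delta^+(j)=\max\{|r_jr_{j-1}-r_+^2|,\ |t_jt_{j-1}-t_+^2|,\ |t_jr_{j+1}-r_+t_+|,\ |t_jr_{j-1}-r_+t_+|\},$$ $$\delta^-(j)=\max\{|r_{-j}r_{-j+1}-r_-^2|,\ |t_{-j}t_{-j+1}-t_-^2|,\ |t_{-j}r_{-j-1}-r_-t_-|,\ |t_{-j}r_{-j+1}-r_-t_-|\}.$$ *)

theory Defs
  imports "HOL-Analysis.Analysis" "HOL-Library.Function_Algebras"
begin

section \<open>The Hilbert spaces \<open>\<ell>\<^sup>2(I)\<close>\<close>

text \<open>
  Vectors of \<open>\<ell>\<^sup>2(I)\<close> are square summable functions on the whole index type that vanish off
  \<open>I\<close>; addition and subtraction are pointwise (from \<open>Function_Algebras\<close>). An operator on a space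
  \<open>H\<close> of such functions is a map on the function type of which only the values on \<open>H\<close> matter.
\<close>

definition ell2 :: "'i set \<Rightarrow> ('i \<Rightarrow> complex) set" where
  "ell2 I = {f. (\<forall>i. i \<notin> I \<longrightarrow> f i = 0) \<and> (\<lambda>i. (norm (f i))\<^sup>2) summable_on I}"

definition ell2_inner :: "('i \<Rightarrow> complex) \<Rightarrow> ('i \<Rightarrow> complex) \<Rightarrow> complex" where
  "ell2_inner f g = (\<Sum>\<^sub>\<infinity>i. cnj (f i) * g i)"

definition ell2_norm :: "('i \<Rightarrow> complex) \<Rightarrow> real" where
  "ell2_norm f = sqrt (\<Sum>\<^sub>\<infinity>i. (norm (f i))\<^sup>2)"

definition cscale :: "complex \<Rightarrow> ('i \<Rightarrow> complex) \<Rightarrow> 'i \<Rightarrow> complex" where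
  "cscale c f = (\<lambda>i. c * f i)"

global_interpretation cfun: vector_space "cscale :: complex \<Rightarrow> ('i \<Rightarrow> complex) \<Rightarrow> 'i \<Rightarrow> complex"
  by unfold_locales (auto simp: cscale_def fun_eq_iff algebra_simps)

definition linear_between ::
  "('i \<Rightarrow> complex) set \<Rightarrow> ('j \<Rightarrow> complex) set \<Rightarrow> (('i \<Rightarrow> complex) \<Rightarrow> 'j \<Rightarrow> complex) \<Rightarrow> bool" where
  "linear_between M N A \<longleftrightarrow>
     A ` M \<subseteq> N \<and>
     (\<forall>f\<in>M. \<forall>g\<in>M. A (f + g) = A f + A g) \<and>
     (\<forall>c. \<forall>f\<in>M. A (cscale c f) = cscale c (A f))"

definition bounded_operator ::
  "('i \<Rightarrow> complex) set \<Rightarrow> (('i \<Rightarrow> complex) \<Rightarrow> 'i \<Rightarrow> complex) \<Rightarrow> bool" where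
  "bounded_operator H A \<longleftrightarrow>
     linear_between H H A \<and> (\<exists>C. \<forall>f\<in>H. ell2_norm (A f) \<le> C * ell2_norm f)"


section \<open>Spectrum and essential spectrum\<close>

definition op_spectrum ::
  "('i \<Rightarrow> complex) set \<Rightarrow> (('i \<Rightarrow> complex) \<Rightarrow> 'i \<Rightarrow> complex) \<Rightarrow> complex set" where
  "op_spectrum H A =
     {z. \<not> (\<exists>R. bounded_operator H R \<and>
               (\<forall>f\<in>H. R (A f - cscale z f) = f \<and> A (R f) - cscale z (R f) = f))}"

definition eigenspace ::
  "('i \<Rightarrow> complex) set \<Rightarrow> (('i \<Rightarrow> complex) \<Rightarrow> 'i \<Rightarrow> complex) \<Rightarrow> complex \<Rightarrow> ('i \<Rightarrow> complex) set" where
  "eigenspace H A z = {f\<in>H. A f = cscale z f}"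

definition discrete_spectrum ::
  "('i \<Rightarrow> complex) set \<Rightarrow> (('i \<Rightarrow> complex) \<Rightarrow> 'i \<Rightarrow> complex) \<Rightarrow> complex set" where
  "discrete_spectrum H A =
     {z. z isolated_in op_spectrum H A \<and>
         eigenspace H A z \<noteq> {0} \<and>
         (\<exists>B. finite B \<and> eigenspace H A z \<subseteq> cfun.span B)}"

text \<open>
  For the unitary operators considered here the usual definitions of the essential spectrum agree;
  this is the one obtained by removing the isolated eigenvalues of finite multiplicity.
\<close>

definition ess_spectrum ::
  "('i \<Rightarrow> complex) set \<Rightarrow> (('i \<Rightarrow> complex) \<Rightarrow> 'i \<Rightarrow> complex) \<Rightarrow> complex set" where
  "ess_spectrum H A = op_spectrum H A - discrete_spectrum H A"


section \<open>Absolutely continuous subspace and unitary equivalence\<close>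

text \<open>
  The spectral measure of a vector \<open>\<psi>\<close> for a unitary operator \<open>U\<close> is the unique finite Borel measure
  \<open>\<mu>\<close> on \<open>[0, 2\<pi>)\<close> with \<open>\<langle>\<psi>, U\<^sup>n \<psi>\<rangle> = \<integral> e\<^bsup>inx\<^esup> d\<mu>(x)\<close> for all integers \<open>n\<close>. The identities for
  negative \<open>n\<close> are the complex conjugates of those for positive \<open>n\<close>.
\<close>

definition is_spectral_measure ::
  "(('i \<Rightarrow> complex) \<Rightarrow> 'i \<Rightarrow> complex) \<Rightarrow> ('i \<Rightarrow> complex) \<Rightarrow> real measure \<Rightarrow> bool" where
  "is_spectral_measure U \<psi> \<mu> \<longleftrightarrow>
     finite_measure \<mu> \<and>
     sets \<mu> = sets (restrict_space borel {0..<2 * pi}) \<and>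
     (\<forall>n::nat. ell2_inner \<psi> ((U ^^ n) \<psi>) = (\<integral>x. cis (real n * x) \<partial>\<mu>))"

definition ac_subspace ::
  "('i \<Rightarrow> complex) set \<Rightarrow> (('i \<Rightarrow> complex) \<Rightarrow> 'i \<Rightarrow> complex) \<Rightarrow> ('i \<Rightarrow> complex) set" where
  "ac_subspace H U =
     {\<psi>\<in>H. \<exists>\<mu>. is_spectral_measure U \<psi> \<mu> \<and>
                absolutely_continuous (restrict_space lborel {0..<2 * pi}) \<mu>}"

text \<open>
  Unitary equivalence of the restriction of \<open>A\<close> to an invariant subspace \<open>M\<close> with the restriction of
  \<open>B\<close> to an invariant subspace \<open>N\<close>.
\<close>

definition unitarily_equivalent ::
  "('i \<Rightarrow> complex) set \<Rightarrow> (('i \<Rightarrow> complex) \<Rightarrow> 'i \<Rightarrow> complex) \<Rightarrow>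
   ('j \<Rightarrow> complex) set \<Rightarrow> (('j \<Rightarrow> complex) \<Rightarrow> 'j \<Rightarrow> complex) \<Rightarrow> bool" where
  "unitarily_equivalent M A N B \<longleftrightarrow>
     (\<exists>W. linear_between M N W \<and> bij_betw W M N \<and>
          (\<forall>f\<in>M. \<forall>g\<in>M. ell2_inner (W f) (W g) = ell2_inner f g) \<and>
          (\<forall>f\<in>M. W (A f) = B (W f)))"

text \<open>The direct sum of \<open>\<ell>\<^sup>2(I)\<close> and \<open>\<ell>\<^sup>2(J)\<close> is realised as \<open>\<ell>\<^sup>2(I <+> J)\<close>.\<close>

definition direct_sum_space ::
  "('i \<Rightarrow> complex) set \<Rightarrow> ('j \<Rightarrow> complex) set \<Rightarrow> ('i + 'j \<Rightarrow> complex) set" where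
  "direct_sum_space M N = {case_sum f g |f g. f \<in> M \<and> g \<in> N}"

definition direct_sum_op ::
  "(('i \<Rightarrow> complex) \<Rightarrow> 'i \<Rightarrow> complex) \<Rightarrow> (('j \<Rightarrow> complex) \<Rightarrow> 'j \<Rightarrow> complex) \<Rightarrow>
   ('i + 'j \<Rightarrow> complex) \<Rightarrow> 'i + 'j \<Rightarrow> complex" where
  "direct_sum_op A B h = case_sum (A (h \<circ> Inl)) (B (h \<circ> Inr))"


section \<open>The unitary band operators\<close>

definition S_mat ::
  "(int \<Rightarrow> real) \<Rightarrow> (int \<Rightarrow> real) \<Rightarrow> (int \<Rightarrow> real) \<Rightarrow> (int \<Rightarrow> real) \<Rightarrow> (int \<Rightarrow> real) \<Rightarrow>
   int \<Rightarrow> complex^2^2" where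
  "S_mat \<theta> \<alpha> \<gamma> t r k =
     (let c = cis (- \<theta> k) in
      vector [vector [c * (r k * cis (- \<alpha> k)), c * (\<i> * t k * cis (\<gamma> k))],
              vector [c * (\<i> * t k * cis (- \<gamma> k)), c * (r k * cis (\<alpha> k))]])"

text \<open>
  \<open>block_op p S\<close> acts as \<open>S k\<close> on the span of \<open>\<phi>\<^sub>k, \<phi>\<^sub>k\<^sub>+\<^sub>1\<close> (in this order), for every \<open>k\<close> with
  \<open>k mod 2 = p\<close>. It is written in coordinates, i.e. \<open>\<psi> = \<Sum>\<^sub>k \<psi>(k) \<phi>\<^sub>k\<close>.
\<close>

definition block_op :: "int \<Rightarrow> (int \<Rightarrow> complex^2^2) \<Rightarrow> (int \<Rightarrow> complex) \<Rightarrow> int \<Rightarrow> complex" where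
  "block_op p S \<psi> j =
     (if j mod 2 = p then (S j *v vector [\<psi> j, \<psi> (j + 1)]) $ 1
      else (S (j - 1) *v vector [\<psi> (j - 1), \<psi> j]) $ 2)"

definition U_full :: "(int \<Rightarrow> complex^2^2) \<Rightarrow> (int \<Rightarrow> complex) \<Rightarrow> int \<Rightarrow> complex" where
  "U_full S = block_op 1 S \<circ> block_op 0 S"

definition Ue_plus :: "(int \<Rightarrow> real) \<Rightarrow> (int \<Rightarrow> complex^2^2) \<Rightarrow> (int \<Rightarrow> complex) \<Rightarrow> int \<Rightarrow> complex" where
  "Ue_plus \<theta> S \<psi> j =
     (if j = 1 then cis (- \<theta> 0) * \<psi> 1 else if j \<ge> 2 then block_op 0 S \<psi> j else 0)"

definition Uo_plus :: "(int \<Rightarrow> complex^2^2) \<Rightarrow> (int \<Rightarrow> complex) \<Rightarrow> int \<Rightarrow> complex" where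
  "Uo_plus S \<psi> j = (if j \<ge> 1 then block_op 1 S \<psi> j else 0)"

definition U_plus :: "(int \<Rightarrow> real) \<Rightarrow> (int \<Rightarrow> complex^2^2) \<Rightarrow> (int \<Rightarrow> complex) \<Rightarrow> int \<Rightarrow> complex" where
  "U_plus \<theta> S = Uo_plus S \<circ> Ue_plus \<theta> S"

definition Ue_minus :: "(int \<Rightarrow> complex^2^2) \<Rightarrow> (int \<Rightarrow> complex) \<Rightarrow> int \<Rightarrow> complex" where
  "Ue_minus S \<psi> j = (if j \<le> -1 then block_op 0 S \<psi> j else 0)"

definition Uo_minus :: "(int \<Rightarrow> real) \<Rightarrow> (int \<Rightarrow> complex^2^2) \<Rightarrow> (int \<Rightarrow> complex) \<Rightarrow> int \<Rightarrow> complex" where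
  "Uo_minus \<theta> S \<psi> j =
     (if j = -1 then cis (- \<theta> (-1)) * \<psi> (-1) else if j \<le> -2 then block_op 1 S \<psi> j else 0)"

definition U_minus :: "(int \<Rightarrow> real) \<Rightarrow> (int \<Rightarrow> complex^2^2) \<Rightarrow> (int \<Rightarrow> complex) \<Rightarrow> int \<Rightarrow> complex" where
  "U_minus \<theta> S = Uo_minus \<theta> S \<circ> Ue_minus S"

text \<open>
  The half-line operators involve \<open>S k\<close> only for \<open>k \<ge> 1\<close> and \<open>k \<le> -2\<close> respectively, so taking the
  coefficients constant on all of \<open>\<int>\<close> is the same as fixing them on the half-line only.
\<close>

definition U_plus_lim ::
  "(int \<Rightarrow> real) \<Rightarrow> (int \<Rightarrow> real) \<Rightarrow> (int \<Rightarrow> real) \<Rightarrow> real \<Rightarrow> real \<Rightarrow>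
   (int \<Rightarrow> complex) \<Rightarrow> int \<Rightarrow> complex" where
  "U_plus_lim \<theta> \<alpha> \<gamma> tp rp = U_plus \<theta> (S_mat \<theta> \<alpha> \<gamma> (\<lambda>_. tp) (\<lambda>_. rp))"

definition U_minus_lim ::
  "(int \<Rightarrow> real) \<Rightarrow> (int \<Rightarrow> real) \<Rightarrow> (int \<Rightarrow> real) \<Rightarrow> real \<Rightarrow> real \<Rightarrow>
   (int \<Rightarrow> complex) \<Rightarrow> int \<Rightarrow> complex" where
  "U_minus_lim \<theta> \<alpha> \<gamma> tm rm = U_minus \<theta> (S_mat \<theta> \<alpha> \<gamma> (\<lambda>_. tm) (\<lambda>_. rm))"

definition delta_plus :: "(int \<Rightarrow> real) \<Rightarrow> (int \<Rightarrow> real) \<Rightarrow> real \<Rightarrow> real \<Rightarrow> nat \<Rightarrow> real" where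
  "delta_plus t r tp rp n =
     (let j = int n in
      Max {\<bar>r j * r (j - 1) - rp\<^sup>2\<bar>, \<bar>t j * t (j - 1) - tp\<^sup>2\<bar>,
           \<bar>t j * r (j + 1) - rp * tp\<bar>, \<bar>t j * r (j - 1) - rp * tp\<bar>})"

definition delta_minus :: "(int \<Rightarrow> real) \<Rightarrow> (int \<Rightarrow> real) \<Rightarrow> real \<Rightarrow> real \<Rightarrow> nat \<Rightarrow> real" where
  "delta_minus t r tm rm n =
     (let j = int n in
      Max {\<bar>r (- j) * r (- j + 1) - rm\<^sup>2\<bar>, \<bar>t (- j) * t (- j + 1) - tm\<^sup>2\<bar>,
           \<bar>t (- j) * r (- j - 1) - rm * tm\<bar>, \<bar>t (- j) * r (- j + 1) - rm * tm\<bar>})"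

end

theory Submission
  imports Defs "HOL-Probability.Helly_Selection"
begin

text \<open>
  Replace the coefficients of \<open>U\<close> by their limits on both half-lines and make the blocks \<open>S\<^sub>-\<^sub>1\<close> and \<open>S\<^sub>0\<close>
  diagonal. The resulting unitary operator \<open>V\<close> on \<open>\<ell>\<^sup>2(\<int>)\<close> is \<open>U\<^sup>-(t\<^sub>-) \<oplus> c \<oplus> U\<^sup>+(t\<^sub>+)\<close> with a phase \<open>c\<close> on
  the span of \<open>\<phi>\<^sub>0\<close>, and \<open>U - V\<close> is a band operator whose entries tend to \<open>0\<close>, hence is compact. The first
  claim is then Weyl's theorem. A point is in the essential spectrum iff it has approximate eigenvectors
  that are almost orthogonal to any given finite set; that isolated eigenvalues of finite multiplicity
  do not have this property follows from spectral measures, which exist by Herglotz' theorem.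

  If \<open>\<delta>\<^sup>\<plusminus>(j) = O(j\<^sup>-\<^sup>2\<^sup>\<epsilon>)\<close> with \<open>2\<epsilon> > 1\<close>, the entries of \<open>U - V\<close> are summable, so \<open>U - V\<close> is of trace class, and
  the second claim is the Kato--Rosenblum theorem for unitary operators. If the spectral measure of \<open>x\<close>
  has a bounded density, then \<open>\<Sum>\<^sub>n |\<langle>y, V\<^sup>n x\<rangle>|\<^sup>2 \<le> C \<parallel>y\<parallel>\<^sup>2\<close> for all \<open>y\<close>, and for such \<open>x\<close> Pearson's argument shows
  that \<open>U\<^sup>-\<^sup>n V\<^sup>n x\<close> converges. These \<open>x\<close> are dense in the absolutely continuous subspace, and exchanging
  \<open>U\<close> and \<open>V\<close> inverts the wave operator.
\<close>

section \<open>Complex Hilbert spaces\<close>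

text \<open>The functional calculus is built from Laurent polynomials p alone. By
  \<open>norm_tp_op\<close> the norm of p(A)x is an integral against the scalar spectral measure of
  x, and the projection of x onto a closed part of the spectrum is a norm limit of vectors p(A)x.
  Spectral measures of different vectors are compared through norms of p(A)x, which behave well
  under projections and orthogonal sums. The half-line operators get no Hilbert space of their own:
  they are one operator V seen on two of its reducing subspaces, so the spectral notions carry a
  subspace H as parameter. The leftover vector \<phi>_0 must be invisible twice: its span is finite
  dimensional, so one more test vector removes it from Weyl's criterion, and it is an eigenvector,
  so it contributes nothing absolutely continuous. The trace class property enters through a
  quadratic form that turns square summability of orbits into summability of the defect of U - V
  along the orbit. The form is symmetric in U and V, so both wave operators come from one
  argument.\<close>

class complex_hilbert = real_inner + complete_space +
  fixes scaleC :: "complex \<Rightarrow> 'a \<Rightarrow> 'a"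
  assumes scaleC_add_right: "scaleC c (x + y) = scaleC c x + scaleC c y"
    and scaleC_add_left: "scaleC (c + d) x = scaleC c x + scaleC d x"
    and scaleC_scaleC [simp]: "scaleC c (scaleC d x) = scaleC (c * d) x"
    and scaleC_of_real: "scaleC (complex_of_real s) x = scaleR s x"
    and norm_scaleC [simp]: "norm (scaleC c x) = cmod c * norm x"

text \<open>Conjugate linear in the first argument, like \<open>ell2_inner\<close>. The imaginary
  part is recovered from the real inner product because Re(-i z) = Im z.\<close>

definition cinner :: "'a::complex_hilbert \<Rightarrow> 'a \<Rightarrow> complex" where
  "cinner x y = Complex (inner x y) (inner (scaleC \<i> x) y)"

lemma scaleC_one [simp]: "scaleC 1 x = x"
  using scaleC_of_real[of 1 x] by simp

lemma scaleC_zero_left [simp]: "scaleC 0 x = 0"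
  using scaleC_of_real[of 0 x] by simp

lemma scaleC_zero_right [simp]: "scaleC c 0 = 0"
  using scaleC_add_right[of c 0 0] by simp

lemma scaleC_minus_right: "scaleC c (- x) = - scaleC c x"
  using scaleC_add_right[of c x "-x"] by (simp add: eq_neg_iff_add_eq_0 add.commute)

lemma scaleC_diff_right: "scaleC c (x - y) = scaleC c x - scaleC c y"
  using scaleC_add_right[of c x "-y"] by (simp add: scaleC_minus_right)

lemma scaleC_minus_left: "scaleC (- c) x = - scaleC c x"
  using scaleC_add_left[of c "-c" x] by (simp add: eq_neg_iff_add_eq_0 add.commute)

lemma scaleC_diff_left: "scaleC (c - d) x = scaleC c x - scaleC d x"
  using scaleC_add_left[of c "-d" x] by (simp add: scaleC_minus_left)

lemma scaleC_scaleR: "scaleC c (scaleR s x) = scaleR s (scaleC c x)"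
  by (metis scaleC_of_real scaleC_scaleC mult.commute)

lemma scaleC_minus_one [simp]: "scaleC (- 1) x = - x"
  using scaleC_minus_left[of 1 x] by simp

lemma bounded_linear_scaleC: "bounded_linear (scaleC c)"
  by (rule bounded_linear_intro[where K = "cmod c"]) (auto simp: scaleC_add_right scaleC_scaleR mult.commute)

text \<open>Polarisation of the fact that multiplication by i preserves the norm. The complex
  structure is thus orthogonal for the real inner product, and the sesquilinearity of
  \<open>cinner\<close> rests on this.\<close>

lemma inner_i_self: "inner (scaleC \<i> x) (scaleC \<i> y) = inner x y"
proof -
  have "(norm (scaleC \<i> (x + y)))\<^sup>2 = (norm (x + y))\<^sup>2" by simp
  then show ?thesis
    by (simp add: scaleC_add_right power2_norm_eq_inner inner_add inner_commute)
       (simp add: power2_norm_eq_inner[symmetric] inner_commute)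
qed

lemma inner_i_left: "inner (scaleC \<i> x) y = - inner x (scaleC \<i> y)"
  using inner_i_self[of x "scaleC \<i> y"] by simp

lemma inner_scaleC_right: "inner x (scaleC c y) = Re c * inner x y + Im c * inner x (scaleC \<i> y)"
proof -
  have "scaleC c y = scaleC (of_real (Re c)) y + scaleC (of_real (Im c)) (scaleC \<i> y)"
    by (metis complex_eq mult.commute scaleC_add_left scaleC_scaleC)
  then show ?thesis by (simp only: scaleC_of_real inner_add_right inner_scaleR_right)
qed

lemma cinner_add_right: "cinner x (y + z) = cinner x y + cinner x z"
  by (simp add: cinner_def inner_add complex_eq_iff)

lemma cinner_add_left: "cinner (x + y) z = cinner x z + cinner y z"
  by (simp add: cinner_def inner_add scaleC_add_right complex_eq_iff)

lemma cinner_diff_right: "cinner x (y - z) = cinner x y - cinner x z"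
  by (simp add: cinner_def inner_diff complex_eq_iff)

lemma cinner_diff_left: "cinner (x - y) z = cinner x z - cinner y z"
  by (simp add: cinner_def inner_diff scaleC_diff_right complex_eq_iff)

lemma cinner_commute: "cinner x y = cnj (cinner y x)"
  using inner_i_left[of x y] by (simp add: cinner_def complex_eq_iff inner_commute)

lemma cinner_zero_left [simp]: "cinner 0 y = 0"
  by (simp add: cinner_def complex_eq_iff)

lemma cinner_zero_right [simp]: "cinner x 0 = 0"
  by (simp add: cinner_def complex_eq_iff)

lemma cinner_scaleC_right: "cinner x (scaleC c y) = c * cinner x y"
  using inner_i_left[of x y] inner_i_self[of x y]
  by (simp add: cinner_def complex_eq_iff inner_scaleC_right[of _ c] inner_i_left[of x "scaleC \<i> y"]
        scaleC_minus_left algebra_simps)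

lemma cinner_scaleC_left: "cinner (scaleC c x) y = cnj c * cinner x y"
  using cinner_commute[of "scaleC c x" y] cinner_commute[of x y] by (simp add: cinner_scaleC_right)

lemma cinner_sum_right: "cinner x (sum f S) = (\<Sum>i\<in>S. cinner x (f i))"
  by (induction S rule: infinite_finite_induct) (auto simp: cinner_add_right)

lemma cinner_sum_left: "cinner (sum f S) x = (\<Sum>i\<in>S. cinner (f i) x)"
  by (induction S rule: infinite_finite_induct) (auto simp: cinner_add_left)

lemma Re_cinner [simp]: "Re (cinner x y) = inner x y"
  by (simp add: cinner_def)

lemma cinner_self: "cinner x x = of_real ((norm x)\<^sup>2)"
  using inner_i_left[of x x]
  by (simp add: cinner_def complex_eq_iff power2_norm_eq_inner inner_commute)

text \<open>A phase u turns the complex inner product into a nonnegative real one, to which the real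
  Cauchy-Schwarz inequality applies.\<close>

lemma norm_cinner_le: "cmod (cinner x y) \<le> norm x * norm y"
proof (cases "cinner x y = 0")
  case False
  define u where "u = cnj (cinner x y) / cmod (cinner x y)"
  have u: "cmod u = 1" using False by (simp add: u_def norm_divide)
  have "cinner x (scaleC u y) = of_real (cmod (cinner x y))"
    using False by (simp add: cinner_scaleC_right u_def complex_norm_square[symmetric] power2_eq_square field_simps)
  then have "inner x (scaleC u y) = cmod (cinner x y)" by (metis Re_cinner Re_complex_of_real)
  with norm_cauchy_schwarz[of x "scaleC u y"] u show ?thesis by simp
qed auto

lemma abs_inner_le_cinner: "\<bar>inner x y\<bar> \<le> cmod (cinner x y)"
  using abs_Re_le_cmod[of "cinner x y"] by simp

lemma bounded_bilinear_cinner: "bounded_bilinear cinner"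
proof
  fix a b :: 'a and r :: real
  show "cinner (scaleR r a) b = r *\<^sub>R cinner a b" "cinner a (scaleR r b) = r *\<^sub>R cinner a b"
    by (simp_all add: scaleC_of_real[symmetric] cinner_scaleC_left cinner_scaleC_right scaleR_conv_of_real)
  show "\<exists>K. \<forall>a b :: 'a. cmod (cinner a b) \<le> norm a * norm b * K"
    by (intro exI[of _ 1]) (auto simp: norm_cinner_le)
qed (auto simp: cinner_add_left cinner_add_right)

lemmas tendsto_cinner = bounded_bilinear.tendsto[OF bounded_bilinear_cinner]
lemmas tendsto_scaleC = bounded_linear.tendsto[OF bounded_linear_scaleC]

text \<open>Closed under complex scalars, while \<open>subspace\<close>, \<open>span\<close> and
  \<open>independent\<close> refer to the real structure; dimension counts therefore pair a vector u
  with \<open>scaleC \<i> u\<close>.\<close>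

definition csubspace :: "'a::complex_hilbert set \<Rightarrow> bool" where
  "csubspace H \<longleftrightarrow> 0 \<in> H \<and> (\<forall>x\<in>H. \<forall>y\<in>H. x + y \<in> H) \<and> (\<forall>c. \<forall>x\<in>H. scaleC c x \<in> H)"

lemma csubspaceD:
  assumes "csubspace H"
  shows "0 \<in> H" "x \<in> H \<Longrightarrow> y \<in> H \<Longrightarrow> x + y \<in> H" "x \<in> H \<Longrightarrow> scaleC c x \<in> H"
    "x \<in> H \<Longrightarrow> y \<in> H \<Longrightarrow> x - y \<in> H"
proof -
  show "0 \<in> H" "x \<in> H \<Longrightarrow> y \<in> H \<Longrightarrow> x + y \<in> H" "x \<in> H \<Longrightarrow> scaleC c x \<in> H" for x y c
    using assms by (auto simp: csubspace_def)
  from this(2)[of x "- y"] this(3)[of y "-1"]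
  show "x \<in> H \<Longrightarrow> y \<in> H \<Longrightarrow> x - y \<in> H" by (simp add: scaleC_minus_left)
qed

lemma csubspace_UNIV [simp]: "csubspace UNIV"
  by (simp add: csubspace_def)

lemma csubspace_sum: "csubspace H \<Longrightarrow> (\<And>i. i \<in> S \<Longrightarrow> f i \<in> H) \<Longrightarrow> sum f S \<in> H"
  by (induction S rule: infinite_finite_induct) (auto simp: csubspaceD)

section \<open>Trigonometric polynomials\<close>

text \<open>
  The list of pairs \<open>(n, c)\<close> stands for \<open>\<Sum> c z\<^sup>n\<close>; repeated exponents are allowed, so that the
  operations need no normalisation.
\<close>

type_synonym trig_poly = "(int \<times> complex) list"

definition tp_eval :: "trig_poly \<Rightarrow> complex \<Rightarrow> complex" where
  "tp_eval p z = (\<Sum>(n, c)\<leftarrow>p. c * z powi n)"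

definition tp_mult :: "trig_poly \<Rightarrow> trig_poly \<Rightarrow> trig_poly" where
  "tp_mult p q = concat (map (\<lambda>(m, c). map (\<lambda>(n, d). (m + n, c * d)) q) p)"

definition tp_cnj :: "trig_poly \<Rightarrow> trig_poly" where
  "tp_cnj p = map (\<lambda>(n, c). (- n, cnj c)) p"

lemma tp_eval_Nil [simp]: "tp_eval [] z = 0" by (simp add: tp_eval_def)

lemma tp_eval_Cons [simp]: "tp_eval ((n, c) # p) z = c * z powi n + tp_eval p z" by (simp add: tp_eval_def)

lemma tp_eval_append [simp]: "tp_eval (p @ q) z = tp_eval p z + tp_eval q z" by (simp add: tp_eval_def)

lemma tp_mult_Nil [simp]: "tp_mult [] q = []" by (simp add: tp_mult_def)

lemma tp_mult_Cons: "tp_mult ((m, c) # p) q = map (\<lambda>(n, d). (m + n, c * d)) q @ tp_mult p q"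
  by (simp add: tp_mult_def)

lemma tp_eval_shift:
  assumes "z \<noteq> 0"
  shows "tp_eval (map (\<lambda>(n, d). (m + n, c * d)) q) z = c * z powi m * tp_eval q z"
  using assms by (induction q) (auto simp: power_int_add algebra_simps)

lemma tp_eval_mult: "z \<noteq> 0 \<Longrightarrow> tp_eval (tp_mult p q) z = tp_eval p z * tp_eval q z"
  by (induction p) (auto simp: tp_mult_Cons tp_eval_shift algebra_simps)

text \<open>On the unit circle the inverse is the conjugate, so conjugation stays within Laurent
  polynomials; \<open>tp_cnj\<close> becomes the symbol of the adjoint.\<close>

lemma tp_eval_cnj:
  assumes "cmod z = 1"
  shows "tp_eval (tp_cnj p) z = cnj (tp_eval p z)"
proof -
  have 1: "z powi (- n) = cnj (z powi n)" for n
  proof -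
    have "cnj (z powi n) * z powi n = of_real ((cmod (z powi n))\<^sup>2)"
      by (metis complex_norm_square mult.commute)
    then have "cnj (z powi n) * z powi n = 1" using assms by (simp add: norm_power_int)
    then show ?thesis
      by (simp add: power_int_minus inverse_unique mult.commute)
  qed
  show ?thesis
    by (induction p) (auto simp: tp_cnj_def 1)
qed

lemma continuous_on_tp_eval: "0 \<notin> S \<Longrightarrow> continuous_on S (tp_eval p)"
proof (induction p)
  case (Cons a p)
  then show ?case by (cases a) (auto intro!: continuous_intros)
qed (auto simp: tp_eval_def)

lemma continuous_tp_eval_cis: "continuous_on S (\<lambda>t. tp_eval p (cis t))"
  by (rule continuous_on_compose2[OF continuous_on_tp_eval[of "-{0}"]])
     (auto intro!: continuous_intros simp: cis_neq_zero)

lemma borel_measurable_tp_eval_cis [measurable]: "(\<lambda>t. tp_eval p (cis t)) \<in> borel_measurable borel"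
  by (intro borel_measurable_continuous_onI continuous_tp_eval_cis)

lemma tp_eval_cis_bounded: "\<exists>B. \<forall>t. cmod (tp_eval p (cis t)) \<le> B"
proof (induction p)
  case (Cons a p)
  then obtain B where B: "\<And>t. cmod (tp_eval p (cis t)) \<le> B" by auto
  show ?case
  proof (cases a)
    case (Pair n c)
    have "cmod (tp_eval (a # p) (cis t)) \<le> cmod c + B" for t
      using B[of t] norm_triangle_ineq[of "c * cis t powi n" "tp_eval p (cis t)"]
      by (simp add: Pair norm_mult norm_power_int)
    then show ?thesis by blast
  qed
qed auto

text \<open>Stone-Weierstrass for the real functions on the circle that are values of Laurent
  polynomials. They form an algebra, and Re z = (z + 1/z)/2 together with Im z = (z - 1/z)/(2i)
  separates points.\<close>

lemma tp_approx_continuous: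
  fixes g :: "complex \<Rightarrow> real"
  assumes "continuous_on (sphere 0 1) g" "0 < e"
  shows "\<exists>p. \<forall>z\<in>sphere 0 1. cmod (tp_eval p z - of_real (g z)) < e"
proof -
  let ?S = "sphere 0 1 :: complex set"
  let ?P = "\<lambda>f. \<exists>p. \<forall>z\<in>?S. tp_eval p z = complex_of_real (f z)"
  have "\<exists>f. ?P f \<and> (\<forall>z\<in>?S. \<bar>g z - f z\<bar> < e)"
  proof (rule Stone_Weierstrass_HOL[where P = ?P])
    show "?P (\<lambda>x. c)" for c by (rule exI[of _ "[(0, of_real c)]"]) auto
    show "continuous_on ?S f" if "?P f" for f
    proof -
      from that obtain p where p: "\<forall>z\<in>?S. tp_eval p z = complex_of_real (f z)" by blast
      have "continuous_on ?S (\<lambda>z. Re (tp_eval p z))"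
        by (intro continuous_intros continuous_on_tp_eval) auto
      then show ?thesis by (rule continuous_on_eq) (use p in auto)
    qed
    show "?P (\<lambda>x. f x + h x)" if "?P f \<and> ?P h" for f h
    proof -
      from that obtain p q where "\<forall>z\<in>?S. tp_eval p z = complex_of_real (f z)"
        "\<forall>z\<in>?S. tp_eval q z = complex_of_real (h z)" by blast
      then show ?thesis by (intro exI[of _ "p @ q"]) auto
    qed
    show "?P (\<lambda>x. f x * h x)" if "?P f \<and> ?P h" for f h
    proof -
      from that obtain p q where pq: "\<forall>z\<in>?S. tp_eval p z = complex_of_real (f z)"
        "\<forall>z\<in>?S. tp_eval q z = complex_of_real (h z)" by blast
      show ?thesis
      proof (intro exI[of _ "tp_mult p q"] ballI)
        fix z :: complex assume z: "z \<in> ?S"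
        then have "z \<noteq> 0" by auto
        then show "tp_eval (tp_mult p q) z = of_real (f z * h z)"
          using pq z by (simp add: tp_eval_mult)
      qed
    qed
    have inv: "z powi -1 = cnj z" if "z \<in> ?S" for z
      using tp_eval_cnj[of z "[(1,1)]"] that by (simp add: tp_cnj_def)
    have Re: "?P Re"
      by (rule exI[of _ "[(1, 1/2), (-1, 1/2)]"]) (use inv in \<open>auto simp: complex_eq_iff\<close>)
    have Im: "?P Im"
      by (rule exI[of _ "[(1, -\<i>/2), (-1, \<i>/2)]"]) (use inv in \<open>auto simp: complex_eq_iff\<close>)
    show "\<exists>f. ?P f \<and> f x \<noteq> f y" if "x \<in> ?S \<and> y \<in> ?S \<and> x \<noteq> y" for x y
      using that Re Im by (metis complex_eqI)
  qed (use assms in auto)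
  then obtain f p where f: "\<forall>z\<in>?S. \<bar>g z - f z\<bar> < e" "\<forall>z\<in>?S. tp_eval p z = complex_of_real (f z)" by auto
  have "cmod (tp_eval p z - of_real (g z)) = \<bar>g z - f z\<bar>" if "z \<in> ?S" for z
    using f(2) that by (simp add: norm_minus_commute flip: of_real_diff)
  then show ?thesis using f(1) by (metis (no_types, lifting))
qed

text \<open>The bound 2 is uniform in n, so the convergence to the indicator is fit for dominated
  convergence under any finite measure.\<close>

lemma tp_approx_closed:
  fixes L :: "complex set"
  assumes "closed L"
  shows "\<exists>P. (\<forall>n::nat. \<forall>z\<in>sphere 0 1. cmod (tp_eval (P n) z) \<le> 2) \<and>
             (\<forall>z\<in>sphere 0 1. (\<lambda>n. tp_eval (P n) z) \<longlonglongrightarrow> indicator L z)"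
\<comment> \<open>For empty L the distance \<open>infdist\<close> is 0 by convention, and the tents
  used below would be constantly 1.\<close>
proof (cases "L = {}")
  case True
  then show ?thesis by (intro exI[of _ "\<lambda>_. []"]) auto
next
  case False
  \<comment> \<open>Tents of slope n: equal to 1 on L, and 0 from some n on at each point off L,
    because such a point has positive distance to the closed set L.\<close>
  define g where "g n z = max 0 (1 - real n * infdist z L)" for n :: nat and z
  have "\<exists>p. \<forall>z\<in>sphere 0 1. cmod (tp_eval p z - of_real (g n z)) < 1 / Suc n" for n
    unfolding g_def by (intro tp_approx_continuous continuous_intros) auto
  then obtain P where P: "\<And>n z. z \<in> sphere 0 1 \<Longrightarrow> cmod (tp_eval (P n) z - of_real (g n z)) < 1 / Suc n"
    by metis
  have g01: "0 \<le> g n z" "g n z \<le> 1" for n z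
    by (auto simp: g_def infdist_nonneg)
  have bound: "cmod (tp_eval (P n) z) \<le> 2" if "z \<in> sphere 0 1" for n z
  proof -
    have "cmod (tp_eval (P n) z) \<le> cmod (tp_eval (P n) z - of_real (g n z)) + cmod (of_real (g n z) :: complex)"
      by (metis diff_add_cancel norm_triangle_ineq)
    also have "\<dots> \<le> 1 / Suc n + 1" using P[OF that, of n] g01[where n = n and z = z] by (intro add_mono) auto
    also have "\<dots> \<le> 2" by simp
    finally show ?thesis .
  qed
  have lim_g: "(\<lambda>n. g n z) \<longlonglongrightarrow> indicator L z" for z
  proof (cases "z \<in> L")
    case True
    then show ?thesis by (simp add: g_def)
  next
    case zL: False
    then have d: "infdist z L > 0"
      using assms False by (metis in_closed_iff_infdist_zero infdist_nonneg less_eq_real_def)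
    have "\<forall>\<^sub>F n in sequentially. g n z = 0"
    proof -
      obtain N :: nat where "1 / infdist z L < N" using reals_Archimedean2 by blast
      then have "1 \<le> real n * infdist z L" if "n \<ge> N" for n
        using d that by (simp add: field_simps) (smt (verit, best) mult_mono of_nat_mono of_nat_0_le_iff)
      then show ?thesis unfolding eventually_sequentially g_def by (intro exI[of _ N]) auto
    qed
    with zL show ?thesis by (simp add: tendsto_eventually)
  qed
  have "(\<lambda>n. tp_eval (P n) z) \<longlonglongrightarrow> indicator L z" if z: "z \<in> sphere 0 1" for z
  proof -
    have "(\<lambda>n. tp_eval (P n) z - of_real (g n z)) \<longlonglongrightarrow> 0"
      by (rule Lim_null_comparison[OF _ LIMSEQ_inverse_real_of_nat])
         (use P[OF z] in \<open>auto intro!: always_eventually less_imp_le simp: inverse_eq_divide\<close>)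
    from tendsto_add[OF this tendsto_of_real[OF lim_g[of z]]]
    show ?thesis by (cases "z \<in> L") simp_all
  qed
  with bound show ?thesis by blast
qed

section \<open>Unitary operators and their spectral measures\<close>

locale unitary_operator =
  fixes A :: "'a::complex_hilbert \<Rightarrow> 'a"
  assumes add: "A (x + y) = A x + A y"
    and scale: "A (scaleC c x) = scaleC c (A x)"
    and norm_A [simp]: "norm (A x) = norm x"
    and surj_A: "surj A"
begin

lemma diff: "A (x - y) = A x - A y"
  using add[of "x - y" y] by simp

lemma zero [simp]: "A 0 = 0"
  using diff[of 0 0] by simp

lemma inj_A: "inj A"
proof (rule injI)
  fix x y assume "A x = A y"
  then have "norm (A (x - y)) = 0" by (simp add: diff)
  then show "x = y" by simp
qed

definition Ai :: "'a \<Rightarrow> 'a" where "Ai = inv A"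

lemma A_Ai [simp]: "A (Ai x) = x"
  by (simp add: Ai_def surj_f_inv_f surj_A)

lemma Ai_A [simp]: "Ai (A x) = x"
  by (simp add: Ai_def inj_A)

lemma Ai_eqI: "A y = x \<Longrightarrow> Ai x = y" by auto

lemma Ai_add: "Ai (x + y) = Ai x + Ai y"
  by (rule Ai_eqI) (simp add: add)

lemma Ai_scale: "Ai (scaleC c x) = scaleC c (Ai x)"
  by (rule Ai_eqI) (simp add: scale)

lemma norm_Ai [simp]: "norm (Ai x) = norm x"
  using norm_A[of "Ai x"] by simp

lemma unitary_Ai: "unitary_operator Ai"
  by unfold_locales (auto simp: Ai_add Ai_scale intro!: surjI[of _ A])

lemma inner_A [simp]: "inner (A x) (A y) = inner x y"
proof -
  have "(norm (A (x + y)))\<^sup>2 = (norm (x + y))\<^sup>2" by simp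
  then show ?thesis
    unfolding add power2_norm_eq_inner inner_add
    by (simp add: power2_norm_eq_inner[symmetric] inner_commute)
qed

lemma cinner_A [simp]: "cinner (A x) (A y) = cinner x y"
  by (simp add: cinner_def scale[symmetric])

section \<open>Integer powers of a unitary operator\<close>

definition ipow :: "int \<Rightarrow> 'a \<Rightarrow> 'a" where
  "ipow n x = (if n \<ge> 0 then (A ^^ nat n) x else (Ai ^^ nat (- n)) x)"

lemma ipow_of_nat: "ipow (int n) x = (A ^^ n) x"
  by (simp add: ipow_def)

lemma ipow_0 [simp]: "ipow 0 x = x"
  by (simp add: ipow_def)

lemma A_ipow: "A (ipow n x) = ipow (n + 1) x"
proof (cases "n \<ge> 0")
  case True
  then have "nat (n + 1) = Suc (nat n)" by simp
  then show ?thesis using True by (simp add: ipow_def)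
next
  case False
  then have 1: "nat (- n) = Suc (nat (- (n + 1)))" by simp
  have "ipow (n + 1) x = (Ai ^^ nat (- (n + 1))) x"
    using False by (cases "n = -1") (auto simp: ipow_def)
  moreover have "ipow n x = Ai ((Ai ^^ nat (- (n + 1))) x)"
    using False by (simp add: ipow_def 1)
  ultimately show ?thesis by simp
qed

lemma ipow_1 [simp]: "ipow 1 x = A x"
  using A_ipow[of 0 x] by simp

lemma Ai_ipow: "Ai (ipow n x) = ipow (n - 1) x"
  using A_ipow[of "n - 1" x] by (intro Ai_eqI) simp

lemma ipow_ipow: "ipow m (ipow n x) = ipow (m + n) x"
proof (induction m rule: int_induct[of _ 0])
  case (step1 i)
  then show ?case using A_ipow[of i "ipow n x"] A_ipow[of "i + n" x] by (simp add: algebra_simps)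
next
  case (step2 i)
  then show ?case using Ai_ipow[of i "ipow n x"] Ai_ipow[of "i + n" x] by (simp add: algebra_simps)
qed simp

lemma ipow_add: "ipow n (x + y) = ipow n x + ipow n y"
proof (induction n rule: int_induct[of _ 0])
  case (step1 i)
  then show ?case by (simp add: A_ipow[symmetric] add)
next
  case (step2 i)
  then show ?case by (simp add: Ai_ipow[symmetric] Ai_add)
qed simp

lemma ipow_scale: "ipow n (scaleC c x) = scaleC c (ipow n x)"
proof (induction n rule: int_induct[of _ 0])
  case (step1 i)
  then show ?case by (simp add: A_ipow[symmetric] scale)
next
  case (step2 i)
  then show ?case by (simp add: Ai_ipow[symmetric] Ai_scale)
qed simp

lemma norm_ipow [simp]: "norm (ipow n x) = norm x"
proof (induction n rule: int_induct[of _ 0])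
  case (step1 i)
  then show ?case by (simp add: A_ipow[symmetric])
next
  case (step2 i)
  then show ?case by (simp add: Ai_ipow[symmetric])
qed simp

lemma unitary_ipow: "unitary_operator (ipow n)"
  by unfold_locales
     (auto simp: ipow_add ipow_scale ipow_ipow intro!: surjI[of _ "ipow (- n)"])

lemma ipow_diff: "ipow n (x - y) = ipow n x - ipow n y"
  by (rule unitary_operator.diff[OF unitary_ipow])

lemma ipow_zero [simp]: "ipow n 0 = 0"
  by (rule unitary_operator.zero[OF unitary_ipow])

lemma cinner_ipow_left: "cinner (ipow n x) y = cinner x (ipow (- n) y)"
  using unitary_operator.cinner_A[OF unitary_ipow, of n x "ipow (- n) y"] by (simp add: ipow_ipow)

lemma bounded_linear_A: "bounded_linear A"
  by (rule bounded_linear_intro[where K = 1]) (auto simp: add scaleC_of_real[symmetric] scale)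

lemma bounded_linear_ipow: "bounded_linear (ipow n)"
  by (rule unitary_operator.bounded_linear_A[OF unitary_ipow])

text \<open>Equality of the image with H, rather than inclusion, gives invariance under
  \<open>Ai\<close> as well, hence under all integer powers and all p(A).\<close>

definition reducing :: "'a set \<Rightarrow> bool" where
  "reducing H \<longleftrightarrow> csubspace H \<and> closed H \<and> A ` H = H"

lemma reducing_UNIV [simp]: "reducing UNIV"
  by (simp add: reducing_def surj_A)

lemma reducing_A: "reducing H \<Longrightarrow> x \<in> H \<Longrightarrow> A x \<in> H"
  by (auto simp: reducing_def)

lemma reducing_Ai: "reducing H \<Longrightarrow> x \<in> H \<Longrightarrow> Ai x \<in> H"
  unfolding reducing_def by (metis Ai_A imageE)

lemma reducing_ipow: "reducing H \<Longrightarrow> x \<in> H \<Longrightarrow> ipow n x \<in> H"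
proof (induction n rule: int_induct[of _ 0])
  case (step1 i)
  then show ?case by (simp add: A_ipow[symmetric] reducing_A)
next
  case (step2 i)
  then show ?case by (simp add: Ai_ipow[symmetric] reducing_Ai)
qed simp

section \<open>Laurent polynomials of a unitary operator\<close>

definition tp_op :: "trig_poly \<Rightarrow> 'a \<Rightarrow> 'a" where
  "tp_op p x = (\<Sum>(n, c)\<leftarrow>p. scaleC c (ipow n x))"

lemma tp_op_Nil [simp]: "tp_op [] x = 0" by (simp add: tp_op_def)

lemma tp_op_Cons [simp]: "tp_op ((n, c) # p) x = scaleC c (ipow n x) + tp_op p x" by (simp add: tp_op_def)

lemma tp_op_append [simp]: "tp_op (p @ q) x = tp_op p x + tp_op q x" by (simp add: tp_op_def)

lemma tp_op_add: "tp_op p (x + y) = tp_op p x + tp_op p y"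
  by (induction p) (auto simp: ipow_add scaleC_add_right algebra_simps)

lemma tp_op_scale: "tp_op p (scaleC c x) = scaleC c (tp_op p x)"
  by (induction p) (auto simp: ipow_scale scaleC_add_right algebra_simps)

lemma tp_op_zero [simp]: "tp_op p 0 = 0"
  using tp_op_scale[of p 0 0] by simp

lemma ipow_tp_op: "ipow n (tp_op p x) = tp_op p (ipow n x)"
  by (induction p) (auto simp: ipow_add ipow_scale ipow_ipow add.commute)

lemma tp_op_shift: "tp_op (map (\<lambda>(n, d). (m + n, c * d)) q) x = scaleC c (ipow m (tp_op q x))"
  by (induction q) (auto simp: ipow_add ipow_scale ipow_ipow scaleC_add_right algebra_simps)

lemma tp_op_mult: "tp_op (tp_mult p q) x = tp_op p (tp_op q x)"
  by (induction p) (auto simp: tp_mult_Cons tp_op_shift)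

lemma cinner_tp_op_left: "cinner (tp_op p x) y = cinner x (tp_op (tp_cnj p) y)"
  by (induction p)
     (auto simp: tp_cnj_def cinner_add_left cinner_add_right cinner_scaleC_left cinner_scaleC_right cinner_ipow_left)

lemma bounded_linear_tp_op: "bounded_linear (tp_op p)"
proof (induction p)
  case (Cons a p)
  then show ?case
    by (cases a)
       (auto intro!: bounded_linear_add bounded_linear_compose[OF bounded_linear_scaleC bounded_linear_ipow])
qed (simp add: bounded_linear_zero)

lemma reducing_tp_op: "reducing H \<Longrightarrow> x \<in> H \<Longrightarrow> tp_op p x \<in> H"
  by (induction p) (auto simp: reducing_ipow csubspaceD reducing_def)

text \<open>A measure on the whole line carried by [0, 2 pi), instead of one on a restricted space
  as in \<open>is_spectral_measure\<close>: weak limits and the comparison with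
  \<open>lborel\<close> then take place on the real line. \<open>ac_subspace_eq\<close> translates
  between the two.\<close>

definition spectral_meas :: "'a \<Rightarrow> real measure \<Rightarrow> bool" where
  "spectral_meas x \<mu> \<longleftrightarrow>
     sets \<mu> = sets borel \<and> finite_measure \<mu> \<and> (AE t in \<mu>. t \<in> {0..<2*pi}) \<and>
     (\<forall>n::nat. cinner x ((A ^^ n) x) = (\<integral>t. cis (real n * t) \<partial>\<mu>))"

lemma spectral_meas_ipow:
  assumes "spectral_meas x \<mu>"
  shows "cinner x (ipow n x) = (\<integral>t. cis (of_int n * t) \<partial>\<mu>)"
proof (cases "n \<ge> 0")
  case True
  then obtain k where "n = int k" by (metis nonneg_int_cases)
  then show ?thesis using assms by (simp add: spectral_meas_def ipow_of_nat)
next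
  case False
  then obtain k where k: "n = - int k" by (metis linear minus_minus nonneg_int_cases neg_le_0_iff_le)
  have "cinner x (ipow n x) = cnj (cinner x (ipow (int k) x))"
    by (metis cinner_commute cinner_ipow_left k)
  also have "\<dots> = cnj (\<integral>t. cis (real k * t) \<partial>\<mu>)"
    using assms by (simp add: spectral_meas_def ipow_of_nat)
  also have "\<dots> = (\<integral>t. cis (of_int n * t) \<partial>\<mu>)"
    using Bochner_Integration.integral_cnj[of \<mu> "\<lambda>t. cis (real k * t)"] by (simp add: k cis_cnj)
  finally show ?thesis .
qed

context
  fixes x \<mu>
  assumes sm: "spectral_meas x \<mu>"
begin

lemma spectral_sets: "sets \<mu> = sets borel"
  using sm by (simp add: spectral_meas_def)

lemma spectral_space [simp]: "space \<mu> = UNIV"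
  using sets_eq_imp_space_eq[OF spectral_sets] by simp

lemma spectral_finite: "finite_measure \<mu>"
  using sm by (simp add: spectral_meas_def)

lemma spectral_AE: "AE t in \<mu>. t \<in> {0..<2*pi}"
  using sm by (simp add: spectral_meas_def)

lemma integrable_tp_eval: "integrable \<mu> (\<lambda>t. tp_eval p (cis t))"
proof -
  note [measurable_cong] = spectral_sets
  obtain B where "\<And>t. cmod (tp_eval p (cis t)) \<le> B" using tp_eval_cis_bounded by blast
  then show ?thesis
    by (intro finite_measure.integrable_const_bound[OF spectral_finite, where B = B]) auto
qed

lemma cinner_tp_op: "cinner x (tp_op p x) = (\<integral>t. tp_eval p (cis t) \<partial>\<mu>)"
proof (induction p)
  case (Cons a p)
  obtain n c where a: "a = (n, c)" by fastforce
  have 1: "integrable \<mu> (\<lambda>t. c * cis (of_int n * t))"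
    using integrable_tp_eval[of "[(n, c)]"] by (simp add: cis_power_int)
  show ?case
    using Cons.IH integrable_tp_eval[of p] 1
    by (simp add: a cinner_add_right cinner_scaleC_right spectral_meas_ipow[OF sm] cis_power_int)
qed auto

text \<open>The cyclic representation: p(A)x corresponds isometrically to the function p in L^2 of
  the spectral measure, because the squared modulus of p is the symbol of the adjoint of p(A) times
  p(A).\<close>

lemma norm_tp_op: "(norm (tp_op p x))\<^sup>2 = (\<integral>t. (cmod (tp_eval p (cis t)))\<^sup>2 \<partial>\<mu>)"
proof -
  have "complex_of_real ((norm (tp_op p x))\<^sup>2) = cinner x (tp_op (tp_mult (tp_cnj p) p) x)"
    unfolding cinner_self[symmetric] by (simp only: cinner_tp_op_left tp_op_mult)
  also have "\<dots> = (\<integral>t. tp_eval (tp_mult (tp_cnj p) p) (cis t) \<partial>\<mu>)"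
    by (rule cinner_tp_op)
  also have "\<dots> = (\<integral>t. complex_of_real ((cmod (tp_eval p (cis t)))\<^sup>2) \<partial>\<mu>)"
    by (simp add: tp_eval_mult cis_neq_zero tp_eval_cnj complex_norm_square mult.commute del: of_real_power)
  finally show ?thesis
    by (simp only: integral_complex_of_real of_real_eq_iff)
qed

text \<open>The vector \<eta> is the spectral projection onto L applied to x. The polynomials
  \<open>P n\<close> converge to the indicator of L in L^2(\<mu>), so by the isometry
  \<open>norm_tp_op\<close> their values at A, applied to x, form a Cauchy sequence.\<close>

lemma spectral_cutoff:
  assumes "closed L"
  obtains \<eta> P where
    "(\<lambda>n::nat. tp_op (P n) x) \<longlonglongrightarrow> \<eta>"
    "\<And>q. (norm (tp_op q \<eta>))\<^sup>2 = (\<integral>t. (cmod (tp_eval q (cis t)))\<^sup>2 * indicator L (cis t) \<partial>\<mu>)"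
    "(norm (x - \<eta>))\<^sup>2 = (\<integral>t. indicator (- L) (cis t) \<partial>\<mu>)"
proof -
  note [measurable] = borel_closed[OF assms]
  note [measurable_cong] = spectral_sets
  interpret finite_measure \<mu> by (rule spectral_finite)
  obtain P where P2: "\<And>n z. z \<in> sphere 0 1 \<Longrightarrow> cmod (tp_eval (P n) z) \<le> 2"
    and P: "\<And>z. z \<in> sphere 0 1 \<Longrightarrow> (\<lambda>n::nat. tp_eval (P n) z) \<longlonglongrightarrow> indicator L z"
    using tp_approx_closed[OF assms] by metis
  have cis_m [measurable]: "cis \<in> borel_measurable borel"
    by (intro borel_measurable_continuous_onI continuous_intros)
  \<comment> \<open>The squared defect of \<open>P n\<close>, dominated by (2 + 1)^2 = 9.\<close>
  define d where "d n t = (cmod (tp_eval (P n) (cis t) - indicator L (cis t)))\<^sup>2" for n t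
  have ind1: "cmod (indicator L z) \<le> 1" for z by (auto simp: indicator_def)
  have d_bound: "d n t \<le> 9" for n t
  proof -
    have "cmod (tp_eval (P n) (cis t) - indicator L (cis t)) \<le> 2 + 1"
      by (intro order_trans[OF norm_triangle_ineq4] add_mono P2 ind1) auto
    then have "d n t \<le> (2 + 1)\<^sup>2" unfolding d_def by (intro power_mono) auto
    then show ?thesis by simp
  qed
  have d_int: "integrable \<mu> (d n)" for n
  proof (intro integrable_const_bound[where B = 9])
    show "d n \<in> borel_measurable \<mu>" unfolding d_def by measurable
  qed (use d_bound in \<open>auto simp: d_def\<close>)
  have d_lim: "(\<lambda>n. \<integral>t. d n t \<partial>\<mu>) \<longlonglongrightarrow> (\<integral>t. 0 \<partial>\<mu>)"
  proof (rule integral_dominated_convergence[where w = "\<lambda>_. 9"])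
    have "(\<lambda>n. d n t) \<longlonglongrightarrow> 0" for t
    proof -
      have "(\<lambda>n. d n t) \<longlonglongrightarrow> (cmod (indicator L (cis t) - indicator L (cis t)))\<^sup>2"
        unfolding d_def by (intro tendsto_intros P) auto
      then show ?thesis by simp
    qed
    then show "AE t in \<mu>. (\<lambda>n. d n t) \<longlonglongrightarrow> 0" by auto
    show "AE t in \<mu>. norm (d n t) \<le> 9" for n using d_bound by (auto simp: d_def)
    show "d n \<in> borel_measurable \<mu>" for n using d_int by auto
  qed auto
  then have d_lim: "(\<lambda>n. \<integral>t. d n t \<partial>\<mu>) \<longlonglongrightarrow> 0" by simp
  have "Cauchy (\<lambda>n. tp_op (P n) x)"
  proof (rule metric_CauchyI)
    fix e :: real assume e: "e > 0"
    have "\<forall>\<^sub>F n in sequentially. (\<integral>t. d n t \<partial>\<mu>) < e\<^sup>2 / 4"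
      by (rule order_tendstoD[OF d_lim]) (use e in auto)
    then obtain N where N: "\<And>n. n \<ge> N \<Longrightarrow> (\<integral>t. d n t \<partial>\<mu>) < e\<^sup>2 / 4"
      by (auto simp: eventually_sequentially)
    have "dist (tp_op (P m) x) (tp_op (P n) x) < e" if "m \<ge> N" "n \<ge> N" for m n
    proof -
      let ?q = "P m @ tp_mult [(0, -1)] (P n)"
      have ev: "tp_eval ?q (cis t) = tp_eval (P m) (cis t) - tp_eval (P n) (cis t)" for t
        by (simp add: tp_eval_mult cis_neq_zero)
      have "(dist (tp_op (P m) x) (tp_op (P n) x))\<^sup>2 = (norm (tp_op ?q x))\<^sup>2"
        by (simp add: dist_norm tp_op_mult)
      also have "\<dots> = (\<integral>t. (cmod (tp_eval ?q (cis t)))\<^sup>2 \<partial>\<mu>)" by (rule norm_tp_op)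
      also have "\<dots> \<le> (\<integral>t. 2 * d m t + 2 * d n t \<partial>\<mu>)"
      proof (rule integral_mono_AE')
        show "integrable \<mu> (\<lambda>t. 2 * d m t + 2 * d n t)" using d_int by simp
        have "(cmod (a - b))\<^sup>2 \<le> 2 * (cmod (a - c))\<^sup>2 + 2 * (cmod (b - c))\<^sup>2" for a b c :: complex
        proof -
          have "cmod (a - b) \<le> cmod (a - c) + cmod (b - c)"
            using norm_triangle_ineq4[of "a - c" "b - c"] by simp
          then have "(cmod (a - b))\<^sup>2 \<le> (cmod (a - c) + cmod (b - c))\<^sup>2" by (intro power_mono) auto
          also have "\<dots> \<le> 2 * (cmod (a - c))\<^sup>2 + 2 * (cmod (b - c))\<^sup>2"
            using sum_squares_bound[of "cmod (a - c)" "cmod (b - c)"] by (simp add: power2_sum)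
          finally show ?thesis .
        qed
        then show "AE t in \<mu>. (cmod (tp_eval ?q (cis t)))\<^sup>2 \<le> 2 * d m t + 2 * d n t"
          unfolding ev d_def by auto
      qed (auto simp: d_def)
      also have "\<dots> = 2 * (\<integral>t. d m t \<partial>\<mu>) + 2 * (\<integral>t. d n t \<partial>\<mu>)"
        using d_int by simp
      also have "\<dots> < e\<^sup>2" using N[OF that(1)] N[OF that(2)] by simp
      finally show ?thesis using e by (simp add: power2_less_imp_less)
    qed
    then show "\<exists>M. \<forall>m\<ge>M. \<forall>n\<ge>M. dist (tp_op (P m) x) (tp_op (P n) x) < e" by blast
  qed
  then obtain \<eta> where \<eta>: "(\<lambda>n. tp_op (P n) x) \<longlonglongrightarrow> \<eta>"
    using convergent_eq_Cauchy by blast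
  \<comment> \<open>The isometry passes to limits of uniformly bounded polynomials. It serves twice:
    for the \<open>P n\<close> themselves, and for 1 - \<open>P n\<close>, whose bound is 1 + 2 =
    3.\<close>
  have key: "(norm (tp_op q y))\<^sup>2 = (\<integral>t. (cmod (h t))\<^sup>2 \<partial>\<mu>)"
    if y: "(\<lambda>n. tp_op (R n) x) \<longlonglongrightarrow> y" and h: "\<And>t. (\<lambda>n. tp_eval q (cis t) * tp_eval (R n) (cis t)) \<longlonglongrightarrow> h t"
      and R: "\<And>n t. cmod (tp_eval (R n) (cis t)) \<le> 3" and hm: "h \<in> borel_measurable borel" for q y R h
  proof (rule LIMSEQ_unique)
    show "(\<lambda>n. (norm (tp_op q (tp_op (R n) x)))\<^sup>2) \<longlonglongrightarrow> (norm (tp_op q y))\<^sup>2"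
      by (intro tendsto_intros bounded_linear.tendsto[OF bounded_linear_tp_op] y)
    obtain B where B: "\<And>t. cmod (tp_eval q (cis t)) \<le> B" using tp_eval_cis_bounded by blast
    have "(\<lambda>n. \<integral>t. (cmod (tp_eval q (cis t) * tp_eval (R n) (cis t)))\<^sup>2 \<partial>\<mu>) \<longlonglongrightarrow> (\<integral>t. (cmod (h t))\<^sup>2 \<partial>\<mu>)"
    proof (rule integral_dominated_convergence[where w = "\<lambda>_. (B * 3)\<^sup>2"])
      show "AE t in \<mu>. (\<lambda>n. (cmod (tp_eval q (cis t) * tp_eval (R n) (cis t)))\<^sup>2) \<longlonglongrightarrow> (cmod (h t))\<^sup>2"
        using h by (auto intro!: tendsto_intros)
      have "(cmod (tp_eval q (cis t) * tp_eval (R n) (cis t)))\<^sup>2 \<le> (B * 3)\<^sup>2" for t n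
        unfolding norm_mult using B[of t] R[of n t] norm_ge_zero[of "tp_eval q (cis t)"]
        by (intro power_mono mult_mono mult_nonneg_nonneg norm_ge_zero) linarith+
      then show "AE t in \<mu>. norm ((cmod (tp_eval q (cis t) * tp_eval (R n) (cis t)))\<^sup>2) \<le> (B * 3)\<^sup>2" for n
        by auto
      show "(\<lambda>t. (cmod (h t))\<^sup>2) \<in> borel_measurable \<mu>" using hm by measurable
    qed auto
    then show "(\<lambda>n. (norm (tp_op q (tp_op (R n) x)))\<^sup>2) \<longlonglongrightarrow> (\<integral>t. (cmod (h t))\<^sup>2 \<partial>\<mu>)"
      by (simp add: tp_op_mult[symmetric] norm_tp_op tp_eval_mult cis_neq_zero)
  qed
  show ?thesis
  proof (rule that[OF \<eta>])
    fix q
    have "(norm (tp_op q \<eta>))\<^sup>2 = (\<integral>t. (cmod (tp_eval q (cis t) * indicator L (cis t)))\<^sup>2 \<partial>\<mu>)"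
    proof (rule key[OF \<eta>])
      show "cmod (tp_eval (P n) (cis t)) \<le> 3" for n t using P2[of "cis t" n] by simp
    qed (auto intro!: tendsto_intros P)
    also have "\<dots> = (\<integral>t. (cmod (tp_eval q (cis t)))\<^sup>2 * indicator L (cis t) \<partial>\<mu>)"
      by (rule Bochner_Integration.integral_cong) (auto simp: indicator_def)
    finally show "(norm (tp_op q \<eta>))\<^sup>2 = (\<integral>t. (cmod (tp_eval q (cis t)))\<^sup>2 * indicator L (cis t) \<partial>\<mu>)" .
  next
    let ?R = "\<lambda>n. (0, 1) # tp_mult [(0, -1)] (P n)"
    have "(norm (tp_op [(0, 1)] (x - \<eta>)))\<^sup>2 = (\<integral>t. (cmod (1 - indicator L (cis t)))\<^sup>2 \<partial>\<mu>)"
    proof (rule key[where R = ?R])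
      show "(\<lambda>n. tp_op (?R n) x) \<longlonglongrightarrow> x - \<eta>"
        using tendsto_diff[OF tendsto_const \<eta>, of x] by (simp add: tp_op_mult)
      show "cmod (tp_eval (?R n) (cis t)) \<le> 3" for n t
        using P2[of "cis t" n] norm_triangle_ineq4[of 1 "tp_eval (P n) (cis t)"]
        by (simp add: tp_eval_mult cis_neq_zero)
      show "(\<lambda>n. tp_eval [(0, 1)] (cis t) * tp_eval (?R n) (cis t)) \<longlonglongrightarrow> 1 - indicator L (cis t)" for t
        using tendsto_diff[OF tendsto_const P, of "cis t" 1] by (simp add: tp_eval_mult cis_neq_zero)
    qed auto
    also have "\<dots> = (\<integral>t. indicator (- L) (cis t) \<partial>\<mu>)"
      by (rule Bochner_Integration.integral_cong) (auto simp: indicator_def)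
    finally show "(norm (x - \<eta>))\<^sup>2 = (\<integral>t. indicator (- L) (cis t) \<partial>\<mu>)" by simp
  qed
qed

end

end

section \<open>Existence of spectral measures\<close>

lemma borel_measurable_cis [measurable]: "cis \<in> borel_measurable borel"
  by (intro borel_measurable_continuous_onI continuous_intros)

lemma integrable_cis_period: "integrable lborel (\<lambda>t. indicator {0..2*pi} t *\<^sub>R cis (s * t))"
  by (intro borel_integrable_compact) (auto intro!: continuous_intros)

lemma integral_cis_period:
  "(\<integral>t. indicator {0..2*pi} t *\<^sub>R cis (of_int m * t) \<partial>lborel) = (if m = 0 then 2 * pi else 0)"
proof (cases "m = 0")
  case True
  then show ?thesis
    by (simp add: scaleR_conv_of_real complex_of_real_def integral_complex_of_real[unfolded complex_of_real_def])
next
  case False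
  have "(\<integral>t. indicator {0..2*pi} t *\<^sub>R cis (of_int m * t) \<partial>lborel) =
    cis (of_int m * (2*pi)) / (\<i> * of_int m) - cis (of_int m * 0) / (\<i> * of_int m)"
  proof (rule integral_FTC_Icc)
    fix t :: real
    have "((\<lambda>z. exp (\<i> * of_int m * z) / (\<i> * of_int m)) has_field_derivative exp (\<i> * of_int m * of_real t)) (at (of_real t))"
      using False by (auto intro!: derivative_eq_intros)
    from has_vector_derivative_real_field[OF this]
    show "((\<lambda>t. cis (of_int m * t) / (\<i> * of_int m)) has_vector_derivative cis (of_int m * t)) (at t within {0..2*pi})"
      by (simp add: cis_conv_exp mult.assoc)
  qed (auto intro!: continuous_intros)
  also have "cis (of_int m * (2*pi)) = 1"
    by (metis cis_multiple_2pi Ints_of_int mult.commute mult.left_commute)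
  finally show ?thesis using False by simp
qed

context unitary_operator
begin

text \<open>The Fejer mean of order N of the spectral measure still to be found. Written as a
  squared norm it is visibly nonnegative; this is where the positive definiteness of the moment
  sequence enters.\<close>

definition fejer :: "'a \<Rightarrow> nat \<Rightarrow> real \<Rightarrow> real" where
  "fejer x N t = (norm (\<Sum>k<N. scaleC (cis (- (real k * t))) ((A ^^ k) x)))\<^sup>2 / (2 * pi * real N)"

lemma cinner_powers: "cinner ((A ^^ j) x) ((A ^^ k) x) = cinner x (ipow (int k - int j) x)"
  by (simp add: ipow_of_nat[symmetric] cinner_ipow_left ipow_ipow)

lemma fejer_eq:
  "complex_of_real (fejer x N t) =
     (\<Sum>j<N. \<Sum>k<N. cinner x (ipow (int k - int j) x) / of_real (2 * pi * real N) * cis (of_int (int j - int k) * t))"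
proof -
  let ?S = "\<Sum>k<N. scaleC (cis (- (real k * t))) ((A ^^ k) x)"
  have "complex_of_real ((norm ?S)\<^sup>2) =
    (\<Sum>j<N. \<Sum>k<N. cis (real j * t) * cis (- (real k * t)) * cinner x (ipow (int k - int j) x))"
    unfolding cinner_self[symmetric] cinner_sum_left cinner_sum_right
    unfolding cinner_scaleC_left cinner_scaleC_right cinner_powers
    by (subst sum.swap) (simp add: cis_cnj sum_distrib_left mult_ac)
  also have "\<dots> = (\<Sum>j<N. \<Sum>k<N. cinner x (ipow (int k - int j) x) * cis (of_int (int j - int k) * t))"
    by (intro sum.cong refl) (simp add: cis_mult algebra_simps)
  finally have 1: "complex_of_real ((norm ?S)\<^sup>2) =
    (\<Sum>j<N. \<Sum>k<N. cinner x (ipow (int k - int j) x) * cis (of_int (int j - int k) * t))" .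
  have "complex_of_real (fejer x N t) = complex_of_real ((norm ?S)\<^sup>2) / of_real (2 * pi * real N)"
    by (simp add: fejer_def)
  then show ?thesis by (simp only: 1 sum_divide_distrib times_divide_eq_left)
qed

lemma fejer_nonneg: "0 \<le> fejer x N t"
  by (simp add: fejer_def)

lemma continuous_fejer: "continuous_on S (fejer x N)"
proof -
  have "continuous_on S (\<lambda>t. Re (complex_of_real (fejer x N t)))"
    unfolding fejer_eq by (intro continuous_intros)
  then show ?thesis by simp
qed

lemma fejer_measurable [measurable]: "fejer x N \<in> borel_measurable borel"
  by (intro borel_measurable_continuous_onI continuous_fejer)

text \<open>Orthogonality of the characters leaves only the pairs k = j + n of the double sum. There
  are N - n of them, whence the Cesaro factor.\<close>

lemma fejer_moments:
  assumes "N > 0" "n \<le> N"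
  shows "(\<integral>t. (fejer x N t * indicator {0..2*pi} t) *\<^sub>R cis (real n * t) \<partial>lborel)
    = of_real (real (N - n) / real N) * cinner x ((A ^^ n) x)"
proof -
  let ?c = "\<lambda>j k. cinner x (ipow (int k - int j) x) / of_real (2 * pi * real N)"
  have "(fejer x N t * indicator {0..2*pi} t) *\<^sub>R cis (real n * t) =
     (\<Sum>j<N. \<Sum>k<N. ?c j k * (indicator {0..2*pi} t *\<^sub>R cis (of_int (int j - int k + int n) * t)))" for t
  proof -
    have "(fejer x N t * indicator {0..2*pi} t) *\<^sub>R cis (real n * t) =
       complex_of_real (fejer x N t) * (indicator {0..2*pi} t *\<^sub>R cis (real n * t))"
      by (simp add: scaleR_conv_of_real)
    also have "\<dots> = (\<Sum>j<N. \<Sum>k<N. ?c j k * (indicator {0..2*pi} t *\<^sub>R (cis (of_int (int j - int k) * t) * cis (real n * t))))"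
      unfolding fejer_eq sum_distrib_right
      by (intro sum.cong refl) (simp add: scaleR_conv_of_real mult_ac)
    finally show ?thesis by (simp add: cis_mult algebra_simps)
  qed
  then have "(\<integral>t. (fejer x N t * indicator {0..2*pi} t) *\<^sub>R cis (real n * t) \<partial>lborel) =
     (\<integral>t. (\<Sum>j<N. \<Sum>k<N. ?c j k * (indicator {0..2*pi} t *\<^sub>R cis (of_int (int j - int k + int n) * t))) \<partial>lborel)"
    by simp
  also have "\<dots> = (\<Sum>j<N. \<Sum>k<N. ?c j k * (\<integral>t. indicator {0..2*pi} t *\<^sub>R cis (of_int (int j - int k + int n) * t) \<partial>lborel))"
    by (simp only: Bochner_Integration.integral_sum Bochner_Integration.integrable_sum integrable_cis_period
          Bochner_Integration.integrable_mult_right Bochner_Integration.integral_mult_right_zero)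
  also have "\<dots> = (\<Sum>j<N. \<Sum>k<N. if k = j + n then cinner x ((A ^^ n) x) / real N else 0)"
  proof (intro sum.cong refl)
    fix j k
    show "?c j k * (\<integral>t. indicator {0..2*pi} t *\<^sub>R cis (of_int (int j - int k + int n) * t) \<partial>lborel) =
       (if k = j + n then cinner x ((A ^^ n) x) / real N else 0)"
      unfolding integral_cis_period by (auto simp: ipow_of_nat)
  qed
  also have "\<dots> = (\<Sum>j<N. if j + n < N then cinner x ((A ^^ n) x) / real N else 0)"
    by (intro sum.cong refl) (simp add: sum.delta')
  also have "\<dots> = (\<Sum>j\<in>{..<N - n}. cinner x ((A ^^ n) x) / real N)"
    by (rule sum.mono_neutral_cong_right) auto
  finally show ?thesis by simp
qed

text \<open>
  A weak limit of the measures with Fejer densities lives on \<open>[0, 2\<pi>]\<close>; its mass at \<open>2\<pi>\<close> has to be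
  moved to \<open>0\<close>.
\<close>

lemma spectral_meas_exists_unit:
  assumes x: "norm x = 1"
  shows "\<exists>\<mu>. spectral_meas x \<mu>"
proof -
  \<comment> \<open>The order is \<open>Suc N\<close> so that it is never 0; the density is cut down
    to one period.\<close>
  define g where "g N t = fejer x (Suc N) t * indicator {0..2*pi} t" for N t
  have g_m [measurable]: "g N \<in> borel_measurable borel" for N
    unfolding g_def by measurable
  have g_nonneg: "0 \<le> g N t" for N t by (simp add: g_def fejer_nonneg)
  define \<mu> where "\<mu> N = density lborel (\<lambda>t. ennreal (g N t))" for N
  have sets_\<mu> [simp, measurable_cong]: "sets (\<mu> N) = sets borel" for N by (simp add: \<mu>_def)
  have moments: "(\<integral>t. cis (real n * t) \<partial>\<mu> N) = of_real (real (Suc N - n) / real (Suc N)) * cinner x ((A ^^ n) x)"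
    if "n \<le> N" for n N
  proof -
    have "(\<integral>t. cis (real n * t) \<partial>\<mu> N) = (\<integral>t. g N t *\<^sub>R cis (real n * t) \<partial>lborel)"
      unfolding \<mu>_def by (rule integral_density) (auto simp: g_nonneg intro!: borel_measurable_continuous_onI continuous_intros)
    then show ?thesis using fejer_moments[of "Suc N" n x] that by (simp add: g_def)
  qed
  have g_int: "integrable lborel (g N)" for N
    using borel_integrable_compact[of "{0..2*pi}" "fejer x (Suc N)"]
    unfolding g_def by (simp add: continuous_fejer mult.commute)
  have prob: "prob_space (\<mu> N)" for N
  proof
    have "complex_of_real (\<integral>t. g N t \<partial>lborel) = (\<integral>t. g N t *\<^sub>R cis (real 0 * t) \<partial>lborel)"
      by (simp add: scaleR_conv_of_real)
    also have "\<dots> = 1" using fejer_moments[of "Suc N" 0 x] x by (simp add: g_def cinner_self)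
    finally have 1: "(\<integral>t. g N t \<partial>lborel) = 1" by (metis of_real_eq_1_iff)
    have "emeasure (\<mu> N) (space (\<mu> N)) = (\<integral>\<^sup>+t. ennreal (g N t) \<partial>lborel)"
      by (simp add: \<mu>_def emeasure_density)
    also have "\<dots> = ennreal (\<integral>t. g N t \<partial>lborel)"
      by (rule nn_integral_eq_integral[OF g_int]) (simp add: g_nonneg)
    finally show "emeasure (\<mu> N) (space (\<mu> N)) = 1" using 1 by simp
  qed
  have rd: "real_distribution (\<mu> N)" for N
    using prob by (simp add: real_distribution_def real_distribution_axioms_def)
  have AE_\<mu>: "AE t in \<mu> N. t \<in> {0..2*pi}" for N
    unfolding \<mu>_def by (subst AE_density) (auto simp: g_def split: split_indicator)
  \<comment> \<open>All the measures are carried by [0, 2 pi]. The interval starts at -1 because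
    tightness is stated with intervals open on the left, which would lose the point 0.\<close>
  have "tight \<mu>"
    unfolding tight_def
  proof (intro conjI allI impI)
    fix \<epsilon> :: real assume "\<epsilon> > 0"
    have "measure (\<mu> N) {-1<..2*pi} = 1" for N
    proof -
      interpret prob_space "\<mu> N" by (rule prob)
      have "AE t in \<mu> N. t \<in> {-1<..2*pi}" using AE_\<mu>[of N] by eventually_elim auto
      then show ?thesis by (subst prob_eq_1) auto
    qed
    moreover have "-1 < 2 * pi" using pi_gt_zero by linarith
    ultimately show "\<exists>a b::real. a < b \<and> (\<forall>n. measure (\<mu> n) {a<..b} > 1 - \<epsilon>)"
      using \<open>\<epsilon> > 0\<close> by (intro exI[of _ "-1"] exI[of _ "2*pi"]) auto
  qed (rule rd)
  from tight_imp_convergent_subsubsequence[OF this strict_mono_id]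
  obtain r M where r: "strict_mono r" and M: "real_distribution M" and conv: "weak_conv_m (\<mu> \<circ> r) M" by auto
  interpret M: real_distribution M by (rule M)
  have rd': "real_distribution ((\<mu> \<circ> r) n)" for n using rd by simp
  note lim = weak_conv_imp_integral_bdd_continuous_conv[OF rd' M conv]
  have M_moments: "(\<integral>t. cis (real n * t) \<partial>M) = cinner x ((A ^^ n) x)" for n
  proof (rule LIMSEQ_unique)
    show "(\<lambda>k. \<integral>t. cis (real n * t) \<partial>(\<mu> \<circ> r) k) \<longlonglongrightarrow> (\<integral>t. cis (real n * t) \<partial>M)"
    proof (rule lim[where B = 1])
      have "continuous_on UNIV (\<lambda>t. cis (real n * t))" by (intro continuous_intros)
      then show "isCont (\<lambda>t. cis (real n * t)) t" for t by (simp add: continuous_on_eq_continuous_at)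
    qed auto
    have "(\<lambda>N. of_real (real (Suc N - n) / real (Suc N)) * cinner x ((A ^^ n) x)) \<longlonglongrightarrow> of_real 1 * cinner x ((A ^^ n) x)"
    proof (intro tendsto_intros)
      have "(\<lambda>N. 1 - real n * inverse (real (Suc N))) \<longlonglongrightarrow> 1 - real n * 0"
        by (intro tendsto_intros LIMSEQ_inverse_real_of_nat)
      moreover have "\<forall>\<^sub>F N in sequentially. 1 - real n * inverse (real (Suc N)) = real (Suc N - n) / real (Suc N)"
        using eventually_ge_at_top[of n] by eventually_elim (simp add: field_simps of_nat_diff)
      ultimately show "(\<lambda>N. real (Suc N - n) / real (Suc N)) \<longlonglongrightarrow> 1"
        by (auto intro: Lim_transform_eventually)
    qed
    moreover have "\<forall>\<^sub>F N in sequentially. of_real (real (Suc N - n) / real (Suc N)) * cinner x ((A ^^ n) x) = (\<integral>t. cis (real n * t) \<partial>\<mu> N)"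
      using eventually_ge_at_top[of n] by eventually_elim (simp only: moments)
    ultimately have "(\<lambda>N. \<integral>t. cis (real n * t) \<partial>\<mu> N) \<longlonglongrightarrow> cinner x ((A ^^ n) x)"
      by (auto intro: Lim_transform_eventually)
    from LIMSEQ_subseq_LIMSEQ[OF this r]
    show "(\<lambda>k. \<integral>t. cis (real n * t) \<partial>(\<mu> \<circ> r) k) \<longlonglongrightarrow> cinner x ((A ^^ n) x)"
      by (simp add: o_def)
  qed
  have AE_M: "AE t in M. t \<in> {0..2*pi}"
  proof -
    \<comment> \<open>A bounded continuous function that vanishes exactly on [0, 2 pi]; its
      integrals are 0, and weak convergence carries this to the limit.\<close>
    define h where "h t = min 1 (infdist t {0..2*pi})" for t :: real
    have h_cont: "isCont h t" for t
      unfolding h_def by (intro continuous_intros)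
    have h: "0 \<le> h t" "h t \<le> 1" for t by (auto simp: h_def infdist_nonneg)
    have hm [measurable]: "h \<in> borel_measurable borel"
      by (intro borel_measurable_continuous_onI continuous_at_imp_continuous_on ballI h_cont)
    have "(\<lambda>k. \<integral>t. h t \<partial>(\<mu> \<circ> r) k) \<longlonglongrightarrow> (\<integral>t. h t \<partial>M)"
      by (rule lim[where B = 1]) (use h h_cont in auto)
    moreover have "(\<integral>t. h t \<partial>(\<mu> \<circ> r) k) = 0" for k
    proof (rule integral_eq_zero_AE)
      show "AE t in (\<mu> \<circ> r) k. h t = 0"
        using AE_\<mu>[of "r k"] unfolding o_def by eventually_elim (simp add: h_def)
    qed
    ultimately have 0: "(\<integral>t. h t \<partial>M) = 0" by (simp add: LIMSEQ_const_iff)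
    have "integrable M h"
      by (intro M.integrable_const_bound[where B = 1]) (use h in auto)
    then have "AE t in M. h t = 0" using 0 h(1) integral_nonneg_eq_0_iff_AE by blast
    then show ?thesis
    proof eventually_elim
      case (elim t)
      then have "infdist t {0..2*pi} = 0" by (simp add: h_def min_def split: if_splits)
      then show ?case using in_closed_iff_infdist_zero[of "{0..2*pi}" t] pi_gt_zero by auto
    qed
  qed
  define fold where "fold t = (if t = 2*pi then 0 else t)" for t :: real
  have fold_m [measurable]: "fold \<in> borel_measurable borel" unfolding fold_def by measurable
  have cis_fold: "cis (real n * fold t) = cis (real n * t)" for n t
    using cis_multiple_2pi[of "real n"] by (auto simp: fold_def mult_ac)
  have "spectral_meas x (distr M borel fold)"
    unfolding spectral_meas_def
  proof (intro conjI allI)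
    show "finite_measure (distr M borel fold)"
      by (intro M.finite_measure_distr) simp
    have "AE t in M. fold t \<in> {0..<2*pi}"
      using AE_M by eventually_elim (auto simp: fold_def)
    then show "AE t in distr M borel fold. t \<in> {0..<2*pi}"
      by (subst AE_distr_iff) auto
    fix n :: nat
    have "(\<integral>t. cis (real n * t) \<partial>distr M borel fold) = (\<integral>t. cis (real n * fold t) \<partial>M)"
      by (intro integral_distr) (auto intro!: borel_measurable_continuous_onI continuous_intros)
    then show "cinner x ((A ^^ n) x) = (\<integral>t. cis (real n * t) \<partial>distr M borel fold)"
      by (simp add: cis_fold M_moments)
  qed simp
  then show ?thesis by blast
qed

text \<open>Normalisation: the weak limit was taken among probability measures. The measure of x is
  that of the unit vector u times the squared norm of x, and the zero vector has the null
  measure.\<close>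

theorem spectral_meas_exists: "\<exists>\<mu>. spectral_meas x \<mu>"
proof (cases "x = 0")
  case True
  have "spectral_meas x (null_measure borel)"
    unfolding spectral_meas_def
    by (auto intro!: finite_measureI AE_I[of _ _ UNIV] simp: True funpow_swap1[symmetric])
  then show ?thesis by blast
next
  case False
  define u where "u = scaleC (of_real (1 / norm x)) x"
  have "norm u = 1" using False by (simp add: u_def norm_divide)
  then obtain \<mu> where \<mu>: "spectral_meas u \<mu>" using spectral_meas_exists_unit by blast
  note [measurable_cong] = spectral_sets[OF \<mu>]
  interpret finite_measure \<mu> by (rule spectral_finite[OF \<mu>])
  have x: "x = scaleC (of_real (norm x)) u" using False by (simp add: u_def)
  let ?c = "(norm x)\<^sup>2"
  have "spectral_meas x (density \<mu> (\<lambda>_. ennreal ?c))"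
    unfolding spectral_meas_def
  proof (intro conjI allI)
    show "finite_measure (density \<mu> (\<lambda>_. ennreal ?c))"
      by (intro finite_measureI) (simp add: emeasure_density nn_integral_cmult emeasure_eq_measure flip: ennreal_mult)
    show "AE t in density \<mu> (\<lambda>_. ennreal ?c). t \<in> {0..<2*pi}"
      using spectral_AE[OF \<mu>] by (subst AE_density) auto
    fix n
    have "(\<integral>t. cis (real n * t) \<partial>density \<mu> (\<lambda>_. ennreal ?c)) = (\<integral>t. ?c *\<^sub>R cis (real n * t) \<partial>\<mu>)"
      by (intro integral_density) (simp_all add: measurable_cong_sets[OF spectral_sets[OF \<mu>] refl])
    also have "\<dots> = of_real ?c * cinner u (ipow (int n) u)"
      using spectral_meas_ipow[OF \<mu>, of "int n"] by (simp add: scaleR_conv_of_real)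
    also have "\<dots> = cinner (scaleC (of_real (norm x)) u) (ipow (int n) (scaleC (of_real (norm x)) u))"
      by (simp add: ipow_scale cinner_scaleC_left cinner_scaleC_right power2_eq_square)
    also have "\<dots> = cinner x (ipow (int n) x)" by (simp only: x[symmetric])
    finally show "cinner x ((A ^^ n) x) = (\<integral>t. cis (real n * t) \<partial>density \<mu> (\<lambda>_. ennreal ?c))"
      by (simp add: ipow_of_nat)
  qed (simp add: spectral_sets[OF \<mu>])
  then show ?thesis by blast
qed

end

section \<open>Absolutely continuous vectors\<close>

lemma cis_inj_period:
  assumes "s \<in> {0..<2*pi}" "t \<in> {0..<2*pi}" "cis s = cis t"
  shows "s = t"
proof -
  have "\<i> * complex_of_real s = \<i> * complex_of_real t"
    by (rule exp_complex_eqI) (use assms in \<open>auto simp: cis_conv_exp abs_less_iff\<close>)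
  then show ?thesis by simp
qed

lemma cis_mem_image_iff:
  assumes "K \<subseteq> {0..<2*pi}" "t \<in> {0..<2*pi}"
  shows "cis t \<in> cis ` K \<longleftrightarrow> t \<in> K"
  using assms cis_inj_period[OF assms(2)] by (metis image_iff subsetD)

lemma compact_cis_image: "compact K \<Longrightarrow> compact (cis ` K)"
  by (intro compact_continuous_image continuous_intros)

text \<open>Parseval's identity on [0, 2 pi]. Together with a bounded density it controls the norm
  of p(A)x by the coefficients of p.\<close>

lemma integral_norm_trig_sum:
  "(\<integral>t. indicator {0..2*pi} t * (cmod (\<Sum>n<N. d n * cis (real n * t)))\<^sup>2 \<partial>lborel) =
     2 * pi * (\<Sum>n<N. (cmod (d n))\<^sup>2)"
proof -
  have "complex_of_real (indicator {0..2*pi} t * (cmod (\<Sum>n<N. d n * cis (real n * t)))\<^sup>2) =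
     (\<Sum>n<N. \<Sum>m<N. d n * cnj (d m) * (indicator {0..2*pi} t *\<^sub>R cis (of_int (int n - int m) * t)))" for t
  proof -
    have "complex_of_real (indicator {0..2*pi} t * (cmod (\<Sum>n<N. d n * cis (real n * t)))\<^sup>2) =
      indicator {0..2*pi} t *\<^sub>R ((\<Sum>n<N. d n * cis (real n * t)) * (\<Sum>n<N. cnj (d n) * cis (- (real n * t))))"
      by (simp add: scaleR_conv_of_real complex_norm_square cis_cnj del: of_real_power)
    also have "\<dots> = (\<Sum>n<N. \<Sum>m<N. indicator {0..2*pi} t *\<^sub>R ((d n * cis (real n * t)) * (cnj (d m) * cis (- (real m * t)))))"
      by (simp only: sum_product scaleR_sum_right)
    also have "\<dots> = (\<Sum>n<N. \<Sum>m<N. d n * cnj (d m) * (indicator {0..2*pi} t *\<^sub>R (cis (real n * t) * cis (- (real m * t)))))"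
      by (intro sum.cong refl) (simp add: scaleR_conv_of_real mult_ac)
    finally show ?thesis by (simp add: cis_mult algebra_simps)
  qed
  then have "complex_of_real (\<integral>t. indicator {0..2*pi} t * (cmod (\<Sum>n<N. d n * cis (real n * t)))\<^sup>2 \<partial>lborel) =
    (\<integral>t. (\<Sum>n<N. \<Sum>m<N. d n * cnj (d m) * (indicator {0..2*pi} t *\<^sub>R cis (of_int (int n - int m) * t))) \<partial>lborel)"
    unfolding integral_complex_of_real[symmetric] by simp
  also have "\<dots> = (\<Sum>n<N. \<Sum>m<N. d n * cnj (d m) * (if int n - int m = 0 then 2 * pi else 0))"
    by (simp only: Bochner_Integration.integral_sum Bochner_Integration.integrable_sum integrable_cis_period
          Bochner_Integration.integrable_mult_right Bochner_Integration.integral_mult_right_zero integral_cis_period)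
  also have "\<dots> = (\<Sum>n<N. \<Sum>m<N. if m = n then d n * cnj (d n) * (2 * pi) else 0)"
    by (intro sum.cong refl) auto
  also have "\<dots> = (\<Sum>n<N. d n * cnj (d n) * (2 * pi))"
    by (intro sum.cong refl) (simp add: sum.delta')
  also have "\<dots> = complex_of_real (2 * pi * (\<Sum>n<N. (cmod (d n))\<^sup>2))"
    by (simp add: complex_norm_square sum_distrib_left mult_ac del: of_real_power)
  finally show ?thesis by (simp only: of_real_eq_iff)
qed

context unitary_operator
begin

definition ac_vectors :: "'a set" where
  "ac_vectors = {x. \<exists>\<mu>. spectral_meas x \<mu> \<and> absolutely_continuous lborel \<mu>}"

text \<open>The sequence P depends on L only, not on x. Hence for different vectors the masses of
  the same set are limits of norms under the same polynomials and can be compared.\<close>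

lemma spectral_meas_arc_limit:
  assumes "closed L"
  obtains P where "\<And>x \<mu>. spectral_meas x \<mu> \<Longrightarrow> (\<lambda>n. (norm (tp_op (P n) x))\<^sup>2) \<longlonglongrightarrow> measure \<mu> {t. cis t \<in> L}"
proof -
  obtain P where P2: "\<And>n z. z \<in> sphere 0 1 \<Longrightarrow> cmod (tp_eval (P n) z) \<le> 2"
    and P: "\<And>z. z \<in> sphere 0 1 \<Longrightarrow> (\<lambda>n::nat. tp_eval (P n) z) \<longlonglongrightarrow> indicator L z"
    using tp_approx_closed[OF assms] by metis
  have meas: "{t. cis t \<in> L} \<in> sets borel"
    using measurable_sets[OF borel_measurable_cis borel_closed[OF assms]] by (simp add: vimage_def)
  note [measurable] = borel_closed[OF assms]
  have "(\<lambda>n. (norm (tp_op (P n) x))\<^sup>2) \<longlonglongrightarrow> measure \<mu> {t. cis t \<in> L}" if \<mu>: "spectral_meas x \<mu>" for x \<mu>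
  proof -
    note [measurable_cong] = spectral_sets[OF \<mu>]
    interpret finite_measure \<mu> by (rule spectral_finite[OF \<mu>])
    have "(\<lambda>n. \<integral>t. (cmod (tp_eval (P n) (cis t)))\<^sup>2 \<partial>\<mu>) \<longlonglongrightarrow> (\<integral>t. (cmod (indicator L (cis t)))\<^sup>2 \<partial>\<mu>)"
    proof (rule integral_dominated_convergence[where w = "\<lambda>_. 4"])
      show "AE t in \<mu>. (\<lambda>n. (cmod (tp_eval (P n) (cis t)))\<^sup>2) \<longlonglongrightarrow> (cmod (indicator L (cis t)))\<^sup>2"
        by (intro AE_I2 tendsto_intros P) auto
      have "(cmod (tp_eval (P n) (cis t)))\<^sup>2 \<le> 2\<^sup>2" for n t
        by (intro power_mono P2) auto
      then show "AE t in \<mu>. norm ((cmod (tp_eval (P n) (cis t)))\<^sup>2) \<le> 4" for n by auto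
    qed auto
    also have "(\<integral>t. (cmod (indicator L (cis t)))\<^sup>2 \<partial>\<mu>) = (\<integral>t. indicator {t. cis t \<in> L} t \<partial>\<mu>)"
      by (rule Bochner_Integration.integral_cong) (auto simp: indicator_def)
    also have "\<dots> = measure \<mu> {t. cis t \<in> L}"
      using meas by (simp add: spectral_space[OF \<mu>] spectral_sets[OF \<mu>])
    finally show ?thesis by (simp add: norm_tp_op[OF \<mu>])
  qed
  then show ?thesis by (rule that)
qed

text \<open>Compactness of K makes its image under \<open>cis\<close> closed, and injectivity of
  \<open>cis\<close> on [0, 2 pi) brings the preimage of that image back to K up to a null
  set.\<close>

lemma spectral_meas_cis_image:
  assumes \<mu>: "spectral_meas x \<mu>" and K: "compact K" "K \<subseteq> {0..<2*pi}"
  shows "measure \<mu> {t. cis t \<in> cis ` K} = measure \<mu> K"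
proof (rule finite_measure.finite_measure_eq_AE[OF spectral_finite[OF \<mu>]])
  show "AE t in \<mu>. (t \<in> {t. cis t \<in> cis ` K}) = (t \<in> K)"
    using spectral_AE[OF \<mu>] by eventually_elim (simp only: mem_Collect_eq cis_mem_image_iff[OF K(2)])
  show "{t. cis t \<in> cis ` K} \<in> sets \<mu>"
    using measurable_sets[OF borel_measurable_cis, of "cis ` K"] compact_cis_image[OF K(1)]
    by (simp add: vimage_def spectral_sets[OF \<mu>] compact_imp_closed)
  show "K \<in> sets \<mu>" using K by (simp add: spectral_sets[OF \<mu>] compact_imp_closed)
qed

text \<open>Inner regularity. Compact sets are the ones whose mass is accessible as a limit of norms
  of p(A)x.\<close>

lemma spectral_meas_null_if_compact_null:
  assumes \<mu>: "spectral_meas x \<mu>" and B: "B \<in> sets borel"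
    and null: "\<And>K. compact K \<Longrightarrow> K \<subseteq> B \<inter> {0..<2*pi} \<Longrightarrow> measure \<mu> K = 0"
  shows "emeasure \<mu> B = 0"
proof -
  interpret finite_measure \<mu> by (rule spectral_finite[OF \<mu>])
  let ?B = "B \<inter> {0..<2*pi}"
  have "emeasure \<mu> B = emeasure \<mu> ?B"
  proof (rule emeasure_eq_AE)
    show "AE t in \<mu>. (t \<in> B) = (t \<in> ?B)" using spectral_AE[OF \<mu>] by eventually_elim auto
  qed (use B in \<open>auto simp: spectral_sets[OF \<mu>]\<close>)
  also have "\<dots> = (SUP K \<in> {K. K \<subseteq> ?B \<and> compact K}. emeasure \<mu> K)"
    using B by (intro inner_regular) (auto simp: spectral_sets[OF \<mu>])
  also have "\<dots> = (SUP K \<in> {K. K \<subseteq> ?B \<and> compact K}. 0)"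
    using null by (intro SUP_cong) (auto simp: emeasure_eq_measure)
  also have "\<dots> = 0" by (simp add: SUP_constant bot_ennreal)
  finally show ?thesis .
qed

text \<open>
  On compact subsets of the circle, the spectral measure is a limit of the quantities
  \<open>\<parallel>p(A) x\<parallel>\<^sup>2\<close>, so an inequality between the latter is inherited by the measures.
\<close>

lemma ac_vectors_dominated:
  assumes "y \<in> ac_vectors" "z \<in> ac_vectors"
    and le: "\<And>p. (norm (tp_op p x))\<^sup>2 \<le> (norm (tp_op p y))\<^sup>2 + (norm (tp_op p z))\<^sup>2"
  shows "x \<in> ac_vectors"
proof -
  obtain \<mu> where \<mu>: "spectral_meas x \<mu>" using spectral_meas_exists by blast
  obtain \<mu>1 \<mu>2 where \<mu>1: "spectral_meas y \<mu>1" "absolutely_continuous lborel \<mu>1"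
    and \<mu>2: "spectral_meas z \<mu>2" "absolutely_continuous lborel \<mu>2"
    using assms(1,2) by (auto simp: ac_vectors_def)
  have "absolutely_continuous lborel \<mu>"
    unfolding absolutely_continuous_def
  proof
    fix B :: "real set" assume B: "B \<in> null_sets lborel"
    have "emeasure \<mu> B = 0"
    proof (rule spectral_meas_null_if_compact_null[OF \<mu>])
      show "B \<in> sets borel" using B by auto
      fix K assume K: "compact K" "K \<subseteq> B \<inter> {0..<2*pi}"
      then have K': "K \<subseteq> {0..<2*pi}" by auto
      have "K \<in> null_sets lborel"
        by (rule null_sets_subset[OF B]) (use K in \<open>auto intro: borel_compact\<close>)
      then have 0: "measure \<mu>1 K = 0" "measure \<mu>2 K = 0"
        using \<mu>1(2) \<mu>2(2) by (auto simp: absolutely_continuous_def measure_def null_sets_def)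
      obtain P where P: "\<And>x \<mu>. spectral_meas x \<mu> \<Longrightarrow>
          (\<lambda>n. (norm (tp_op (P n) x))\<^sup>2) \<longlonglongrightarrow> measure \<mu> {t. cis t \<in> cis ` K}"
        using spectral_meas_arc_limit[of "cis ` K"] compact_cis_image[OF K(1)] compact_imp_closed by blast
      have "measure \<mu> {t. cis t \<in> cis ` K} \<le> measure \<mu>1 {t. cis t \<in> cis ` K} + measure \<mu>2 {t. cis t \<in> cis ` K}"
        by (rule LIMSEQ_le[OF P[OF \<mu>] tendsto_add[OF P[OF \<mu>1(1)] P[OF \<mu>2(1)]]]) (use le in auto)
      then show "measure \<mu> K = 0"
        using 0 measure_nonneg[of \<mu> K]
        unfolding spectral_meas_cis_image[OF \<mu> K(1) K'] spectral_meas_cis_image[OF \<mu>1(1) K(1) K']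
          spectral_meas_cis_image[OF \<mu>2(1) K(1) K'] by linarith
    qed
    moreover have "B \<in> sets borel" using B by auto
    ultimately show "B \<in> null_sets \<mu>" by (simp add: null_sets_def spectral_sets[OF \<mu>])
  qed
  with \<mu> show ?thesis by (auto simp: ac_vectors_def)
qed

lemma ac_vectors_add:
  assumes "x \<in> ac_vectors" "y \<in> ac_vectors" and orth: "\<And>p. cinner (tp_op p x) (tp_op p y) = 0"
  shows "x + y \<in> ac_vectors"
proof (rule ac_vectors_dominated[OF assms(1,2)])
  fix p
  have "inner (tp_op p x) (tp_op p y) = 0" by (metis Re_cinner orth zero_complex.sel(1))
  then show "(norm (tp_op p (x + y)))\<^sup>2 \<le> (norm (tp_op p x))\<^sup>2 + (norm (tp_op p y))\<^sup>2"
    by (simp add: tp_op_add power2_norm_eq_inner inner_add inner_commute)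
qed

lemma ac_vectors_le:
  assumes "y \<in> ac_vectors" and "\<And>p. norm (tp_op p x) \<le> norm (tp_op p y)"
  shows "x \<in> ac_vectors"
proof (rule ac_vectors_dominated[OF assms(1,1)])
  fix p
  have "(norm (tp_op p x))\<^sup>2 \<le> (norm (tp_op p y))\<^sup>2" by (intro power_mono assms(2)) simp
  then show "(norm (tp_op p x))\<^sup>2 \<le> (norm (tp_op p y))\<^sup>2 + (norm (tp_op p y))\<^sup>2"
    using zero_le_power2[of "norm (tp_op p y)"] by linarith
qed

text \<open>For an eigenvector z - w vanishes almost everywhere for the spectral measure, which
  therefore sits at a single s with cis s = w, while absolute continuity gives points no
  mass.\<close>

lemma ac_vectors_eigenvector:
  assumes x: "x \<in> ac_vectors" and ev: "A x = scaleC w x"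
  shows "x = 0"
proof (rule ccontr)
  assume nz: "x \<noteq> 0"
  obtain \<mu> where \<mu>: "spectral_meas x \<mu>" "absolutely_continuous lborel \<mu>"
    using x by (auto simp: ac_vectors_def)
  note [measurable_cong] = spectral_sets[OF \<mu>(1)]
  interpret finite_measure \<mu> by (rule spectral_finite[OF \<mu>(1)])
  let ?q = "[(1, 1), (0, - w)] :: trig_poly"
  have "tp_op ?q x = 0" by (simp add: ev scaleC_minus_left)
  then have 0: "(\<integral>t. (cmod (cis t - w))\<^sup>2 \<partial>\<mu>) = 0"
    using norm_tp_op[OF \<mu>(1), of ?q] by simp
  have int: "integrable \<mu> (\<lambda>t. (cmod (cis t - w))\<^sup>2)"
  proof (rule integrable_const_bound[where B = "(1 + cmod w)\<^sup>2"])
    have "(cmod (cis t - w))\<^sup>2 \<le> (1 + cmod w)\<^sup>2" for t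
      using norm_triangle_ineq4[of "cis t" w] by (intro power_mono) auto
    then show "AE t in \<mu>. norm ((cmod (cis t - w))\<^sup>2) \<le> (1 + cmod w)\<^sup>2" by simp
  qed auto
  have "AE t in \<mu>. (cmod (cis t - w))\<^sup>2 = 0"
    using 0 int integral_nonneg_eq_0_iff_AE[of \<mu> "\<lambda>t. (cmod (cis t - w))\<^sup>2"] by simp
  then have AE: "AE t in \<mu>. t \<in> {t\<in>{0..<2*pi}. cis t = w}"
    using spectral_AE[OF \<mu>(1)] by eventually_elim auto
  have "\<exists>s. {t\<in>{0..<2*pi}. cis t = w} \<subseteq> {s}"
    using cis_inj_period by blast
  then obtain s where s: "{t\<in>{0..<2*pi}. cis t = w} \<subseteq> {s}" by blast
  have "{s} \<in> null_sets lborel" by (simp add: null_sets_def)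
  then have "{s} \<in> null_sets \<mu>" using \<mu>(2) unfolding absolutely_continuous_def by blast
  then have "AE t in \<mu>. t \<notin> {s}" by (rule AE_not_in)
  with AE have "AE t in \<mu>. False" by eventually_elim (use s in auto)
  then have "measure \<mu> (space \<mu>) = 0"
    by (simp add: eventually_False ae_filter_eq_bot_iff emeasure_eq_measure)
  moreover have "(norm (tp_op [(0, 1)] x))\<^sup>2 = measure \<mu> (space \<mu>)"
    unfolding norm_tp_op[OF \<mu>(1)] by simp
  ultimately show False using nz by simp
qed

text \<open>Square summability of the forward orbit against every y, with one constant for all y:
  the form in which a bounded spectral density is used. Only n \<ge> 0 is summed, the direction in
  which the wave operators are taken.\<close>

definition bounded_orbit :: "real \<Rightarrow> 'a \<Rightarrow> bool" where
  "bounded_orbit C x \<longleftrightarrow> (\<forall>y N. (\<Sum>n<N. (cmod (cinner y ((A ^^ n) x)))\<^sup>2) \<le> C * (norm y)\<^sup>2)"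

text \<open>The Radon-Nikodym density f is finite \<mu>-almost everywhere, so the sets where f > k
  shrink to a null set and one of them has mass below e/2. Inner regularity gives up less than
  another e/2 in the complement.\<close>

lemma spectral_compact_approx:
  assumes \<mu>: "spectral_meas x \<mu>" and ac: "absolutely_continuous lborel \<mu>" and e: "e > 0"
  obtains f K k where "f \<in> borel_measurable lborel" "density lborel f = \<mu>" "compact K" "K \<subseteq> {0..<2*pi}"
    "\<And>t. t \<in> K \<Longrightarrow> f t \<le> ennreal (real k)" "measure \<mu> (- K) < e"
proof -
  interpret finite_measure \<mu> by (rule spectral_finite[OF \<mu>])
  have sp: "space \<mu> = UNIV" by (rule spectral_space[OF \<mu>])
  obtain f where f: "f \<in> borel_measurable lborel" "density lborel f = \<mu>"
    using sigma_finite_measure.Radon_Nikodym[OF sigma_finite_lborel ac] spectral_sets[OF \<mu>] by auto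
  note [measurable_cong] = spectral_sets[OF \<mu>]
  have [measurable]: "f \<in> borel_measurable borel" using f(1) by simp
  have "(\<integral>\<^sup>+t. f t \<partial>lborel) = emeasure \<mu> UNIV"
    using f by (auto simp: emeasure_density)
  then have "(\<integral>\<^sup>+t. f t \<partial>lborel) \<noteq> \<infinity>" by (simp add: emeasure_eq_measure)
  then have "AE t in lborel. f t \<noteq> \<infinity>" by (intro nn_integral_PInf_AE f(1)) auto
  then have "AE t in lborel. 0 < f t \<longrightarrow> f t \<noteq> \<infinity>" by auto
  then have fin: "AE t in \<mu>. f t \<noteq> \<infinity>"
    unfolding f(2)[symmetric] by (subst AE_density[OF f(1)])
  define E where "E k = {t. f t > ennreal (real k)}" for k :: nat
  have E_m: "E k \<in> sets \<mu>" for k unfolding E_def by measurable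
  have "(\<lambda>k. measure \<mu> (E k)) \<longlonglongrightarrow> measure \<mu> (\<Inter>k. E k)"
    by (rule finite_Lim_measure_decseq) (use E_m in \<open>auto simp: decseq_def E_def intro: order.strict_trans1[rotated]\<close>)
  also have "measure \<mu> (\<Inter>k. E k) = measure \<mu> {}"
  proof (rule finite_measure_eq_AE)
    show "AE t in \<mu>. (t \<in> (\<Inter>k. E k)) = (t \<in> {})"
      using fin
    proof eventually_elim
      case (elim t)
      then obtain r where r: "f t = ennreal r" "r \<ge> 0" by (cases "f t") auto
      obtain k :: nat where "r \<le> real k" using real_arch_simple by blast
      then have "t \<notin> E k" using r by (simp add: E_def not_less ennreal_leI)
      then show ?case by auto
    qed
  qed (use E_m in auto)
  finally have "(\<lambda>k. measure \<mu> (E k)) \<longlonglongrightarrow> 0" by simp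
  then have "\<forall>\<^sub>F k in sequentially. measure \<mu> (E k) < e / 2"
    by (rule order_tendstoD) (use e in auto)
  then obtain k where k: "measure \<mu> (E k) < e / 2" by (auto simp: eventually_sequentially)
  let ?B = "- E k \<inter> {0..<2*pi}"
  have B_m: "?B \<in> sets borel" using E_m[of k] by (auto simp: spectral_sets[OF \<mu>])
  have "emeasure \<mu> ?B = (SUP K \<in> {K. K \<subseteq> ?B \<and> compact K}. emeasure \<mu> K)"
    using B_m by (intro inner_regular) (auto simp: spectral_sets[OF \<mu>])
  moreover have "\<exists>K. K \<subseteq> ?B \<and> compact K \<and> measure \<mu> ?B < measure \<mu> K + e / 2"
  \<comment> \<open>The case split keeps \<open>measure \<mu> ?B - e / 2\<close> nonnegative where
    it is converted to \<open>ennreal\<close>.\<close>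
  proof (cases "measure \<mu> ?B < e / 2")
    case True
    then show ?thesis by (intro exI[of _ "{}"]) auto
  next
    case False
    then have "ennreal (measure \<mu> ?B - e / 2) < emeasure \<mu> ?B"
      using e by (simp add: emeasure_eq_measure ennreal_less_iff)
    with calculation obtain K where K: "K \<subseteq> ?B" "compact K" "ennreal (measure \<mu> ?B - e / 2) < emeasure \<mu> K"
      by (auto simp: less_SUP_iff)
    then have "measure \<mu> ?B - e / 2 < measure \<mu> K"
      using False by (simp add: emeasure_eq_measure ennreal_less_iff)
    then show ?thesis using K by (intro exI[of _ K]) auto
  qed
  ultimately obtain K where K: "K \<subseteq> ?B" "compact K" "measure \<mu> ?B < measure \<mu> K + e / 2" by blast
  have K_m: "K \<in> sets \<mu>" using K by (simp add: spectral_sets[OF \<mu>] compact_imp_closed)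
  have "measure \<mu> (- K) = measure \<mu> UNIV - measure \<mu> K"
    using finite_measure_compl[OF K_m] by (simp add: sp Compl_eq_Diff_UNIV)
  also have "measure \<mu> UNIV \<le> measure \<mu> (E k \<union> ?B)"
  proof (rule finite_measure_mono_AE)
    show "AE t in \<mu>. t \<in> UNIV \<longrightarrow> t \<in> E k \<union> ?B" using spectral_AE[OF \<mu>] by eventually_elim auto
  qed (use E_m[of k] B_m in \<open>auto simp: spectral_sets[OF \<mu>]\<close>)
  also have "\<dots> \<le> measure \<mu> (E k) + measure \<mu> ?B"
    using E_m[of k] B_m by (intro measure_Un_le) (auto simp: spectral_sets[OF \<mu>])
  finally have "measure \<mu> (- K) < e" using k K(3) by simp
  moreover have "f t \<le> ennreal (real k)" if "t \<in> K" for t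
    using that K(1) by (auto simp: E_def not_less)
  ultimately show ?thesis using that[OF f K(2), of k] K(1) by blast
qed

text \<open>
  Vectors whose spectral measure has a bounded density have square summable orbits, and cutting
  an absolutely continuous vector off outside a compact set on which the density is bounded
  shows that such vectors are dense.
\<close>

theorem ac_vectors_approx:
  assumes x: "x \<in> ac_vectors" and e: "e > 0"
  obtains \<eta> C where "norm (x - \<eta>) < e" "bounded_orbit C \<eta>"
proof -
  obtain \<mu> where \<mu>: "spectral_meas x \<mu>" and ac: "absolutely_continuous lborel \<mu>"
    using x by (auto simp: ac_vectors_def)
  note [measurable_cong] = spectral_sets[OF \<mu>]
  interpret finite_measure \<mu> by (rule spectral_finite[OF \<mu>])
  \<comment> \<open>The mass left out is below e^2 because it will be the squared distance from x to
    the cut-off vector.\<close>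
  obtain f K k where f: "f \<in> borel_measurable lborel" "density lborel f = \<mu>" and K: "compact K" "K \<subseteq> {0..<2*pi}"
    and fK: "\<And>t. t \<in> K \<Longrightarrow> f t \<le> ennreal (real k)" and mK: "measure \<mu> (- K) < e\<^sup>2"
    using spectral_compact_approx[OF \<mu> ac, of "e\<^sup>2"] e by (metis zero_less_power)
  have [measurable]: "f \<in> borel_measurable borel" using f(1) by simp
  have K_m [measurable]: "K \<in> sets borel" using K by (simp add: compact_imp_closed)
  define L where "L = cis ` K"
  have L: "closed L" unfolding L_def by (intro compact_imp_closed compact_cis_image K)
  have AE_L: "AE t in \<mu>. cis t \<in> L \<longleftrightarrow> t \<in> K"
    using spectral_AE[OF \<mu>] by eventually_elim (simp only: L_def cis_mem_image_iff[OF K(2)])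
  note [measurable] = borel_closed[OF L]
  obtain \<eta> P where \<eta>: "\<And>q. (norm (tp_op q \<eta>))\<^sup>2 = (\<integral>t. (cmod (tp_eval q (cis t)))\<^sup>2 * indicator L (cis t) \<partial>\<mu>)"
    and x\<eta>: "(norm (x - \<eta>))\<^sup>2 = (\<integral>t. indicator (- L) (cis t) \<partial>\<mu>)"
    using spectral_cutoff[OF \<mu> L] by metis
  have "(\<integral>t. indicator (- L) (cis t) \<partial>\<mu>) = (\<integral>t. (indicator (- K) t :: real) \<partial>\<mu>)"
  proof (rule integral_cong_AE)
    show "AE t in \<mu>. indicator (- L) (cis t) = (indicator (- K) t :: real)"
      using AE_L by eventually_elim (auto simp: indicator_def)
  qed auto
  also have "\<dots> = measure \<mu> (- K)"
    by (simp add: spectral_space[OF \<mu>] Compl_eq_Diff_UNIV)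
  finally have "(norm (x - \<eta>))\<^sup>2 < e\<^sup>2" using x\<eta> mK by simp
  then have 1: "norm (x - \<eta>) < e" using e by (simp add: power2_less_imp_less)
  \<comment> \<open>On K the density is at most k, so the norm of q(A)\<eta> is controlled by the
    Lebesgue L^2 norm of q.\<close>
  have bound: "(norm (tp_op q \<eta>))\<^sup>2 \<le> real k * (\<integral>t. indicator {0..2*pi} t * (cmod (tp_eval q (cis t)))\<^sup>2 \<partial>lborel)" for q
  proof -
    let ?h = "\<lambda>t. (cmod (tp_eval q (cis t)))\<^sup>2"
    obtain B where B: "\<And>t. cmod (tp_eval q (cis t)) \<le> B" using tp_eval_cis_bounded by blast
    have hB: "?h t \<le> B\<^sup>2" for t by (intro power_mono B) auto
    have "integrable \<mu> (\<lambda>t. ?h t * indicator L (cis t))"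
      by (rule integrable_const_bound[where B = "B\<^sup>2"])
         (use hB in \<open>auto simp: indicator_def intro!: AE_I2\<close>)
    then have "ennreal ((norm (tp_op q \<eta>))\<^sup>2) = (\<integral>\<^sup>+t. ennreal (?h t * indicator L (cis t)) \<partial>\<mu>)"
      unfolding \<eta> by (intro nn_integral_eq_integral[symmetric]) auto
    also have "\<dots> = (\<integral>\<^sup>+t. ennreal (?h t * indicator K t) \<partial>\<mu>)"
      by (rule nn_integral_cong_AE) (use AE_L in \<open>eventually_elim, auto simp: indicator_def\<close>)
    also have "\<dots> = (\<integral>\<^sup>+t. f t * ennreal (?h t * indicator K t) \<partial>lborel)"
      unfolding f(2)[symmetric] by (intro nn_integral_density) (use f in auto)
    also have "\<dots> \<le> (\<integral>\<^sup>+t. ennreal (real k * (indicator {0..2*pi} t * ?h t)) \<partial>lborel)"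
    proof (rule nn_integral_mono)
      fix t
      show "f t * ennreal (?h t * indicator K t) \<le> ennreal (real k * (indicator {0..2*pi} t * ?h t))"
      proof (cases "t \<in> K")
        case True
        then have "t \<in> {0..2*pi}" using K(2) by auto
        then show ?thesis using mult_right_mono[OF fK[OF True], of "ennreal (?h t)"] True
          by (simp add: ennreal_mult)
      qed simp
    qed
    also have "\<dots> = ennreal (\<integral>t. real k * (indicator {0..2*pi} t * ?h t) \<partial>lborel)"
    proof (rule nn_integral_eq_integral)
      have "integrable lborel (\<lambda>t. indicator {0..2*pi} t *\<^sub>R ?h t)"
        by (intro borel_integrable_compact continuous_intros continuous_tp_eval_cis) auto
      then show "integrable lborel (\<lambda>t. real k * (indicator {0..2*pi} t * ?h t))" by simp
    qed auto
    finally show ?thesis by (subst (asm) ennreal_le_iff) (auto intro!: integral_nonneg_AE)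
  qed
  have "bounded_orbit (2 * pi * real k) \<eta>"
    unfolding bounded_orbit_def
  proof (intro allI)
    fix y N
    define c where "c n = cinner y ((A ^^ n) \<eta>)" for n
    define S where "S = (\<Sum>n<N. (cmod (c n))\<^sup>2)"
    \<comment> \<open>The coefficients are chosen by duality: with them <y, q(A)\<eta>> is S itself.
      Cauchy-Schwarz and Parseval then give S^2 \<le> |y|^2 k 2 pi S, and one factor S
      cancels.\<close>
    define q where "q = map (\<lambda>n. (int n, cnj (c n))) [0..<N]"
    have ev: "tp_eval q (cis t) = (\<Sum>n<N. cnj (c n) * cis (real n * t))" for t
      by (simp add: q_def tp_eval_def o_def interv_sum_list_conv_sum_set_nat atLeast0LessThan cis_power_int)
    have op: "tp_op q \<eta> = (\<Sum>n<N. scaleC (cnj (c n)) ((A ^^ n) \<eta>))"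
      by (simp add: q_def tp_op_def o_def interv_sum_list_conv_sum_set_nat atLeast0LessThan ipow_of_nat)
    have "complex_of_real S = cinner y (tp_op q \<eta>)"
      by (simp add: op S_def cinner_sum_right cinner_scaleC_right c_def[symmetric] complex_norm_square mult.commute del: of_real_power)
    then have "S \<le> norm y * norm (tp_op q \<eta>)"
      using norm_cinner_le[of y "tp_op q \<eta>"] by (metis abs_le_D1 norm_of_real)
    moreover have "0 \<le> S" by (simp add: S_def sum_nonneg)
    ultimately have "S\<^sup>2 \<le> (norm y * norm (tp_op q \<eta>))\<^sup>2" by (intro power_mono)
    also have "\<dots> = (norm y)\<^sup>2 * (norm (tp_op q \<eta>))\<^sup>2" by (simp add: power_mult_distrib)
    also have "\<dots> \<le> (norm y)\<^sup>2 * (real k * (2 * pi * S))"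
      using bound[of q] unfolding ev integral_norm_trig_sum by (intro mult_left_mono) (auto simp: S_def)
    finally have "S * S \<le> S * ((norm y)\<^sup>2 * real k * 2 * pi)" by (simp add: power2_eq_square mult_ac)
    then have "S \<le> (norm y)\<^sup>2 * real k * 2 * pi"
      using \<open>0 \<le> S\<close> by (cases "S = 0") auto
    then show "(\<Sum>n<N. (cmod (cinner y ((A ^^ n) \<eta>)))\<^sup>2) \<le> 2 * pi * real k * (norm y)\<^sup>2"
      by (simp add: S_def c_def mult_ac)
  qed
  with 1 show ?thesis by (rule that)
qed

end

section \<open>Wave operators\<close>

lemma sum_mult_sqrt_le:
  fixes u v :: "'i \<Rightarrow> real"
  assumes "\<And>i. i \<in> S \<Longrightarrow> 0 \<le> u i" "\<And>i. i \<in> S \<Longrightarrow> 0 \<le> v i" "sum u S \<le> a" "sum v S \<le> b"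
  shows "(\<Sum>i\<in>S. sqrt (u i) * sqrt (v i)) \<le> sqrt a * sqrt b"
proof -
  have "(\<Sum>i\<in>S. sqrt (u i) * sqrt (v i)) \<le> L2_set (\<lambda>i. sqrt (u i)) S * L2_set (\<lambda>i. sqrt (v i)) S"
    using L2_set_mult_ineq[of "\<lambda>i. sqrt (u i)" "\<lambda>i. sqrt (v i)" S] assms(1,2) by simp
  also have "\<dots> = sqrt (sum u S) * sqrt (sum v S)"
    using assms(1,2) by (simp add: L2_set_def)
  also have "\<dots> \<le> sqrt a * sqrt b"
  proof (intro mult_mono real_sqrt_le_mono assms(3,4))
    have "0 \<le> a" by (rule order_trans[OF sum_nonneg assms(3)]) (rule assms(1))
    then show "0 \<le> sqrt a" by simp
    show "0 \<le> sqrt (sum v S)" using assms(2) by (simp add: sum_nonneg)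
  qed
  finally show ?thesis .
qed

text \<open>The vector U^{-n} V^n x. It is defined outside the locale, so that both orders of U and
  V are instances of one constant.\<close>

definition wave_seq :: "('a::complex_hilbert \<Rightarrow> 'a) \<Rightarrow> ('a \<Rightarrow> 'a) \<Rightarrow> 'a \<Rightarrow> nat \<Rightarrow> 'a" where
  "wave_seq U V x n = unitary_operator.ipow U (- int n) ((V ^^ n) x)"

text \<open>Meaningful on \<open>wave_domain\<close> only; elsewhere \<open>lim\<close> is an
  arbitrary vector.\<close>

definition wave :: "('a::complex_hilbert \<Rightarrow> 'a) \<Rightarrow> ('a \<Rightarrow> 'a) \<Rightarrow> 'a \<Rightarrow> 'a" where
  "wave U V x = lim (wave_seq U V x)"

locale unitary_pair = U: unitary_operator U + V: unitary_operator V
  for U V :: "'a::complex_hilbert \<Rightarrow> 'a"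
begin

lemma swap: "unitary_pair V U"
  by unfold_locales

lemma wave_seq_eq: "wave_seq U V x n = U.ipow (- int n) (V.ipow (int n) x)"
  by (simp add: wave_seq_def V.ipow_of_nat)

lemma norm_wave_seq [simp]: "norm (wave_seq U V x n) = norm x"
  by (simp add: wave_seq_eq)

lemma wave_seq_add: "wave_seq U V (x + y) n = wave_seq U V x n + wave_seq U V y n"
  by (simp add: wave_seq_eq U.ipow_add V.ipow_add)

lemma wave_seq_diff: "wave_seq U V (x - y) n = wave_seq U V x n - wave_seq U V y n"
  by (simp add: wave_seq_eq U.ipow_diff V.ipow_diff)

lemma wave_seq_scale: "wave_seq U V (scaleC c x) n = scaleC c (wave_seq U V x n)"
  by (simp add: wave_seq_eq U.ipow_scale V.ipow_scale)

lemma wave_seq_shift: "wave_seq U V (V x) n = U (wave_seq U V x (Suc n))"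
  by (simp add: wave_seq_eq U.A_ipow V.ipow_1[symmetric] V.ipow_ipow add.commute del: V.ipow_1)

definition wave_domain :: "'a set" where
  "wave_domain = {x. convergent (wave_seq U V x)}"

lemma wave_lim: "x \<in> wave_domain \<Longrightarrow> wave_seq U V x \<longlonglongrightarrow> wave U V x"
  by (simp add: wave_domain_def wave_def convergent_LIMSEQ_iff)

lemma wave_eqI: "wave_seq U V x \<longlonglongrightarrow> y \<Longrightarrow> x \<in> wave_domain \<and> wave U V x = y"
  by (auto simp: wave_domain_def wave_def convergent_def limI)

lemma wave_add:
  assumes "x \<in> wave_domain" "y \<in> wave_domain"
  shows "x + y \<in> wave_domain \<and> wave U V (x + y) = wave U V x + wave U V y"
  using tendsto_add[OF wave_lim[OF assms(1)] wave_lim[OF assms(2)]]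
  by (intro wave_eqI) (simp add: wave_seq_add[abs_def])

lemma wave_scale:
  assumes "x \<in> wave_domain"
  shows "scaleC c x \<in> wave_domain \<and> wave U V (scaleC c x) = scaleC c (wave U V x)"
  using tendsto_scaleC[OF wave_lim[OF assms]]
  by (intro wave_eqI) (simp add: wave_seq_scale[abs_def])

lemma wave_intertwines:
  assumes "x \<in> wave_domain"
  shows "V x \<in> wave_domain \<and> wave U V (V x) = U (wave U V x)"
proof (rule wave_eqI)
  have "(\<lambda>n. U (wave_seq U V x (Suc n))) \<longlonglongrightarrow> U (wave U V x)"
    using wave_lim[OF assms] by (intro bounded_linear.tendsto[OF U.bounded_linear_A] LIMSEQ_Suc)
  then show "wave_seq U V (V x) \<longlonglongrightarrow> U (wave U V x)"
    by (simp add: wave_seq_shift[abs_def])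
qed

lemma wave_intertwines_power:
  assumes "x \<in> wave_domain"
  shows "(V ^^ n) x \<in> wave_domain \<and> wave U V ((V ^^ n) x) = (U ^^ n) (wave U V x)"
  by (induction n) (auto simp: assms wave_intertwines)

lemma cinner_wave:
  assumes "x \<in> wave_domain" "y \<in> wave_domain"
  shows "cinner (wave U V x) (wave U V y) = cinner x y"
proof (rule LIMSEQ_unique)
  show "(\<lambda>n. cinner (wave_seq U V x n) (wave_seq U V y n)) \<longlonglongrightarrow> cinner (wave U V x) (wave U V y)"
    by (intro tendsto_cinner wave_lim assms)
  show "(\<lambda>n. cinner (wave_seq U V x n) (wave_seq U V y n)) \<longlonglongrightarrow> cinner x y"
    by (simp add: wave_seq_eq U.cinner_ipow_left U.ipow_ipow V.cinner_ipow_left V.ipow_ipow)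
qed

text \<open>With W_n = U^{-n} V^n and limit W, the isometry W_n carries x - V^{-n} U^n W x to W_n x
  - W x. The error of the reversed sequence at W x therefore has the same norm as the error of the
  given one, and tends to 0 with it.\<close>

lemma wave_inverse:
  assumes "x \<in> wave_domain"
  shows "wave V U (wave U V x) = x"
proof -
  interpret VU: unitary_pair V U by (rule swap)
  have "norm (wave_seq V U (wave U V x) n - x) = norm (wave_seq U V x n - wave U V x)" for n
  proof -
    have "wave_seq U V x n - wave U V x = U.ipow (- int n) (V.ipow (int n) (x - wave_seq V U (wave U V x) n))"
      by (simp add: wave_seq_eq VU.wave_seq_eq V.ipow_diff U.ipow_diff U.ipow_ipow V.ipow_ipow)
    then show ?thesis by (simp add: norm_minus_commute)
  qed
  moreover have "(\<lambda>n. norm (wave_seq U V x n - wave U V x)) \<longlonglongrightarrow> 0"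
    using wave_lim[OF assms] by (simp add: LIM_zero tendsto_norm_zero)
  ultimately have "(\<lambda>n. norm (wave_seq V U (wave U V x) n - x)) \<longlonglongrightarrow> 0" by simp
  then have "wave_seq V U (wave U V x) \<longlonglongrightarrow> x"
    by (rule LIM_zero_cancel[OF tendsto_norm_zero_cancel])
  then show ?thesis using VU.wave_eqI by blast
qed

text \<open>By isometry and intertwining, x and its image have the same moments, so one measure
  serves both.\<close>

lemma wave_spectral_meas:
  assumes "x \<in> wave_domain" "V.spectral_meas x \<mu>"
  shows "U.spectral_meas (wave U V x) \<mu>"
  using assms cinner_wave[OF assms(1)] wave_intertwines_power[OF assms(1)]
  unfolding U.spectral_meas_def V.spectral_meas_def by metis

lemma wave_ac_vectors:
  assumes "x \<in> wave_domain" "x \<in> V.ac_vectors"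
  shows "wave U V x \<in> U.ac_vectors"
  using assms wave_spectral_meas unfolding U.ac_vectors_def V.ac_vectors_def by blast

text \<open>Every map x to \<open>wave_seq U V x n\<close> is isometric, so the closeness of x to
  \<eta> transfers uniformly in n.\<close>

lemma wave_domain_closed:
  assumes "\<And>e. e > 0 \<Longrightarrow> \<exists>\<eta>\<in>wave_domain. norm (x - \<eta>) < e"
  shows "x \<in> wave_domain"
proof -
  have "Cauchy (wave_seq U V x)"
  proof (rule metric_CauchyI)
    fix e :: real assume "e > 0"
    then obtain \<eta> where \<eta>: "\<eta> \<in> wave_domain" "norm (x - \<eta>) < e / 3"
      using assms[of "e / 3"] by auto
    have "Cauchy (wave_seq U V \<eta>)" using \<eta>(1) by (simp add: wave_domain_def Cauchy_convergent_iff)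
    then obtain N where N: "\<And>m n. m \<ge> N \<Longrightarrow> n \<ge> N \<Longrightarrow> dist (wave_seq U V \<eta> m) (wave_seq U V \<eta> n) < e / 3"
      using \<open>e > 0\<close> unfolding Cauchy_def by (meson divide_pos_pos zero_less_numeral)
    have close: "dist (wave_seq U V x n) (wave_seq U V \<eta> n) < e / 3" for n
      using \<eta>(2) by (simp add: dist_norm wave_seq_diff[symmetric])
    have "dist (wave_seq U V x m) (wave_seq U V x n) < e" if "m \<ge> N" "n \<ge> N" for m n
      using N[OF that] close[of m] close[of n]
        dist_triangle[of "wave_seq U V x m" "wave_seq U V x n" "wave_seq U V \<eta> m"]
        dist_triangle[of "wave_seq U V \<eta> m" "wave_seq U V x n" "wave_seq U V \<eta> n"]
      by (simp add: dist_commute)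
    then show "\<exists>M. \<forall>m\<ge>M. \<forall>n\<ge>M. dist (wave_seq U V x m) (wave_seq U V x n) < e" by blast
  qed
  then show ?thesis by (simp add: wave_domain_def Cauchy_convergent_iff)
qed

end

text \<open>
  Here \<open>U - V\<close> is of trace class. The form \<open>\<alpha>\<close> is thought of as \<open>\<Sum>\<^sub>k w\<^sub>k |\<langle>e\<^sub>k, x\<rangle>|\<^sup>2\<close> with unit vectors
  \<open>e\<^sub>k\<close> and summable weights \<open>w\<^sub>k \<ge> 0\<close> of sum \<open>D\<close>; the last assumption is all that is used of this.
\<close>

locale trace_class_perturbation = unitary_pair U V
  for U V :: "'a::complex_hilbert \<Rightarrow> 'a" +
  fixes \<alpha> :: "'a \<Rightarrow> real" and D :: real
  assumes form_nonneg: "0 \<le> \<alpha> x"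
    and form_bound: "cmod (cinner x (U y - V y)) \<le> sqrt (\<alpha> x) * sqrt (\<alpha> y)"
    and form_trace: "(\<And>y. (\<Sum>n<N::nat. (cmod (cinner y (u n)))\<^sup>2) \<le> C * (norm y)\<^sup>2) \<Longrightarrow> (\<Sum>n<N. \<alpha> (u n)) \<le> C * D"
begin

lemma swap_trace_class: "trace_class_perturbation V U \<alpha> D"
proof -
  interpret VU: unitary_pair V U by (rule swap)
  have "cmod (cinner x (V y - U y)) \<le> sqrt (\<alpha> x) * sqrt (\<alpha> y)" for x y
    using form_bound[of x y] by (simp add: cinner_diff_right norm_minus_commute)
  then show ?thesis
    using form_nonneg form_trace by unfold_locales auto
qed

text \<open>The trace bound for a single vector, with C = |x|^2 supplied by Cauchy-Schwarz.\<close>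

lemma form_le: "\<alpha> x \<le> D * (norm x)\<^sup>2"
proof -
  have "(\<Sum>n<1::nat. (cmod (cinner y x))\<^sup>2) \<le> (norm x)\<^sup>2 * (norm y)\<^sup>2" for y
    using power_mono[OF norm_cinner_le[of y x], of 2] by (simp add: power_mult_distrib mult.commute)
  from form_trace[where N = 1 and u = "\<lambda>_. x", OF this] show ?thesis by (simp add: mult.commute)
qed

text \<open>\<open>form_bound\<close> is tested against U y - V y itself; \<open>form_le\<close>
  bounds the first factor by sqrt D times the norm of that vector, which cancels.\<close>

lemma norm_diff_le: "norm (U y - V y) \<le> sqrt D * sqrt (\<alpha> y)"
proof (cases "U y = V y")
  case True
  have "0 \<le> sqrt D * sqrt (\<alpha> y)"
  proof (cases "y = 0")
    case True
    then have "\<alpha> y = 0" using form_le[of 0] form_nonneg[of 0] by simp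
    then show ?thesis by simp
  next
    case False
    have "0 \<le> D * (norm y)\<^sup>2" by (rule order_trans[OF form_nonneg form_le])
    then have "0 \<le> D" using False by (simp add: zero_le_mult_iff)
    then show ?thesis by (simp add: form_nonneg)
  qed
  then show ?thesis using True by simp
next
  case False
  let ?T = "U y - V y"
  have "(norm ?T)\<^sup>2 \<le> sqrt (\<alpha> ?T) * sqrt (\<alpha> y)"
    using form_bound[of ?T y] by (simp add: cinner_self norm_power)
  also have "\<dots> \<le> sqrt (D * (norm ?T)\<^sup>2) * sqrt (\<alpha> y)"
    by (intro mult_right_mono real_sqrt_le_mono form_le) (simp add: form_nonneg)
  also have "\<dots> = norm ?T * (sqrt D * sqrt (\<alpha> y))" by (simp add: real_sqrt_mult)
  finally show ?thesis using False by (simp add: power2_eq_square)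
qed

context
  fixes x C
  assumes orbit: "V.bounded_orbit C x"
begin

text \<open>The unitaries U^k and V^m move to y without changing its norm, so the constant C
  survives both.\<close>

lemma orbit_bound:
  "(\<Sum>n<N. (cmod (cinner y (U.ipow k (V.ipow (int (m + n)) x))))\<^sup>2) \<le> C * (norm y)\<^sup>2"
proof -
  let ?z = "V.ipow (- int m) (U.ipow (- k) y)"
  have "cmod (cinner y (U.ipow k (V.ipow (int (m + n)) x))) = cmod (cinner ?z ((V ^^ n) x))" for n
    by (simp add: U.cinner_ipow_left V.cinner_ipow_left V.ipow_ipow V.ipow_of_nat[symmetric] U.ipow_ipow)
  then have "(\<Sum>n<N. (cmod (cinner y (U.ipow k (V.ipow (int (m + n)) x))))\<^sup>2) =
      (\<Sum>n<N. (cmod (cinner ?z ((V ^^ n) x)))\<^sup>2)" by (simp only:)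
  also have "\<dots> \<le> C * (norm ?z)\<^sup>2" using orbit unfolding V.bounded_orbit_def by blast
  finally show ?thesis by simp
qed

lemma form_sum_le: "(\<Sum>n<N. \<alpha> (U.ipow k (V.ipow (int (m + n)) x))) \<le> C * D"
  by (rule form_trace) (rule orbit_bound)

definition "tail_form n = \<alpha> (V.ipow (int n) x)"

lemma tail_form_nonneg: "0 \<le> tail_form n"
  by (simp add: tail_form_def form_nonneg)

lemma tail_form_summable: "summable tail_form"
proof (rule summableI_nonneg_bounded)
  show "sum tail_form {..<N} \<le> C * D" for N
    using form_sum_le[of 0 0 N] by (simp add: tail_form_def)
qed (rule tail_form_nonneg)

definition "tail m = (\<Sum>n. tail_form (n + m))"

lemma tail_sum_le: "(\<Sum>n<N. tail_form (m + n)) \<le> tail m"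
  unfolding tail_def
  using sum_le_suminf[OF summable_ignore_initial_segment[OF tail_form_summable, of m], of "{..<N}"] tail_form_nonneg
  by (simp add: add.commute)

lemma tail_tendsto: "tail \<longlonglongrightarrow> 0"
proof -
  have "tail = (\<lambda>m. suminf tail_form - sum tail_form {..<m})"
    unfolding tail_def[abs_def] by (rule ext) (rule suminf_minus_initial_segment[OF tail_form_summable])
  moreover have "(\<lambda>m. suminf tail_form - sum tail_form {..<m}) \<longlonglongrightarrow> suminf tail_form - suminf tail_form"
    by (intro tendsto_intros summable_LIMSEQ tail_form_summable)
  ultimately show ?thesis by simp
qed

lemma wave_seq_step: "wave_seq U V x n - wave_seq U V x (Suc n) =
    U.ipow (- int (Suc n)) (U (V.ipow (int n) x) - V (V.ipow (int n) x))"
proof -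
  have "wave_seq U V x n = U.ipow (- int (Suc n)) (U.ipow 1 (V.ipow (int n) x))"
    unfolding wave_seq_eq U.ipow_ipow by simp
  moreover have "wave_seq U V x (Suc n) = U.ipow (- int (Suc n)) (V (V.ipow (int n) x))"
    unfolding wave_seq_eq V.A_ipow by (simp add: add.commute)
  ultimately show ?thesis by (simp only: U.ipow_diff U.ipow_1)
qed

text \<open>Each increment contains U - V applied to an orbit vector, which yields the
  \<open>tail_form\<close> factor, while all other unitaries move to the opposite argument. The
  power of U that remains there depends on m - n only; it is constant along a diagonal, so
  \<open>form_sum_le\<close> applies with a fixed k.\<close>

lemma wave_gram_step:
  "cmod (cinner (wave_seq U V x m) (wave_seq U V x n) - cinner (wave_seq U V x (Suc m)) (wave_seq U V x (Suc n)))
    \<le> sqrt (\<alpha> (U.ipow (int m + 1 - int n) (V.ipow (int n) x))) * sqrt (tail_form m)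
     + sqrt (\<alpha> (U.ipow (int n - int m) (V.ipow (int m + 1) x))) * sqrt (tail_form n)"
proof -
  let ?w = "wave_seq U V x"
  let ?T = "\<lambda>n. U (V.ipow (int n) x) - V (V.ipow (int n) x)"
  have "cinner (?w m) (?w n) - cinner (?w (Suc m)) (?w (Suc n)) =
     cinner (?w m - ?w (Suc m)) (?w n) + cinner (?w (Suc m)) (?w n - ?w (Suc n))"
    by (simp add: cinner_diff_left cinner_diff_right)
  also have "cinner (?w m - ?w (Suc m)) (?w n) = cinner (?T m) (U.ipow (int m + 1 - int n) (V.ipow (int n) x))"
    unfolding wave_seq_step by (simp add: U.cinner_ipow_left wave_seq_eq U.ipow_ipow algebra_simps)
  also have "cinner (?w (Suc m)) (?w n - ?w (Suc n)) = cinner (U.ipow (int n - int m) (V.ipow (int m + 1) x)) (?T n)"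
    unfolding wave_seq_step by (simp add: U.cinner_ipow_left wave_seq_eq U.ipow_ipow algebra_simps)
  finally have eq: "cinner (?w m) (?w n) - cinner (?w (Suc m)) (?w (Suc n)) =
     cinner (?T m) (U.ipow (int m + 1 - int n) (V.ipow (int n) x)) +
     cinner (U.ipow (int n - int m) (V.ipow (int m + 1) x)) (?T n)" .
  have "cmod (cinner (?T m) y) \<le> sqrt (\<alpha> y) * sqrt (tail_form m)" for y
    using form_bound[of y "V.ipow (int m) x"] cinner_commute[of "?T m" y]
    by (simp add: tail_form_def)
  moreover have "cmod (cinner y (?T n)) \<le> sqrt (\<alpha> y) * sqrt (tail_form n)" for y
    unfolding tail_form_def by (rule form_bound)
  ultimately show ?thesis
    unfolding eq by (intro order_trans[OF norm_triangle_ineq] add_mono)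
qed

lemma wave_gram_telescope:
  "cmod (cinner (wave_seq U V x m) (wave_seq U V x n) - cinner (wave_seq U V x (m + N)) (wave_seq U V x (n + N)))
    \<le> sqrt (C * D) * sqrt (tail m) + sqrt (C * D) * sqrt (tail n)"
proof -
  define G where "G a = cinner (wave_seq U V x (m + a)) (wave_seq U V x (n + a))" for a
  have "G 0 - G N = (\<Sum>a<N. G a - G (Suc a))" by (simp add: sum_lessThan_telescope')
  then have "cmod (G 0 - G N) \<le> (\<Sum>a<N. cmod (G a - G (Suc a)))" by (simp add: norm_sum)
  also have "\<dots> \<le> (\<Sum>a<N. sqrt (\<alpha> (U.ipow (int m + 1 - int n) (V.ipow (int (n + a)) x))) * sqrt (tail_form (m + a))
     + sqrt (\<alpha> (U.ipow (int n - int m) (V.ipow (int (Suc m + a)) x))) * sqrt (tail_form (n + a)))"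
  proof (rule sum_mono)
    fix a
    show "cmod (G a - G (Suc a)) \<le> sqrt (\<alpha> (U.ipow (int m + 1 - int n) (V.ipow (int (n + a)) x))) * sqrt (tail_form (m + a))
     + sqrt (\<alpha> (U.ipow (int n - int m) (V.ipow (int (Suc m + a)) x))) * sqrt (tail_form (n + a))"
      using wave_gram_step[of "m + a" "n + a"] by (simp add: G_def algebra_simps)
  qed
  \<comment> \<open>Cauchy-Schwarz in the diagonal index: the forms that contain a power of U sum to
    at most C D, the others to a tail.\<close>
  also have "\<dots> \<le> sqrt (C * D) * sqrt (tail m) + sqrt (C * D) * sqrt (tail n)"
    unfolding sum.distrib
    by (intro add_mono sum_mult_sqrt_le form_sum_le tail_sum_le) (auto simp: form_nonneg tail_form_nonneg)
  finally show ?thesis by (simp add: G_def)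
qed

text \<open>Consecutive members of \<open>wave_seq\<close> approach each other, since their distance
  is the norm of (U - V) V^n x and is bounded by the root of a summable sequence. Members at a fixed
  index distance therefore merge far out, although convergence is not yet known.\<close>

lemma wave_gram_limit:
  "(\<lambda>N. cinner (wave_seq U V x (m + N)) (wave_seq U V x (n + N))) \<longlonglongrightarrow> of_real ((norm x)\<^sup>2)"
proof -
  let ?w = "wave_seq U V x"
  have step: "(\<lambda>n. ?w n - ?w (Suc n)) \<longlonglongrightarrow> 0"
  proof (rule Lim_null_comparison)
    show "\<forall>\<^sub>F n in sequentially. norm (?w n - ?w (Suc n)) \<le> sqrt D * sqrt (tail_form n)"
      by (auto simp: wave_seq_step norm_diff_le tail_form_def)
    have "tail_form \<longlonglongrightarrow> 0" by (rule summable_LIMSEQ_zero[OF tail_form_summable])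
    then show "(\<lambda>n. sqrt D * sqrt (tail_form n)) \<longlonglongrightarrow> 0"
      using tendsto_mult[OF tendsto_const tendsto_real_sqrt, of tail_form 0 sequentially "sqrt D"] by simp
  qed
  have shift: "(\<lambda>N. ?w N - ?w (k + N)) \<longlonglongrightarrow> 0" for k
  proof (induction k)
    case (Suc k)
    have "(\<lambda>N. ?w (N + k) - ?w (Suc (N + k))) \<longlonglongrightarrow> 0" by (rule LIMSEQ_ignore_initial_segment[OF step])
    from tendsto_add[OF Suc this] show ?case by (simp add: add.commute)
  qed simp
  have "(\<lambda>N. (?w N - ?w (n + N)) - (?w N - ?w (m + N))) \<longlonglongrightarrow> 0"
    using tendsto_diff[OF shift shift] by simp
  then have "(\<lambda>N. ?w (m + N) - ?w (n + N)) \<longlonglongrightarrow> 0" by simp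
  then have "(\<lambda>N. norm x * norm (?w (m + N) - ?w (n + N))) \<longlonglongrightarrow> 0"
    by (intro tendsto_mult_right_zero tendsto_norm_zero)
  then have lim: "(\<lambda>N. cinner (?w (m + N)) (?w (m + N) - ?w (n + N))) \<longlonglongrightarrow> 0"
  proof (rule Lim_null_comparison[rotated])
    show "\<forall>\<^sub>F N in sequentially. norm (cinner (?w (m + N)) (?w (m + N) - ?w (n + N))) \<le>
        norm x * norm (?w (m + N) - ?w (n + N))"
    proof (intro always_eventually allI)
      show "norm (cinner (?w (m + N)) (?w (m + N) - ?w (n + N))) \<le> norm x * norm (?w (m + N) - ?w (n + N))" for N
        using norm_cinner_le[of "?w (m + N)" "?w (m + N) - ?w (n + N)"] by simp
    qed
  qed
  have "cinner (?w (m + N)) (?w (n + N)) = of_real ((norm x)\<^sup>2) - cinner (?w (m + N)) (?w (m + N) - ?w (n + N))" for N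
    by (simp add: cinner_diff_right cinner_self)
  then show ?thesis
    using tendsto_diff[OF tendsto_const lim, of "of_real ((norm x)\<^sup>2)"] by simp
qed

text \<open>
  Pearson's estimate: \<open>\<langle>W\<^sub>m x, W\<^sub>n x\<rangle>\<close> with \<open>W\<^sub>n = U\<^sup>-\<^sup>n V\<^sup>n\<close> tends to \<open>\<parallel>x\<parallel>\<^sup>2\<close> along the diagonals, and
  the sum of its increments along a diagonal is controlled by the trace form.
\<close>

theorem bounded_orbit_wave_domain: "x \<in> wave_domain"
proof -
  let ?w = "wave_seq U V x"
  define b where "b m = sqrt (C * D) * sqrt (tail m)" for m
  have gram: "cmod (cinner (?w m) (?w n) - of_real ((norm x)\<^sup>2)) \<le> b m + b n" for m n
  proof (rule LIMSEQ_le_const2)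
    show "(\<lambda>N. cmod (cinner (?w m) (?w n) - cinner (?w (m + N)) (?w (n + N)))) \<longlonglongrightarrow>
       cmod (cinner (?w m) (?w n) - of_real ((norm x)\<^sup>2))"
      by (intro tendsto_intros wave_gram_limit)
  qed (use wave_gram_telescope in \<open>auto simp: b_def\<close>)
  have dist: "(dist (?w m) (?w n))\<^sup>2 \<le> 2 * (b m + b n)" for m n
  proof -
    \<comment> \<open>All members have the norm of x, so their squared distance is twice the defect
      of the real part of the inner product.\<close>
    have "(dist (?w m) (?w n))\<^sup>2 = 2 * ((norm x)\<^sup>2 - inner (?w m) (?w n))"
      using power2_norm_eq_inner[of "?w m"] power2_norm_eq_inner[of "?w n"]
      by (simp add: dist_norm power2_norm_eq_inner[of "?w m - ?w n"] inner_diff inner_commute)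
    also have "(norm x)\<^sup>2 - inner (?w m) (?w n) \<le> cmod (cinner (?w m) (?w n) - of_real ((norm x)\<^sup>2))"
      using abs_Re_le_cmod[of "cinner (?w m) (?w n) - of_real ((norm x)\<^sup>2)"] by simp
    finally show ?thesis using gram[of m n] by simp
  qed
  have "b \<longlonglongrightarrow> sqrt (C * D) * sqrt 0"
    unfolding b_def[abs_def] by (intro tendsto_intros tail_tendsto)
  then have b0: "b \<longlonglongrightarrow> 0" by simp
  have "Cauchy ?w"
  proof (rule metric_CauchyI)
    fix e :: real assume e: "e > 0"
    have "\<forall>\<^sub>F n in sequentially. b n < e\<^sup>2 / 4"
      by (rule order_tendstoD[OF b0]) (use e in auto)
    then obtain N where N: "\<And>n. n \<ge> N \<Longrightarrow> b n < e\<^sup>2 / 4" by (auto simp: eventually_sequentially)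
    have "dist (?w m) (?w n) < e" if "m \<ge> N" "n \<ge> N" for m n
    proof (rule power2_less_imp_less)
      show "(dist (?w m) (?w n))\<^sup>2 < e\<^sup>2"
        using dist[of m n] N[OF that(1)] N[OF that(2)] by simp
    qed (use e in auto)
    then show "\<exists>M. \<forall>m\<ge>M. \<forall>n\<ge>M. dist (?w m) (?w n) < e" by blast
  qed
  then show ?thesis by (simp add: wave_domain_def Cauchy_convergent_iff)
qed

end

theorem ac_vectors_wave_domain: "V.ac_vectors \<subseteq> wave_domain"
proof
  fix x assume x: "x \<in> V.ac_vectors"
  show "x \<in> wave_domain"
  proof (rule wave_domain_closed)
    fix e :: real assume "e > 0"
    with x obtain \<eta> C where "norm (x - \<eta>) < e" "V.bounded_orbit C \<eta>"
      using V.ac_vectors_approx by metis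
    then show "\<exists>\<eta>\<in>wave_domain. norm (x - \<eta>) < e" using bounded_orbit_wave_domain by blast
  qed
qed

end

section \<open>The essential spectrum of a unitary operator\<close>

lemma contraction_fixpoint:
  fixes S :: "'a::complete_space set"
  assumes "closed S" "S \<noteq> {}" "0 \<le> c" "c < 1" "f ` S \<subseteq> S"
    and "\<And>x y. x \<in> S \<Longrightarrow> y \<in> S \<Longrightarrow> dist (f x) (f y) \<le> c * dist x y"
  shows "\<exists>x\<in>S. f x = x"
  using Banach_fix[OF assms(1)[folded complete_eq_closed] assms(2-)] by blast

text \<open>A minimising sequence for the distance is Cauchy by the parallelogram law. Real
  orthogonality, applied to both v and \<open>scaleC \<i> v\<close>, is complex
  orthogonality.\<close>

lemma projection_exists:
  fixes M :: "'a::complex_hilbert set"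
  assumes M: "csubspace M" "closed M"
  obtains m where "m \<in> M" "\<And>v. v \<in> M \<Longrightarrow> cinner v (g - m) = 0"
proof -
  define d where "d = infdist g M"
  have ne: "M \<noteq> {}" using csubspaceD(1)[OF M(1)] by auto
  have d_le: "d \<le> norm (g - v)" if "v \<in> M" for v
    using infdist_le[OF that, of g] by (simp add: d_def dist_norm)
  have d0: "0 \<le> d" by (simp add: d_def infdist_nonneg)
  have "\<exists>v\<in>M. norm (g - v) < d + inverse (real (Suc n))" for n
  proof -
    have "infdist g M < d + inverse (real (Suc n))" by (simp add: d_def)
    then show ?thesis unfolding infdist_notempty[OF ne] dist_norm
      by (subst (asm) cInf_less_iff) (use ne in \<open>auto intro!: bdd_belowI[of _ 0]\<close>)
  qed
  then obtain v where v: "\<And>n. v n \<in> M" "\<And>n. norm (g - v n) < d + inverse (real (Suc n))" by metis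
  have par: "(norm (v m - v n))\<^sup>2 \<le> 2 * (norm (g - v m))\<^sup>2 + 2 * (norm (g - v n))\<^sup>2 - 4 * d\<^sup>2" for m n
  proof -
    let ?h = "scaleC (of_real (1/2)) (v m + v n)"
    have "?h \<in> M" by (intro csubspaceD[OF M(1)] v)
    then have "d\<^sup>2 \<le> (norm (g - ?h))\<^sup>2" by (intro power_mono d_le d0)
    moreover have "4 * (norm (g - ?h))\<^sup>2 = (norm ((g - v m) + (g - v n)))\<^sup>2"
    proof -
      have "(g - v m) + (g - v n) = 2 *\<^sub>R (g - ?h)"
        by (simp only: scaleC_of_real) (simp add: algebra_simps scaleR_2)
      then show ?thesis by (simp add: power_mult_distrib)
    qed
    moreover have "(norm ((g - v m) + (g - v n)))\<^sup>2 + (norm ((g - v n) - (g - v m)))\<^sup>2 =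
      2 * (norm (g - v m))\<^sup>2 + 2 * (norm (g - v n))\<^sup>2"
      unfolding power2_norm_eq_inner inner_add inner_diff by (simp add: inner_commute algebra_simps)
    moreover have "(g - v n) - (g - v m) = v m - v n" by simp
    ultimately show ?thesis by simp
  qed
  have lim: "(\<lambda>n. (norm (g - v n))\<^sup>2) \<longlonglongrightarrow> d\<^sup>2"
  proof (intro tendsto_power)
    show "(\<lambda>n. norm (g - v n)) \<longlonglongrightarrow> d"
    proof (rule tendsto_sandwich)
      show "\<forall>\<^sub>F n in sequentially. d \<le> norm (g - v n)" using v(1) d_le by simp
      show "\<forall>\<^sub>F n in sequentially. norm (g - v n) \<le> d + inverse (real (Suc n))"
        using v(2) by (intro always_eventually allI less_imp_le)
      show "(\<lambda>n. d + inverse (real (Suc n))) \<longlonglongrightarrow> d"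
        using tendsto_add[OF tendsto_const LIMSEQ_inverse_real_of_nat, of d] by simp
    qed simp
  qed
  have "Cauchy v"
  proof (rule metric_CauchyI)
    fix e :: real assume e: "e > 0"
    have "\<forall>\<^sub>F n in sequentially. (norm (g - v n))\<^sup>2 < d\<^sup>2 + e\<^sup>2 / 4"
      by (rule order_tendstoD[OF lim]) (use e in auto)
    then obtain N where N: "\<And>n. n \<ge> N \<Longrightarrow> (norm (g - v n))\<^sup>2 < d\<^sup>2 + e\<^sup>2 / 4"
      by (auto simp: eventually_sequentially)
    have "dist (v m) (v n) < e" if "m \<ge> N" "n \<ge> N" for m n
    proof (rule power2_less_imp_less)
      show "(dist (v m) (v n))\<^sup>2 < e\<^sup>2"
        using par[of m n] N[OF that(1)] N[OF that(2)] by (simp add: dist_norm)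
    qed (use e in auto)
    then show "\<exists>K. \<forall>m\<ge>K. \<forall>n\<ge>K. dist (v m) (v n) < e" by blast
  qed
  then obtain m where m: "v \<longlonglongrightarrow> m" using convergent_eq_Cauchy by blast
  have mM: "m \<in> M" using closed_sequentially[OF M(2)] v(1) m by blast
  have "norm (g - m) = d"
  proof -
    have "(\<lambda>n. (norm (g - v n))\<^sup>2) \<longlonglongrightarrow> (norm (g - m))\<^sup>2" by (intro tendsto_intros m)
    then have "(norm (g - m))\<^sup>2 = d\<^sup>2" using lim LIMSEQ_unique by blast
    then show ?thesis using d0 by simp
  qed
  have real_orth: "inner w (g - m) = 0" if w: "w \<in> M" for w
  proof (cases "w = 0")
    case False
    \<comment> \<open>The real s for which m + s w is nearest to g.\<close>
    define s where "s = inner w (g - m) / inner w w"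
    have "m + scaleC (of_real s) w \<in> M" by (intro csubspaceD[OF M(1)] mM w)
    then have "(norm (g - m))\<^sup>2 \<le> (norm ((g - m) - s *\<^sub>R w))\<^sup>2"
      using d_le[of "m + s *\<^sub>R w"] \<open>norm (g - m) = d\<close> by (intro power_mono) (auto simp: scaleC_of_real diff_diff_eq)
    also have "\<dots> = (norm (g - m))\<^sup>2 - 2 * s * inner w (g - m) + s * (s * inner w w)"
      unfolding power2_norm_eq_inner inner_diff by (simp add: inner_commute algebra_simps)
    also have "\<dots> = (norm (g - m))\<^sup>2 - (inner w (g - m))\<^sup>2 / inner w w"
      using False by (simp add: s_def power2_eq_square field_simps)
    finally have "(inner w (g - m))\<^sup>2 / inner w w \<le> 0" by simp
    then show ?thesis using False
      by (metis divide_eq_0_iff inner_eq_zero_iff inner_ge_zero order_antisym zero_le_divide_iff zero_le_power2 zero_eq_power2)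
  qed simp
  have "cinner w (g - m) = 0" if "w \<in> M" for w
    using real_orth[OF that] real_orth[OF csubspaceD(3)[OF M(1) that, of \<i>]] by (simp add: cinner_def complex_eq_iff)
  with mM show ?thesis by (rule that)
qed

lemma scaleC_in_span: "scaleC c u \<in> span {u, scaleC \<i> u}"
proof -
  have "scaleC c u = Re c *\<^sub>R u + Im c *\<^sub>R scaleC \<i> u"
    using arg_cong[OF complex_eq[of c], of "\<lambda>d. scaleC d u"]
    by (simp add: scaleC_add_left scaleC_of_real[symmetric] mult.commute del: complex_eq)
  then show ?thesis by (simp add: span_add span_scale span_base)
qed

text \<open>Each test vector g costs at most one complex dimension: if u is not orthogonal to g,
  subtracting a multiple of u makes any x orthogonal to g. Over the reals this adds u and
  \<open>scaleC \<i> u\<close>.\<close>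

lemma finite_dim_if_finite_codim:
  assumes "finite F" and E: "csubspace E"
    and "{x \<in> E. \<forall>g\<in>F. cinner g x = 0} \<subseteq> span B" "finite B"
  shows "\<exists>B. finite B \<and> E \<subseteq> span B"
  using assms(1,3,4)
proof (induction F arbitrary: B)
  case (insert g F)
  let ?E = "{x \<in> E. \<forall>h\<in>F. cinner h x = 0}"
  show ?case
  proof (cases "\<exists>u\<in>?E. cinner g u \<noteq> 0")
    case False
    then have "?E \<subseteq> span B" using insert.prems by auto
    then show ?thesis using insert by blast
  next
    case True
    then obtain u where u: "u \<in> ?E" "cinner g u \<noteq> 0" by blast
    have "x \<in> span (B \<union> {u, scaleC \<i> u})" if x: "x \<in> ?E" for x
    proof -
      let ?y = "x - scaleC (cinner g x / cinner g u) u"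
      have "?y \<in> E" using x u by (intro csubspaceD[OF E]) auto
      then have "?y \<in> span B"
        using x u insert.prems(1) by (auto simp: cinner_diff_right cinner_scaleC_right)
      then have "?y \<in> span (B \<union> {u, scaleC \<i> u})" using span_mono by blast
      moreover have "scaleC (cinner g x / cinner g u) u \<in> span (B \<union> {u, scaleC \<i> u})"
        using scaleC_in_span span_mono[of "{u, scaleC \<i> u}" "B \<union> {u, scaleC \<i> u}"] by blast
      ultimately have "?y + scaleC (cinner g x / cinner g u) u \<in> span (B \<union> {u, scaleC \<i> u})"
        by (rule span_add)
      then show ?thesis by simp
    qed
    then have "?E \<subseteq> span (B \<union> {u, scaleC \<i> u})" by blast
    moreover have "finite (B \<union> {u, scaleC \<i> u})" using insert.prems by simp
    ultimately show ?thesis using insert.IH by blast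
  qed
qed auto

context unitary_operator
begin

text \<open>The approximate point spectrum. On a reducing subspace a unitary operator has no other
  spectrum, by \<open>resolvent_surjective\<close>.\<close>

definition approx_spectrum :: "'a set \<Rightarrow> complex set" where
  "approx_spectrum H = {z. \<forall>e>0. \<exists>x\<in>H. norm x = 1 \<and> norm (A x - scaleC z x) < e}"

definition eigenvectors :: "'a set \<Rightarrow> complex \<Rightarrow> 'a set" where
  "eigenvectors H z = {x\<in>H. A x = scaleC z x}"

text \<open>
  Weyl's criterion, with the weakly null sequences replaced by finite sets of test vectors.
\<close>

definition singular_at :: "'a set \<Rightarrow> complex \<Rightarrow> bool" where
  "singular_at H z \<longleftrightarrow> (\<forall>F e. finite F \<and> F \<subseteq> H \<and> 0 < e \<longrightarrow>
     (\<exists>x\<in>H. norm x = 1 \<and> (\<forall>g\<in>F. cmod (cinner g x) < e) \<and> norm (A x - scaleC z x) < e))"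

lemma singular_atD:
  assumes "singular_at H z" "finite F" "F \<subseteq> H" "0 < e"
  obtains x where "x \<in> H" "norm x = 1" "\<And>g. g \<in> F \<Longrightarrow> cmod (cinner g x) < e" "norm (A x - scaleC z x) < e"
proof -
  have "\<exists>x\<in>H. norm x = 1 \<and> (\<forall>g\<in>F. cmod (cinner g x) < e) \<and> norm (A x - scaleC z x) < e"
    using assms(1)[unfolded singular_at_def, rule_format, of F e] assms(2-4) by simp
  then show ?thesis using that by auto
qed

section \<open>Solving (A - z) x = y in a reducing subspace\<close>

lemma approx_spectrum_bounded_below:
  assumes H: "csubspace H" and z: "z \<notin> approx_spectrum H"
  obtains c where "c > 0" "\<And>x. x \<in> H \<Longrightarrow> c * norm x \<le> norm (A x - scaleC z x)"
proof -
  from z obtain c where c: "c > 0" "\<And>x. x \<in> H \<Longrightarrow> norm x = 1 \<Longrightarrow> c \<le> norm (A x - scaleC z x)"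
    by (force simp: approx_spectrum_def not_less)
  have "c * norm x \<le> norm (A x - scaleC z x)" if x: "x \<in> H" for x
  proof (cases "x = 0")
    case False
    let ?s = "of_real (1 / norm x) :: complex"
    have "c \<le> norm (A (scaleC ?s x) - scaleC z (scaleC ?s x))"
      using False x by (intro c csubspaceD[OF H]) (simp_all add: norm_divide)
    also have "A (scaleC ?s x) - scaleC z (scaleC ?s x) = scaleC ?s (A x - scaleC z x)"
      by (simp add: scale scaleC_diff_right mult.commute)
    finally show ?thesis using False by (simp add: norm_divide field_simps)
  qed simp
  with c(1) show ?thesis by (rule that)
qed

text \<open>Banach's fixed point theorem stands for the Neumann series: for |z| < 1 the equation
  reads x = A^{-1}(y + z x), with factor |z|; for |z| > 1 it reads x = (A x - y)/z, with factor
  1/|z|.\<close>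

lemma resolvent_surjective_off_circle:
  assumes H: "reducing H" and z: "cmod z \<noteq> 1" and y: "y \<in> H"
  shows "\<exists>x\<in>H. A x - scaleC z x = y"
proof (cases "cmod z < 1")
  case True
  have "\<exists>x\<in>H. Ai (y + scaleC z x) = x"
  proof (rule contraction_fixpoint)
    show "closed H" "H \<noteq> {}" "(\<lambda>x. Ai (y + scaleC z x)) ` H \<subseteq> H"
      using H y by (auto simp: reducing_def intro!: reducing_Ai[OF H] csubspaceD dest: csubspaceD(1))
    show "dist (Ai (y + scaleC z x)) (Ai (y + scaleC z x')) \<le> cmod z * dist x x'" for x x'
      by (simp add: dist_norm flip: unitary_operator.diff[OF unitary_Ai] scaleC_diff_right)
  qed (use True in auto)
  then obtain x where "x \<in> H" "Ai (y + scaleC z x) = x" by blast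
  moreover from this(2) have "A x = y + scaleC z x" using A_Ai by metis
  ultimately show ?thesis by (intro bexI[of _ x]) auto
next
  case False
  then have z1: "cmod z > 1" using z by simp
  then have z0: "z \<noteq> 0" by auto
  have "\<exists>x\<in>H. scaleC (1 / z) (A x - y) = x"
  proof (rule contraction_fixpoint)
    show "closed H" "H \<noteq> {}" "(\<lambda>x. scaleC (1 / z) (A x - y)) ` H \<subseteq> H"
      using H y by (auto simp: reducing_def intro!: reducing_A[OF H] csubspaceD dest: csubspaceD(1))
    show "dist (scaleC (1 / z) (A x - y)) (scaleC (1 / z) (A x' - y)) \<le> 1 / cmod z * dist x x'" for x x'
      by (simp add: dist_norm norm_divide flip: diff scaleC_diff_right)
  qed (use z1 in \<open>auto simp: divide_less_eq\<close>)
  then obtain x where x: "x \<in> H" "scaleC (1 / z) (A x - y) = x" by blast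
  then have "scaleC z x = A x - y" using z0 by (metis nonzero_mult_div_cancel_left mult.right_neutral times_divide_eq_right scaleC_one scaleC_scaleC)
  with x(1) show ?thesis by (intro bexI[of _ x]) auto
qed

text \<open>On the circle the resolvent is reached from outside by a perturbation smaller than the lower bound.\<close>

lemma resolvent_surjective:
  assumes H: "reducing H" and c: "c > 0" "\<And>x. x \<in> H \<Longrightarrow> c * norm x \<le> norm (A x - scaleC z x)"
    and y: "y \<in> H"
  shows "\<exists>x\<in>H. A x - scaleC z x = y"
proof (cases "cmod z = 1")
  case False
  then show ?thesis using resolvent_surjective_off_circle[OF H _ y] by blast
next
  case True
  have sub: "csubspace H" using H by (simp add: reducing_def)
  \<comment> \<open>At w = (1 + s) z, off the circle, the lower bound is still c - s = 2 s, so R has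
    Lipschitz constant 1/(2 s). Going back from w to z perturbs by s, whence the contraction factor
    1/2.\<close>
  define s where "s = c / 3"
  have s: "s > 0" "c - s = 2 * s" using c(1) by (auto simp: s_def)
  define w where "w = of_real (1 + s) * z"
  have w: "cmod w \<noteq> 1" using True s(1) by (simp add: w_def norm_mult del: of_real_add)
  have wz: "w - z = of_real s * z" by (simp add: w_def algebra_simps)
  have "\<forall>v\<in>H. \<exists>x\<in>H. A x - scaleC w x = v"
    using resolvent_surjective_off_circle[OF H w] by blast
  then obtain R where R: "\<And>v. v \<in> H \<Longrightarrow> R v \<in> H" "\<And>v. v \<in> H \<Longrightarrow> A (R v) - scaleC w (R v) = v" by metis
  have low: "2 * s * norm x \<le> norm (A x - scaleC w x)" if "x \<in> H" for x
  proof -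
    have "c * norm x \<le> norm (A x - scaleC z x)" by (rule c(2)[OF that])
    also have "A x - scaleC z x = (A x - scaleC w x) + scaleC (w - z) x" by (simp add: scaleC_diff_left)
    also have "norm \<dots> \<le> norm (A x - scaleC w x) + s * norm x"
      using s(1) True unfolding wz by (intro order_trans[OF norm_triangle_ineq]) (simp add: norm_mult)
    finally show ?thesis using s(2) by (simp add: algebra_simps)
  qed
  have R_lip: "2 * s * dist (R u) (R v) \<le> dist u v" if "u \<in> H" "v \<in> H" for u v
  proof -
    have "A (R u - R v) - scaleC w (R u - R v) = u - v"
      using R(2)[OF that(1)] R(2)[OF that(2)] by (simp add: diff scaleC_diff_right algebra_simps)
    then show ?thesis using low[of "R u - R v"] csubspaceD(4)[OF sub R(1)[OF that(1)] R(1)[OF that(2)]]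
      by (simp add: dist_norm)
  qed
  have "\<exists>x\<in>H. R (y - scaleC (of_real s * z) x) = x"
  proof (rule contraction_fixpoint)
    show "closed H" "H \<noteq> {}" "(\<lambda>x. R (y - scaleC (of_real s * z) x)) ` H \<subseteq> H"
      using H y by (auto simp: reducing_def intro!: R csubspaceD dest: csubspaceD(1))
    show "dist (R (y - scaleC (of_real s * z) x)) (R (y - scaleC (of_real s * z) x')) \<le> 1 / 2 * dist x x'"
      if "x \<in> H" "x' \<in> H" for x x'
    proof -
      have "2 * s * dist (R (y - scaleC (of_real s * z) x)) (R (y - scaleC (of_real s * z) x')) \<le>
        dist (y - scaleC (of_real s * z) x) (y - scaleC (of_real s * z) x')"
        using that y by (intro R_lip csubspaceD[OF sub]) auto
      also have "\<dots> = s * dist x x'"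
        using s(1) True by (simp add: dist_norm norm_minus_commute norm_mult flip: scaleC_diff_right)
      finally show ?thesis using s(1) by simp
    qed
  qed auto
  then obtain x where x: "x \<in> H" "R (y - scaleC (of_real s * z) x) = x" by blast
  have "A x - scaleC w x = y - scaleC (of_real s * z) x"
    using R(2)[of "y - scaleC (of_real s * z) x"] x y csubspaceD[OF sub] by metis
  then have "A x - scaleC w x = y - (scaleC w x - scaleC z x)"
    by (simp only: wz[symmetric] scaleC_diff_left)
  then have "A x - scaleC z x = y" by (simp add: algebra_simps)
  with x(1) show ?thesis by blast
qed

section \<open>From approximate eigenvectors to almost orthogonal ones\<close>

lemma eigenvectors_csubspace: "csubspace H \<Longrightarrow> csubspace (eigenvectors H z)"
  by (auto simp: csubspace_def eigenvectors_def add scale scaleC_add_right mult.commute)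

lemma eigenvectors_Ai:
  assumes "A k = scaleC z k"
  shows "Ai k = scaleC (cnj z) k"
proof (cases "k = 0")
  case True
  then show ?thesis using Ai_eqI[of 0 0] by simp
next
  case False
  have "cmod z * norm k = norm k" using norm_A[of k] by (simp add: assms)
  then have "z * cnj z = 1" using False by (simp add: complex_norm_square[symmetric])
  then show ?thesis by (intro Ai_eqI) (simp add: scale assms mult.commute)
qed

text \<open>The inverse of A is its adjoint, so this exhibits the adjoint of A - z.\<close>

lemma cinner_resolvent: "cinner h (A x - scaleC z x) = cinner (Ai h - scaleC (cnj z) h) x"
  using cinner_A[of "Ai h" x] by (simp add: cinner_diff_left cinner_diff_right cinner_scaleC_left cinner_scaleC_right)

text \<open>Within H, the orthogonal complement of the range of the adjoint of A - z is the kernel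
  of A - z. Projecting g onto the closure of that range leaves the eigenvector k.\<close>

lemma resolvent_range_dense:
  assumes H: "reducing H" and g: "g \<in> H" and e: "e > 0"
  obtains h k where "h \<in> H" "k \<in> eigenvectors H z" "norm (g - (Ai h - scaleC (cnj z) h) - k) < e"
proof -
  have sub: "csubspace H" and cl: "closed H" using H by (auto simp: reducing_def)
  define R where "R = (\<lambda>h. Ai h - scaleC (cnj z) h) ` H"
  have R: "csubspace R"
    unfolding csubspace_def R_def
  proof (intro conjI ballI allI)
    have "Ai 0 = 0" by (rule Ai_eqI) simp
    then show "0 \<in> (\<lambda>h. Ai h - scaleC (cnj z) h) ` H" using csubspaceD(1)[OF sub] by (intro image_eqI[of _ _ 0]) auto
  next
    fix x y assume "x \<in> (\<lambda>h. Ai h - scaleC (cnj z) h) ` H" "y \<in> (\<lambda>h. Ai h - scaleC (cnj z) h) ` H"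
    then obtain h h' where "h \<in> H" "h' \<in> H" "x = Ai h - scaleC (cnj z) h" "y = Ai h' - scaleC (cnj z) h'" by blast
    then show "x + y \<in> (\<lambda>h. Ai h - scaleC (cnj z) h) ` H"
      by (intro image_eqI[of _ _ "h + h'"]) (auto simp: Ai_add scaleC_add_right csubspaceD[OF sub])
  next
    fix c x assume "x \<in> (\<lambda>h. Ai h - scaleC (cnj z) h) ` H"
    then obtain h where "h \<in> H" "x = Ai h - scaleC (cnj z) h" by blast
    then show "scaleC c x \<in> (\<lambda>h. Ai h - scaleC (cnj z) h) ` H"
      by (intro image_eqI[of _ _ "scaleC c h"]) (auto simp: Ai_scale scaleC_diff_right mult.commute csubspaceD[OF sub])
  qed
  have cR: "csubspace (closure R)"
    unfolding csubspace_def
  proof (intro conjI ballI allI)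
    show "0 \<in> closure R" using csubspaceD(1)[OF R] closure_subset by blast
    fix x y assume "x \<in> closure R" "y \<in> closure R"
    then obtain u v where "\<And>n. u n \<in> R" "u \<longlonglongrightarrow> x" "\<And>n. v n \<in> R" "v \<longlonglongrightarrow> y"
      unfolding closure_sequential by blast
    then show "x + y \<in> closure R"
      unfolding closure_sequential by (intro exI[of _ "\<lambda>n. u n + v n"]) (auto intro!: tendsto_add csubspaceD[OF R])
  next
    fix c x assume "x \<in> closure R"
    then obtain u where "\<And>n. u n \<in> R" "u \<longlonglongrightarrow> x"
      unfolding closure_sequential by blast
    then show "scaleC c x \<in> closure R"
      unfolding closure_sequential by (intro exI[of _ "\<lambda>n. scaleC c (u n)"]) (auto intro!: tendsto_scaleC csubspaceD[OF R])
  qed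
  obtain m where m: "m \<in> closure R" "\<And>v. v \<in> closure R \<Longrightarrow> cinner v (g - m) = 0"
    using projection_exists[OF cR closed_closure] by metis
  have RH: "R \<subseteq> H" unfolding R_def by (auto intro!: csubspaceD[OF sub] reducing_Ai[OF H])
  then have "closure R \<subseteq> H" using cl by (simp add: closure_minimal)
  then have k: "g - m \<in> H" using m(1) g by (intro csubspaceD[OF sub]) auto
  \<comment> \<open>As \<open>g - m\<close> is orthogonal to the range, testing it against the range
    element that comes from r gives <r, r> = 0.\<close>
  let ?r = "A (g - m) - scaleC z (g - m)"
  have "?r \<in> H" by (intro csubspaceD[OF sub] reducing_A[OF H] k)
  then have "Ai ?r - scaleC (cnj z) ?r \<in> R" unfolding R_def by (rule imageI)
  then have "Ai ?r - scaleC (cnj z) ?r \<in> closure R" by (rule closure_subset[THEN subsetD])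
  then have "cinner ?r ?r = 0" unfolding cinner_resolvent by (rule m(2))
  then have "?r = 0" by (simp add: cinner_self)
  then have k_eig: "g - m \<in> eigenvectors H z" using k by (simp add: eigenvectors_def)
  obtain v where "v \<in> R" "dist v m < e" using m(1) e closure_approachable by blast
  then obtain h where "h \<in> H" "v = Ai h - scaleC (cnj z) h" "norm (m - v) < e"
    by (auto simp: R_def dist_norm norm_minus_commute)
  moreover have "g - v - (g - m) = m - v" by simp
  ultimately have "norm (g - (Ai h - scaleC (cnj z) h) - (g - m)) < e" by (simp only:)
  then show ?thesis by (rule that[OF \<open>h \<in> H\<close> k_eig])
qed

text \<open>Up to a small error, a test vector is the adjoint of A - z applied to some h, plus an
  eigenvector k. Against the first summand the inner product is <h, (A - z) x>, which is small for
  every approximate eigenvector; only eigenvectors remain to be tested.\<close>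

lemma singular_if_almost_orthogonal_to_eigenvectors:
  assumes H: "reducing H"
    and approx: "\<And>K e. finite K \<Longrightarrow> K \<subseteq> eigenvectors H z \<Longrightarrow> e > 0 \<Longrightarrow>
      \<exists>x\<in>H. norm x = 1 \<and> (\<forall>k\<in>K. cmod (cinner k x) < e) \<and> norm (A x - scaleC z x) < e"
  shows "singular_at H z"
  unfolding singular_at_def
proof (intro allI impI)
  fix F e assume Fe: "finite F \<and> F \<subseteq> H \<and> (0::real) < e"
  then have e3: "e / 3 > 0" by simp
  have "\<forall>g\<in>F. \<exists>h k. h \<in> H \<and> k \<in> eigenvectors H z \<and> norm (g - (Ai h - scaleC (cnj z) h) - k) < e / 3"
    using resolvent_range_dense[OF H _ e3, of _ z] Fe by (metis subsetD)
  then obtain h k where h: "\<And>g. g \<in> F \<Longrightarrow> h g \<in> H" and k: "\<And>g. g \<in> F \<Longrightarrow> k g \<in> eigenvectors H z"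
    and hk: "\<And>g. g \<in> F \<Longrightarrow> norm (g - (Ai (h g) - scaleC (cnj z) (h g)) - k g) < e / 3"
    by metis
  \<comment> \<open>B bounds the norms of all \<open>h g\<close>, and the added 1 keeps it away from
    0. With d = e/(3 B) each of the three summands below stays under e/3.\<close>
  define B where "B = 1 + (\<Sum>g\<in>F. norm (h g))"
  have B: "B \<ge> 1" "norm (h g) \<le> B" if "g \<in> F" for g
    using member_le_sum[of g F "\<lambda>g. norm (h g)"] that Fe unfolding B_def by (auto simp: sum_nonneg)
  have B1: "B \<ge> 1" by (simp add: B_def sum_nonneg)
  define d where "d = e / (3 * B)"
  have d: "d > 0" "d \<le> e / 3" "B * d = e / 3"
    using Fe B1 by (auto simp: d_def field_simps)
  obtain x where x: "x \<in> H" "norm x = 1" "\<And>g. g \<in> F \<Longrightarrow> cmod (cinner (k g) x) < d" "norm (A x - scaleC z x) < d"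
  proof -
    have "k ` F \<subseteq> eigenvectors H z" using k by auto
    from approx[OF _ this d(1)] Fe show ?thesis using that by auto
  qed
  have "cmod (cinner g x) < e" if g: "g \<in> F" for g
  proof -
    let ?m = "Ai (h g) - scaleC (cnj z) (h g)"
    have "cinner g x = cinner (g - ?m - k g) x + cinner ?m x + cinner (k g) x"
      by (simp add: cinner_diff_left)
    also have "cmod \<dots> \<le> cmod (cinner (g - ?m - k g) x) + cmod (cinner ?m x) + cmod (cinner (k g) x)"
      by (intro order_trans[OF norm_triangle_ineq] add_mono norm_triangle_ineq order_refl)
    also have "\<dots> < e / 3 + e / 3 + e / 3"
    proof (intro add_strict_mono)
      show "cmod (cinner (g - ?m - k g) x) < e / 3"
        using norm_cinner_le[of "g - ?m - k g" x] hk[OF g] x(2) by simp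
      have "cmod (cinner ?m x) \<le> norm (h g) * norm (A x - scaleC z x)"
        using norm_cinner_le[of "h g" "A x - scaleC z x"] by (simp add: cinner_resolvent)
      also have "\<dots> \<le> B * norm (A x - scaleC z x)" by (intro mult_right_mono B[OF g]) simp
      also have "\<dots> < B * d" using x(4) B1 by (intro mult_strict_left_mono) auto
      finally show "cmod (cinner ?m x) < e / 3" using d(3) by simp
      show "cmod (cinner (k g) x) < e / 3" using x(3)[OF g] d(2) by simp
    qed
    finally show ?thesis by simp
  qed
  moreover have "norm (A x - scaleC z x) < e" using x(4) d(2) Fe by simp
  ultimately show "\<exists>x\<in>H. norm x = 1 \<and> (\<forall>g\<in>F. cmod (cinner g x) < e) \<and> norm (A x - scaleC z x) < e"
    using x(1,2) by blast
qed

text \<open>By \<open>finite_dim_if_finite_codim\<close> an infinite dimensional eigenspace contains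
  a nonzero vector orthogonal to all of F.\<close>

lemma singular_if_infinite_dim:
  assumes H: "reducing H" and inf: "\<not> (\<exists>B. finite B \<and> eigenvectors H z \<subseteq> span B)"
  shows "singular_at H z"
  unfolding singular_at_def
proof (intro allI impI)
  fix F e assume Fe: "finite F \<and> F \<subseteq> H \<and> (0::real) < e"
  have sub: "csubspace (eigenvectors H z)" using H by (simp add: reducing_def eigenvectors_csubspace)
  have "\<not> {x \<in> eigenvectors H z. \<forall>g\<in>F. cinner g x = 0} \<subseteq> span {}"
    using finite_dim_if_finite_codim[of F _ "{}"] Fe sub inf by blast
  then obtain u where u: "u \<in> eigenvectors H z" "\<And>g. g \<in> F \<Longrightarrow> cinner g u = 0" "u \<noteq> 0" by auto
  let ?x = "scaleC (of_real (1 / norm u)) u"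
  have "?x \<in> eigenvectors H z" by (intro csubspaceD[OF sub] u)
  then show "\<exists>x\<in>H. norm x = 1 \<and> (\<forall>g\<in>F. cmod (cinner g x) < e) \<and> norm (A x - scaleC z x) < e"
    using u Fe by (intro bexI[of _ ?x]) (auto simp: eigenvectors_def cinner_scaleC_right norm_divide)
qed

lemma singular_if_no_eigenvector:
  assumes H: "reducing H" and z: "z \<in> approx_spectrum H" and none: "eigenvectors H z = {0}"
  shows "singular_at H z"
proof (rule singular_if_almost_orthogonal_to_eigenvectors[OF H])
  fix K and e :: real assume K: "finite K" "K \<subseteq> eigenvectors H z" "e > 0"
  obtain x where "x \<in> H" "norm x = 1" "norm (A x - scaleC z x) < e"
    using z K(3) by (auto simp: approx_spectrum_def)
  moreover have "cinner k x = 0" if "k \<in> K" for k using that K(2) none by auto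
  ultimately show "\<exists>x\<in>H. norm x = 1 \<and> (\<forall>k\<in>K. cmod (cinner k x) < e) \<and> norm (A x - scaleC z x) < e"
    using K(3) by auto
qed

text \<open>Approximate eigenvectors for a nearby w \<noteq> z serve: for an eigenvector k at z, the
  product (z - w) <k, x> = <k, (A - w) x> is small.\<close>

lemma singular_if_limit_point:
  assumes H: "reducing H" and lim: "\<And>r. r > 0 \<Longrightarrow> \<exists>w\<in>approx_spectrum H. w \<noteq> z \<and> cmod (w - z) < r"
  shows "singular_at H z"
proof (rule singular_if_almost_orthogonal_to_eigenvectors[OF H])
  fix K and e :: real assume K: "finite K" "K \<subseteq> eigenvectors H z" "e > 0"
  obtain w where w: "w \<in> approx_spectrum H" "w \<noteq> z" "cmod (w - z) < e / 2"
    using lim[of "e / 2"] K(3) by auto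
  define B where "B = 1 + (\<Sum>k\<in>K. norm k)"
  have B1: "B \<ge> 1" by (simp add: B_def sum_nonneg)
  have B: "norm k \<le> B" if "k \<in> K" for k
    using member_le_sum[of k K norm] that K(1) unfolding B_def by auto
  \<comment> \<open>The second entry makes up for the division by |z - w| and for the norms of the
    k.\<close>
  define d where "d = min (e / 2) (e * cmod (z - w) / B)"
  have d: "d > 0" using K(3) w(2) B1 by (auto simp: d_def)
  obtain x where x: "x \<in> H" "norm x = 1" "norm (A x - scaleC w x) < d"
    using w(1) d by (auto simp: approx_spectrum_def)
  have "cmod (cinner k x) < e" if k: "k \<in> K" for k
  proof -
    have "Ai k = scaleC (cnj z) k" using k K(2) by (intro eigenvectors_Ai) (auto simp: eigenvectors_def)
    then have "cinner k (A x - scaleC w x) = (z - w) * cinner k x"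
      unfolding cinner_resolvent by (simp add: cinner_diff_left cinner_scaleC_left algebra_simps)
    then have "cmod (z - w) * cmod (cinner k x) \<le> norm k * norm (A x - scaleC w x)"
      using norm_cinner_le[of k "A x - scaleC w x"] by (simp add: norm_mult)
    also have "\<dots> \<le> B * norm (A x - scaleC w x)" by (intro mult_right_mono B k) simp
    also have "\<dots> < B * d" using x(3) B1 by (intro mult_strict_left_mono) auto
    also have "\<dots> \<le> cmod (z - w) * e"
      using B1 mult_left_mono[of d "e * cmod (z - w) / B" B] by (simp add: d_def mult.commute)
    finally show ?thesis using w(2) by simp
  qed
  moreover have "norm (A x - scaleC z x) < e"
  proof -
    have "norm (A x - scaleC w x + scaleC (w - z) x) \<le> norm (A x - scaleC w x) + cmod (w - z)"
      using x(2) norm_triangle_ineq[of "A x - scaleC w x" "scaleC (w - z) x"] by simp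
    then have "norm (A x - scaleC z x) \<le> norm (A x - scaleC w x) + cmod (w - z)"
      by (simp add: scaleC_diff_left)
    then show ?thesis using x(3) w(3) by (simp add: d_def)
  qed
  ultimately show "\<exists>x\<in>H. norm x = 1 \<and> (\<forall>k\<in>K. cmod (cinner k x) < e) \<and> norm (A x - scaleC z x) < e"
    using x(1,2) by blast
qed

text \<open>The cut-off vector is a limit of vectors p(A)x, so it stays in H and inherits every
  orthogonality that holds for all p(A)x.\<close>

lemma spectral_cutoff_reducing:
  assumes H: "reducing H" "x \<in> H" and \<mu>: "spectral_meas x \<mu>" and L: "closed L"
  obtains \<eta> where "\<eta> \<in> H"
    "\<And>q. (norm (tp_op q \<eta>))\<^sup>2 = (\<integral>t. (cmod (tp_eval q (cis t)))\<^sup>2 * indicator L (cis t) \<partial>\<mu>)"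
    "\<forall>k. (\<forall>p. cinner k (tp_op p x) = 0) \<longrightarrow> cinner k \<eta> = 0"
proof -
  obtain \<eta> P where P: "(\<lambda>n::nat. tp_op (P n) x) \<longlonglongrightarrow> \<eta>"
    and \<eta>: "\<And>q. (norm (tp_op q \<eta>))\<^sup>2 = (\<integral>t. (cmod (tp_eval q (cis t)))\<^sup>2 * indicator L (cis t) \<partial>\<mu>)"
    and "(norm (x - \<eta>))\<^sup>2 = (\<integral>t. indicator (- L) (cis t) \<partial>\<mu>)"
    by (rule spectral_cutoff[OF \<mu> L]) (rule that)
  have 1: "\<eta> \<in> H"
    using H P by (intro closed_sequentially[of H "\<lambda>n. tp_op (P n) x" \<eta>]) (auto simp: reducing_tp_op reducing_def)
  have "\<forall>k. (\<forall>p. cinner k (tp_op p x) = 0) \<longrightarrow> cinner k \<eta> = 0"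
  proof (intro allI impI)
    fix k assume "\<forall>p. cinner k (tp_op p x) = 0"
    then show "cinner k \<eta> = 0"
      using tendsto_cinner[OF tendsto_const P, of k] by (simp add: LIMSEQ_const_iff)
  qed
  with 1 \<eta> show ?thesis by (rule that)
qed

lemma spectral_meas_integrable_cutoff:
  assumes \<mu>: "spectral_meas x \<mu>" and L: "closed L"
  shows "integrable \<mu> (\<lambda>t. (cmod (tp_eval q (cis t)))\<^sup>2 * indicator L (cis t))"
proof -
  note [measurable_cong] = spectral_sets[OF \<mu>]
  note [measurable] = borel_closed[OF L]
  obtain B where B: "\<And>t. cmod (tp_eval q (cis t)) \<le> B" using tp_eval_cis_bounded by blast
  have "(cmod (tp_eval q (cis t)))\<^sup>2 \<le> B\<^sup>2" for t by (intro power_mono B) auto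
  then show ?thesis
    by (intro finite_measure.integrable_const_bound[OF spectral_finite[OF \<mu>], where B = "B\<^sup>2"])
       (auto simp: indicator_def intro!: AE_I2)
qed

text \<open>After x is cut off to the closed ball of radius c/2 about w, A - w shrinks the resulting
  vector at least by the factor c/2, against the lower bound c. Comparing squares, the mass I of the
  ball satisfies c^2 I \<le> c^2 I/4.\<close>

lemma spectral_meas_null_ball:
  assumes H: "reducing H" "x \<in> H" and \<mu>: "spectral_meas x \<mu>" and w: "w \<notin> approx_spectrum H"
  obtains r where "r > 0" "AE t in \<mu>. cis t \<notin> ball w r"
proof -
  obtain c where c: "c > 0" "\<And>x. x \<in> H \<Longrightarrow> c * norm x \<le> norm (A x - scaleC w x)"
    using approx_spectrum_bounded_below w H(1) by (auto simp: reducing_def)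
  define L where "L = cball w (c / 2)"
  have L: "closed L" by (simp add: L_def)
  obtain \<eta> where \<eta>: "\<eta> \<in> H"
    "\<And>q. (norm (tp_op q \<eta>))\<^sup>2 = (\<integral>t. (cmod (tp_eval q (cis t)))\<^sup>2 * indicator L (cis t) \<partial>\<mu>)"
    by (rule spectral_cutoff_reducing[OF H \<mu> L]) (rule that)
  define I :: real where "I = (\<integral>t. indicator L (cis t) \<partial>\<mu>)"
  have n1: "(norm \<eta>)\<^sup>2 = I" using \<eta>(2)[of "[(0, 1)]"] by (simp add: I_def)
  have n2: "(norm (A \<eta> - scaleC w \<eta>))\<^sup>2 = (\<integral>t. (cmod (cis t - w))\<^sup>2 * indicator L (cis t) \<partial>\<mu>)"
    using \<eta>(2)[of "[(1, 1), (0, - w)]"] by (simp add: scaleC_minus_left)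
  have int: "integrable \<mu> (\<lambda>t. indicator L (cis t) :: real)"
    using spectral_meas_integrable_cutoff[OF \<mu> L, of "[(0, 1)]"] by simp
  have "(c * norm \<eta>)\<^sup>2 \<le> (norm (A \<eta> - scaleC w \<eta>))\<^sup>2"
    using c \<eta>(1) by (intro power_mono) auto
  also have "\<dots> \<le> (\<integral>t. (c / 2)\<^sup>2 * indicator L (cis t) \<partial>\<mu>)"
    unfolding n2
  proof (rule integral_mono)
    show "integrable \<mu> (\<lambda>t. (cmod (cis t - w))\<^sup>2 * indicator L (cis t))"
      using spectral_meas_integrable_cutoff[OF \<mu> L, of "[(1, 1), (0, - w)]"] by simp
    show "(cmod (cis t - w))\<^sup>2 * indicator L (cis t) \<le> (c / 2)\<^sup>2 * indicator L (cis t)" for t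
      by (auto simp: L_def indicator_def dist_norm norm_minus_commute intro!: power_mono)
  qed (use int in auto)
  also have "\<dots> = (c / 2)\<^sup>2 * I" by (simp add: I_def)
  finally have "c\<^sup>2 * I \<le> c\<^sup>2 * I / 4" by (simp add: power_mult_distrib n1 power_divide)
  moreover have "0 \<le> I" using n1 by (metis zero_le_power2)
  ultimately have "I = 0" using c(1) by (simp add: mult_le_cancel_left_pos)
  then have "AE t in \<mu>. indicator L (cis t) = (0::real)"
    using integral_nonneg_eq_0_iff_AE[OF int] by (simp add: I_def)
  then have "AE t in \<mu>. cis t \<notin> ball w (c / 2)"
    by eventually_elim (auto simp: L_def indicator_def split: if_splits)
  with c(1) show ?thesis by (intro that[of "c / 2"]) auto
qed

text \<open>
  The spectral measure of a vector orthogonal to the eigenvectors gives no mass to the isolated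
  point \<open>z\<close> nor to its punctured neighbourhood.
\<close>

lemma isolated_bounded_below:
  assumes H: "reducing H" and r: "r > 0" "\<And>w. w \<in> approx_spectrum H \<Longrightarrow> w \<noteq> z \<Longrightarrow> r \<le> cmod (w - z)"
    and x: "x \<in> H" "\<And>k. k \<in> eigenvectors H z \<Longrightarrow> cinner k x = 0"
  shows "r * norm x \<le> norm (A x - scaleC z x)"
proof -
  have sub: "csubspace H" using H by (simp add: reducing_def)
  obtain \<mu> where \<mu>: "spectral_meas x \<mu>" using spectral_meas_exists by blast
  interpret finite_measure \<mu> by (rule spectral_finite[OF \<mu>])
  have "closed {z}" by simp
  obtain \<eta> where \<eta>: "\<eta> \<in> H"
    "\<And>q. (norm (tp_op q \<eta>))\<^sup>2 = (\<integral>t. (cmod (tp_eval q (cis t)))\<^sup>2 * indicator {z} (cis t) \<partial>\<mu>)"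
    "\<forall>k. (\<forall>p. cinner k (tp_op p x) = 0) \<longrightarrow> cinner k \<eta> = 0"
    by (rule spectral_cutoff_reducing[OF H x(1) \<mu> \<open>closed {z}\<close>]) (rule that)
  \<comment> \<open>The symbol of A - z vanishes at the one point that the cut-off retains, so
    \<eta> is an eigenvector.\<close>
  have "(norm (A \<eta> - scaleC z \<eta>))\<^sup>2 = (\<integral>t. (cmod (cis t - z))\<^sup>2 * indicator {z} (cis t) \<partial>\<mu>)"
    using \<eta>(2)[of "[(1, 1), (0, - z)]"] by (simp add: scaleC_minus_left)
  also have "\<dots> = (\<integral>t. 0 \<partial>\<mu>)" by (rule Bochner_Integration.integral_cong) (auto simp: indicator_def)
  finally have eig: "\<eta> \<in> eigenvectors H z" using \<eta>(1) by (simp add: eigenvectors_def)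
  \<comment> \<open>The eigenspace is invariant under all p(A), so with x all p(A)x are orthogonal
    to \<eta>. Being a limit of such vectors, \<eta> is orthogonal to itself.\<close>
  have "cinner \<eta> (tp_op p x) = 0" for p
  proof -
    have "A (tp_op q \<eta>) = scaleC z (tp_op q \<eta>)" for q
      using ipow_tp_op[of 1 q \<eta>] eig by (simp add: eigenvectors_def tp_op_scale)
    then have "tp_op q \<eta> \<in> eigenvectors H z" for q
      using \<eta>(1) by (simp add: eigenvectors_def reducing_tp_op[OF H])
    from x(2)[OF this, of "tp_cnj p"] have "cinner x (tp_op (tp_cnj p) \<eta>) = 0"
      by (metis cinner_commute complex_cnj_zero)
    then have "cinner (tp_op p x) \<eta> = 0" by (simp add: cinner_tp_op_left)
    then show ?thesis by (metis cinner_commute complex_cnj_zero)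
  qed
  then have "cinner \<eta> \<eta> = 0" using \<eta>(3) by simp
  then have "\<eta> = 0" by (simp add: cinner_self)
  then have 0: "(\<integral>t. indicator {z} (cis t) \<partial>\<mu>) = (0::real)" using \<eta>(2)[of "[(0, 1)]"] by simp
  have "integrable \<mu> (\<lambda>t. indicator {z} (cis t) :: real)"
    using spectral_meas_integrable_cutoff[OF \<mu> \<open>closed {z}\<close>, of "[(0, 1)]"] by simp
  from integral_nonneg_eq_0_iff_AE[OF this] 0
  have AE1: "AE t in \<mu>. cis t \<noteq> z"
    by (auto simp: indicator_def elim!: eventually_mono split: if_splits)
  have "\<forall>w\<in>ball z r - {z}. \<exists>\<rho>>0. AE t in \<mu>. cis t \<notin> ball w \<rho>"
  proof
    fix w assume "w \<in> ball z r - {z}"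
    then have "w \<notin> approx_spectrum H" using r(2)[of w] by (auto simp: dist_norm norm_minus_commute)
    then show "\<exists>\<rho>>0. AE t in \<mu>. cis t \<notin> ball w \<rho>"
      using spectral_meas_null_ball[OF H x(1) \<mu>] by metis
  qed
  then obtain \<rho> where \<rho>: "\<And>w. w \<in> ball z r - {z} \<Longrightarrow> \<rho> w > 0"
    "\<And>w. w \<in> ball z r - {z} \<Longrightarrow> AE t in \<mu>. cis t \<notin> ball w (\<rho> w)" by metis
  let ?F = "(\<lambda>w. ball w (\<rho> w)) ` (ball z r - {z})"
  \<comment> \<open>By Lindelof countably many of the null balls have the same union, which contains
    the punctured ball and is therefore null.\<close>
  obtain F' where F': "F' \<subseteq> ?F" "countable F'" "\<Union>F' = \<Union>?F"
    using Lindelof[of ?F] by auto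
  have "AE t in \<mu>. \<forall>S\<in>F'. cis t \<notin> S"
  proof (subst AE_ball_countable[OF F'(2)], intro ballI)
    fix S assume "S \<in> F'"
    then obtain w where "w \<in> ball z r - {z}" "S = ball w (\<rho> w)" using F'(1) by blast
    then show "AE t in \<mu>. cis t \<notin> S" using \<rho>(2) by blast
  qed
  then have AE2: "AE t in \<mu>. cis t \<notin> ball z r"
    using AE1
  proof eventually_elim
    case (elim t)
    show ?case
    proof
      assume "cis t \<in> ball z r"
      then have "cis t \<in> \<Union>?F" using elim(2) \<rho>(1) by (intro UN_I[of "cis t"]) auto
      then show False using F'(3) elim(1) by blast
    qed
  qed
  have "(r * norm x)\<^sup>2 = (\<integral>t. r\<^sup>2 \<partial>\<mu>)"
  proof -
    have "(norm x)\<^sup>2 = measure \<mu> (space \<mu>)" using norm_tp_op[OF \<mu>, of "[(0, 1)]"] by simp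
    then show ?thesis by (simp add: power_mult_distrib)
  qed
  also have "\<dots> \<le> (\<integral>t. (cmod (cis t - z))\<^sup>2 \<partial>\<mu>)"
  proof (rule integral_mono_AE)
    show "integrable \<mu> (\<lambda>t. (cmod (cis t - z))\<^sup>2)"
      using spectral_meas_integrable_cutoff[OF \<mu> closed_UNIV, of "[(1, 1), (0, - z)]"] by simp
    show "AE t in \<mu>. r\<^sup>2 \<le> (cmod (cis t - z))\<^sup>2"
      using AE2 by eventually_elim (use r(1) in \<open>auto simp: dist_norm norm_minus_commute not_less intro!: power_mono\<close>)
  qed auto
  also have "\<dots> = (norm (A x - scaleC z x))\<^sup>2"
    using norm_tp_op[OF \<mu>, of "[(1, 1), (0, - z)]"] by (simp add: scaleC_minus_left)
  finally show ?thesis by (rule power2_le_imp_le) simp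
qed

text \<open>An approximate eigenvector x splits into its projection p onto the finite dimensional
  eigenspace and a rest y. Testing x against an orthogonal basis makes p small; by
  \<open>isolated_bounded_below\<close> (A - z) y is then large, although (A - z) x is
  small.\<close>

lemma not_singular_if_discrete:
  assumes H: "reducing H" and r: "r > 0" "\<And>w. w \<in> approx_spectrum H \<Longrightarrow> w \<noteq> z \<Longrightarrow> r \<le> cmod (w - z)"
    and B: "finite B" "eigenvectors H z \<subseteq> span B"
  shows "\<not> singular_at H z"
proof
  assume sing: "singular_at H z"
  let ?E = "eigenvectors H z"
  have subH: "csubspace H" using H by (simp add: reducing_def)
  have sub: "csubspace ?E" by (rule eigenvectors_csubspace[OF subH])
  obtain B1 where B1: "B1 \<subseteq> ?E" "independent B1" "?E \<subseteq> span B1"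
    using maximal_independent_subset by metis
  then have "finite B1" using independent_span_bound[OF B(1) B1(2)] B(2) by blast
  then obtain C where C: "finite C" "span C = span B1" "pairwise orthogonal C"
    using basis_orthogonal by blast
  \<comment> \<open>The orthogonal set C is taken in the real structure and spans the eigenspace
    over the reals. Complex orthogonality of y returns at the end, because the eigenspace contains
    \<open>scaleC \<i> k\<close> along with k.\<close>
  have "subspace ?E"
    unfolding subspace_def using csubspaceD[OF sub] by (auto simp flip: scaleC_of_real)
  then have "span B1 \<subseteq> ?E" using B1(1) by (simp add: span_minimal)
  then have CE: "C \<subseteq> ?E" using C(2) span_superset by blast
  define K where "K = (\<Sum>c\<in>C. 1 / norm c)"
  have K0: "K \<ge> 0" by (simp add: K_def sum_nonneg)
  \<comment> \<open>Chosen so that the final inequality reads r \<le> r/2.\<close>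
  define e where "e = r / (2 * (r * K + 1 + (1 + cmod z) * K))"
  have den: "r * K + 1 + (1 + cmod z) * K > 0"
    using r(1) K0 by (simp add: add_pos_nonneg add_nonneg_pos)
  have e: "e > 0" using r(1) den by (simp add: e_def)
  have "C \<subseteq> H" using CE by (auto simp: eigenvectors_def)
  then obtain x where x: "x \<in> H" "norm x = 1" "\<And>g. g \<in> C \<Longrightarrow> cmod (cinner g x) < e" "norm (A x - scaleC z x) < e"
    using singular_atD[OF sing C(1) _ e] by auto
  define p where "p = (\<Sum>c\<in>C. (inner c x / inner c c) *\<^sub>R c)"
  define y where "y = x - p"
  have p: "p \<in> ?E" unfolding p_def scaleC_of_real[symmetric]
    by (intro csubspace_sum[OF sub] csubspaceD[OF sub]) (use CE in auto)
  then have "p \<in> H" by (simp add: eigenvectors_def)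
  then have yH: "y \<in> H" unfolding y_def by (intro csubspaceD[OF subH] x(1))
  have norm_p: "norm p \<le> e * K"
  proof -
    have "norm p \<le> (\<Sum>c\<in>C. norm ((inner c x / inner c c) *\<^sub>R c))" unfolding p_def by (rule norm_sum)
    also have "\<dots> \<le> (\<Sum>c\<in>C. e * (1 / norm c))"
    proof (rule sum_mono)
      fix c assume c: "c \<in> C"
      have "norm ((inner c x / inner c c) *\<^sub>R c) = \<bar>inner c x\<bar> / norm c"
        by (cases "c = 0") (auto simp: power2_norm_eq_inner[symmetric] power2_eq_square)
      also have "\<dots> \<le> e / norm c"
        using x(3)[OF c] abs_inner_le_cinner[of c x] by (intro divide_right_mono) auto
      finally show "norm ((inner c x / inner c c) *\<^sub>R c) \<le> e * (1 / norm c)" by simp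
    qed
    finally show ?thesis by (simp add: K_def sum_distrib_left)
  qed
  have "inner c y = 0" if c: "c \<in> C" for c
  proof -
    have "inner c p = (\<Sum>d\<in>C. (inner d x / inner d d) * inner c d)"
      by (simp add: p_def inner_sum_right)
    also have "\<dots> = (\<Sum>d\<in>C. if d = c then inner c x else 0)"
    proof (intro sum.cong refl)
      fix d assume "d \<in> C"
      then show "(inner d x / inner d d) * inner c d = (if d = c then inner c x else 0)"
        using C(3) c by (cases "c = 0") (auto simp: pairwise_def orthogonal_def)
    qed
    also have "\<dots> = inner c x" using c C(1) by simp
    finally show ?thesis by (simp add: y_def inner_diff)
  qed
  then have "C \<subseteq> {v. inner v y = 0}" by auto
  moreover have "subspace {v. inner v y = 0}" by (auto simp: subspace_def inner_add)
  ultimately have "span C \<subseteq> {v. inner v y = 0}" by (simp add: span_minimal)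
  then have orth: "inner k y = 0" if "k \<in> ?E" for k using that B1(3) C(2) by auto
  have "cinner k y = 0" if "k \<in> ?E" for k
    using orth[OF that] orth[OF csubspaceD(3)[OF sub that, of \<i>]] by (simp add: cinner_def complex_eq_iff)
  then have "r * norm y \<le> norm (A y - scaleC z y)"
    by (intro isolated_bounded_below[OF H r yH]) auto
  also have "A y - scaleC z y = (A x - scaleC z x) - (A p - scaleC z p)"
    by (simp add: y_def diff scaleC_diff_right)
  also have "norm \<dots> \<le> norm (A x - scaleC z x) + (norm (A p) + norm (scaleC z p))"
    by (intro order_trans[OF norm_triangle_ineq4] add_left_mono norm_triangle_ineq4)
  also have "\<dots> \<le> e + (1 + cmod z) * (e * K)"
    using x(4) norm_p by (intro add_mono) (auto simp: distrib_right intro!: add_mono mult_left_mono)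
  finally have "r * norm y \<le> e + (1 + cmod z) * (e * K)" .
  moreover have "1 - e * K \<le> norm y"
    using norm_triangle_ineq2[of x p] norm_p x(2) by (simp add: y_def)
  ultimately have "r * (1 - e * K) \<le> e + (1 + cmod z) * (e * K)"
    using r(1) mult_left_mono[of "1 - e * K" "norm y" r] by linarith
  then have "r \<le> e * (r * K + 1 + (1 + cmod z) * K)" by (simp add: algebra_simps)
  also have "\<dots> = r / 2"
  proof -
    have "r / (2 * D) * D = r / 2" if "D > 0" for D :: real using that by simp
    from this[OF den] show ?thesis unfolding e_def .
  qed
  finally show False using r(1) by simp
qed

text \<open>The right-hand side is the spectrum without its discrete part. A spectral point that is
  not discrete is a limit point, has no eigenvector or has infinite multiplicity, and each case
  supplies singular vectors in its own way.\<close>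

theorem singular_at_iff:
  assumes H: "reducing H"
  shows "singular_at H z \<longleftrightarrow> z \<in> approx_spectrum H \<and>
     \<not> (z isolated_in approx_spectrum H \<and> eigenvectors H z \<noteq> {0} \<and>
        (\<exists>B. finite B \<and> eigenvectors H z \<subseteq> span B))" (is "_ \<longleftrightarrow> _ \<and> \<not> (?iso \<and> ?ne \<and> ?fin)")
proof
  assume sing: "singular_at H z"
  have "\<exists>x\<in>H. norm x = 1 \<and> norm (A x - scaleC z x) < e" if "e > 0" for e
    using singular_atD[OF sing finite.emptyI empty_subsetI that] by auto
  then have "z \<in> approx_spectrum H" by (simp add: approx_spectrum_def)
  moreover have False if iso: ?iso and fin: ?fin
  proof -
    obtain r where "r > 0" "\<And>w. w \<in> approx_spectrum H \<Longrightarrow> w \<noteq> z \<Longrightarrow> r \<le> cmod (w - z)"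
    proof -
      from iso obtain T where "open T" "T \<inter> approx_spectrum H = {z}" unfolding isolated_in_def by blast
      then obtain r :: real where "r > 0" "ball z r \<subseteq> T" by (metis Int_iff insertI1 open_contains_ball)
      have "r \<le> cmod (w - z)" if "w \<in> approx_spectrum H" "w \<noteq> z" for w
      proof (rule ccontr)
        assume "\<not> r \<le> cmod (w - z)"
        then have "w \<in> ball z r" by (simp add: dist_norm norm_minus_commute)
        then have "w \<in> {z}" using that(1) \<open>ball z r \<subseteq> T\<close> \<open>T \<inter> approx_spectrum H = {z}\<close> by blast
        then show False using that(2) by simp
      qed
      then show ?thesis by (rule that[OF \<open>r > 0\<close>])
    qed
    then show False using not_singular_if_discrete[OF H] fin sing by metis
  qed
  ultimately show "z \<in> approx_spectrum H \<and> \<not> (?iso \<and> ?ne \<and> ?fin)" by blast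
next
  assume *: "z \<in> approx_spectrum H \<and> \<not> (?iso \<and> ?ne \<and> ?fin)"
  then have zs: "z \<in> approx_spectrum H" by (rule conjunct1)
  from * consider "\<not> ?iso" | "\<not> ?ne" | "\<not> ?fin" by satx
  then show "singular_at H z"
  proof cases
    case 1
    show ?thesis
    proof (rule singular_if_limit_point[OF H], rule ccontr)
      fix r :: real assume r: "r > 0" "\<not> (\<exists>w\<in>approx_spectrum H. w \<noteq> z \<and> cmod (w - z) < r)"
      then have "ball z r \<inter> approx_spectrum H = {z}"
        using zs by (auto simp: dist_norm norm_minus_commute)
      moreover have "open (ball z r)" by simp
      ultimately have "z isolated_in approx_spectrum H" using zs unfolding isolated_in_def by (metis (no_types))
      with 1 show False by (rule notE)
    qed
  next
    case 2
    then have "eigenvectors H z = {0}" by (rule notnotD)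
    then show ?thesis by (rule singular_if_no_eigenvector[OF H zs])
  next
    case 3
    then show ?thesis by (rule singular_if_infinite_dim[OF H])
  qed
qed

end

text \<open>The assumption \<open>compact\<close> says that \<open>U - V\<close> maps weakly null bounded nets to null nets.\<close>

lemma (in unitary_pair) singular_at_compact_perturbation:
  assumes sing: "V.singular_at UNIV z"
    and compact: "\<And>e. e > 0 \<Longrightarrow> \<exists>F d. finite F \<and> d > 0 \<and>
       (\<forall>x. norm x = 1 \<and> (\<forall>g\<in>F. cmod (cinner g x) < d) \<longrightarrow> norm (U x - V x) < e)"
  shows "U.singular_at UNIV z"
  unfolding U.singular_at_def
proof (intro allI impI)
  fix F :: "'a set" and e :: real
  assume Fe: "finite F \<and> F \<subseteq> UNIV \<and> 0 < e"
  then obtain F' d where F': "finite F'" "d > 0"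
    and *: "\<And>x. norm x = 1 \<Longrightarrow> (\<And>g. g \<in> F' \<Longrightarrow> cmod (cinner g x) < d) \<Longrightarrow> norm (U x - V x) < e / 2"
    using compact[of "e / 2"] by (metis half_gt_zero)
  let ?e = "min d (e / 2)"
  obtain x where x: "norm x = 1" "\<And>g. g \<in> F \<union> F' \<Longrightarrow> cmod (cinner g x) < ?e" "norm (V x - scaleC z x) < ?e"
    using V.singular_atD[OF sing, of "F \<union> F'" ?e] Fe F' by auto
  have "norm (U x - V x) < e / 2" using x(2) by (intro * x(1)) auto
  moreover have "norm (U x - scaleC z x) \<le> norm (U x - V x) + norm (V x - scaleC z x)"
    using norm_triangle_ineq[of "U x - V x" "V x - scaleC z x"] by simp
  ultimately have "norm (U x - scaleC z x) < e" using x(3) by simp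
  moreover have "cmod (cinner g x) < e" if "g \<in> F" for g using x(2)[of g] that Fe by auto
  ultimately show "\<exists>x\<in>UNIV. norm x = 1 \<and> (\<forall>g\<in>F. cmod (cinner g x) < e) \<and> norm (U x - scaleC z x) < e"
    using x(1) by blast
qed

section \<open>Transfer to \<open>\<ell>\<^sup>2(I)\<close>\<close>

text \<open>A type over the full index type, so that the Hilbert space class applies; the space on I
  becomes the closed subspace \<open>supported_on I\<close>.\<close>

typedef 'i l2 = "{f :: 'i \<Rightarrow> complex. (\<lambda>i. (cmod (f i))\<^sup>2) summable_on UNIV}"
  morphisms l2_fun l2_of
  by (rule exI[of _ "\<lambda>_. 0"]) simp

setup_lifting type_definition_l2

lemma square_summable_add:
  fixes f g :: "'i \<Rightarrow> complex"
  assumes "(\<lambda>i. (cmod (f i))\<^sup>2) summable_on S" "(\<lambda>i. (cmod (g i))\<^sup>2) summable_on S"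
  shows "(\<lambda>i. (cmod (f i + g i))\<^sup>2) summable_on S"
proof (rule summable_on_comparison_test)
  show "(\<lambda>i. 2 * (cmod (f i))\<^sup>2 + 2 * (cmod (g i))\<^sup>2) summable_on S"
    by (intro summable_on_add summable_on_cmult_right assms)
  show "(cmod (f i + g i))\<^sup>2 \<le> 2 * (cmod (f i))\<^sup>2 + 2 * (cmod (g i))\<^sup>2" for i
  proof -
    have "(cmod (f i + g i))\<^sup>2 \<le> (cmod (f i) + cmod (g i))\<^sup>2" by (intro power_mono norm_triangle_ineq) simp
    also have "\<dots> \<le> 2 * (cmod (f i))\<^sup>2 + 2 * (cmod (g i))\<^sup>2"
      using sum_squares_bound[of "cmod (f i)" "cmod (g i)"] by (simp add: power2_sum)
    finally show ?thesis .
  qed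
qed simp

lemma square_summable_scale:
  fixes f :: "'i \<Rightarrow> complex"
  assumes "(\<lambda>i. (cmod (f i))\<^sup>2) summable_on S"
  shows "(\<lambda>i. (cmod (c * f i))\<^sup>2) summable_on S"
  unfolding norm_mult power_mult_distrib by (intro summable_on_cmult_right assms)

lemma square_summable_inner:
  fixes f g :: "'i \<Rightarrow> complex"
  assumes "(\<lambda>i. (cmod (f i))\<^sup>2) summable_on S" "(\<lambda>i. (cmod (g i))\<^sup>2) summable_on S"
  shows "(\<lambda>i. cmod (cnj (f i) * g i)) summable_on S"
proof (rule summable_on_comparison_test)
  show "(\<lambda>i. (cmod (f i))\<^sup>2 + (cmod (g i))\<^sup>2) summable_on S"
    by (intro summable_on_add assms)
  show "cmod (cnj (f i) * g i) \<le> (cmod (f i))\<^sup>2 + (cmod (g i))\<^sup>2" for i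
  proof -
    have "0 \<le> cmod (f i) * cmod (g i)" by simp
    then have "cmod (f i) * cmod (g i) \<le> (cmod (f i))\<^sup>2 + (cmod (g i))\<^sup>2"
      using sum_squares_bound[of "cmod (f i)" "cmod (g i)"] by linarith
    then show ?thesis by (simp add: norm_mult)
  qed
qed simp

instantiation l2 :: (type) real_vector
begin

lift_definition zero_l2 :: "'a l2" is "\<lambda>_. 0" by simp
lift_definition plus_l2 :: "'a l2 \<Rightarrow> 'a l2 \<Rightarrow> 'a l2" is "\<lambda>f g i. f i + g i"
  by (rule square_summable_add)
lift_definition uminus_l2 :: "'a l2 \<Rightarrow> 'a l2" is "\<lambda>f i. - f i" by simp
lift_definition minus_l2 :: "'a l2 \<Rightarrow> 'a l2 \<Rightarrow> 'a l2" is "\<lambda>f g i. f i - g i"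
  using square_summable_add[of _ _ "\<lambda>i. - g i" for g] by fastforce
lift_definition scaleR_l2 :: "real \<Rightarrow> 'a l2 \<Rightarrow> 'a l2" is "\<lambda>s f i. of_real s * f i"
  by (rule square_summable_scale)

instance
  by standard (transfer; simp add: algebra_simps fun_eq_iff)+

end

lemma l2_summable: "(\<lambda>i. (cmod (l2_fun x i))\<^sup>2) summable_on UNIV"
  using l2_fun[of x] by simp

lemma l2_inner_summable: "(\<lambda>i. cnj (l2_fun x i) * l2_fun y i) summable_on UNIV"
  by (rule abs_summable_summable) (rule square_summable_inner[OF l2_summable l2_summable])

instantiation l2 :: (type) real_inner
begin

definition inner_l2 :: "'a l2 \<Rightarrow> 'a l2 \<Rightarrow> real" where
  "inner_l2 x y = Re (ell2_inner (l2_fun x) (l2_fun y))"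
definition norm_l2 :: "'a l2 \<Rightarrow> real" where "norm_l2 x = sqrt (inner x x)"
definition sgn_l2 :: "'a l2 \<Rightarrow> 'a l2" where "sgn_l2 x = x /\<^sub>R norm x"
definition dist_l2 :: "'a l2 \<Rightarrow> 'a l2 \<Rightarrow> real" where "dist_l2 x y = norm (x - y)"
definition uniformity_l2 :: "('a l2 \<times> 'a l2) filter" where
  "uniformity_l2 = (INF e\<in>{0<..}. principal {(x, y). dist x y < e})"
definition open_l2 :: "'a l2 set \<Rightarrow> bool" where
  "open_l2 S = (\<forall>x\<in>S. \<forall>\<^sub>F (x', y) in uniformity. x' = x \<longrightarrow> y \<in> S)"

lemma ell2_inner_self: "ell2_inner (l2_fun x) (l2_fun x) = of_real (\<Sum>\<^sub>\<infinity>i. (cmod (l2_fun x i))\<^sup>2)"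
proof -
  have "ell2_inner (l2_fun x) (l2_fun x) = (\<Sum>\<^sub>\<infinity>i. complex_of_real ((cmod (l2_fun x i))\<^sup>2))"
    unfolding ell2_inner_def by (intro infsum_cong) (simp add: complex_norm_square mult.commute del: of_real_power)
  also have "\<dots> = of_real (\<Sum>\<^sub>\<infinity>i. (cmod (l2_fun x i))\<^sup>2)"
    using has_sum_bounded_linear[OF bounded_linear_of_real has_sum_infsum[OF l2_summable[of x]]]
    by (rule infsumI)
  finally show ?thesis .
qed

lemma inner_l2_self: "inner x x = (\<Sum>\<^sub>\<infinity>i. (cmod (l2_fun x i))\<^sup>2)" for x :: "'a l2"
  by (simp add: inner_l2_def ell2_inner_self)

lemma ell2_inner_commute: "ell2_inner g f = cnj (ell2_inner f g)"
  unfolding ell2_inner_def infsum_cnj[symmetric] by (intro infsum_cong) (simp add: mult.commute)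

lemma ell2_inner_add_left:
  "ell2_inner (l2_fun (x + y)) (l2_fun z) = ell2_inner (l2_fun x) (l2_fun z) + ell2_inner (l2_fun y) (l2_fun z)"
  using infsum_add[OF l2_inner_summable[of x z] l2_inner_summable[of y z]]
  unfolding ell2_inner_def plus_l2.rep_eq by (simp add: distrib_right)

instance
proof
  fix x y z :: "'a l2" and r :: real
  show "inner x y = inner y x"
    unfolding inner_l2_def by (subst ell2_inner_commute) simp
  show "inner (x + y) z = inner x z + inner y z"
    by (simp add: inner_l2_def ell2_inner_add_left)
  show "inner (r *\<^sub>R x) y = r * inner x y"
  proof -
    have "ell2_inner (l2_fun (r *\<^sub>R x)) (l2_fun y) = of_real r * ell2_inner (l2_fun x) (l2_fun y)"
      unfolding ell2_inner_def scaleR_l2.rep_eq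
      using infsum_cmult_right[OF l2_inner_summable[of x y], of "of_real r"] by (simp add: mult.assoc)
    then show ?thesis by (simp add: inner_l2_def)
  qed
  show "0 \<le> inner x x" by (simp add: inner_l2_self infsum_nonneg)
  show "(inner x x = 0) = (x = 0)"
  proof
    assume "inner x x = 0"
    then have "(\<Sum>\<^sub>\<infinity>i. (cmod (l2_fun x i))\<^sup>2) = 0" by (simp add: inner_l2_self)
    moreover have "(cmod (l2_fun x i))\<^sup>2 \<le> (\<Sum>\<^sub>\<infinity>i. (cmod (l2_fun x i))\<^sup>2)" for i
      using finite_sum_le_infsum[OF l2_summable, of "{i}" x] by simp
    ultimately have "\<forall>i. l2_fun x i = 0" by simp
    then have "l2_fun x = l2_fun 0" by (simp add: fun_eq_iff zero_l2.rep_eq)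
    then show "x = 0" by (simp only: l2_fun_inject)
  qed (simp add: inner_l2_self zero_l2.rep_eq)
qed (rule sgn_l2_def dist_l2_def uniformity_l2_def open_l2_def norm_l2_def)+

end

lemma norm_l2_sq: "(norm x)\<^sup>2 = (\<Sum>\<^sub>\<infinity>i. (cmod (l2_fun x i))\<^sup>2)"
  by (simp add: power2_norm_eq_inner inner_l2_self)

lemma norm_l2_eq: "norm x = ell2_norm (l2_fun x)"
  by (simp add: norm_l2_def inner_l2_self ell2_norm_def)

lemma sum_l2_le: "finite F \<Longrightarrow> (\<Sum>i\<in>F. (cmod (l2_fun x i))\<^sup>2) \<le> (norm x)\<^sup>2"
  unfolding norm_l2_sq by (rule finite_sum_le_infsum) (auto simp: l2_summable)

lemma l2_coord_le: "cmod (l2_fun x i) \<le> norm x"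
proof (rule power2_le_imp_le)
  show "(cmod (l2_fun x i))\<^sup>2 \<le> (norm x)\<^sup>2" using sum_l2_le[of "{i}" x] by simp
qed simp

lemma square_summable_if_bounded:
  fixes f :: "'i \<Rightarrow> complex"
  assumes "\<And>F. finite F \<Longrightarrow> (\<Sum>i\<in>F. (cmod (f i))\<^sup>2) \<le> C"
  shows "(\<lambda>i. (cmod (f i))\<^sup>2) summable_on UNIV"
  by (rule nonneg_bdd_above_summable_on) (auto intro!: bdd_aboveI[of _ C] assms)

lemma norm_l2_le:
  assumes "\<And>F. finite F \<Longrightarrow> (\<Sum>i\<in>F. (cmod (l2_fun x i))\<^sup>2) \<le> C\<^sup>2" "0 \<le> C"
  shows "norm x \<le> C"
proof (rule power2_le_imp_le)
  show "(norm x)\<^sup>2 \<le> C\<^sup>2"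
    unfolding norm_l2_sq by (intro infsum_le_finite_sums l2_summable assms(1))
qed (rule assms(2))

text \<open>Coordinatewise limits give the candidate; bounds on finite partial sums survive the
  limit and bound the norm.\<close>

instance l2 :: (type) complete_space
proof
  fix X :: "nat \<Rightarrow> 'a l2"
  assume "Cauchy X"
  have "\<exists>l. (\<lambda>n. l2_fun (X n) i) \<longlonglongrightarrow> l" for i
  proof -
    have "Cauchy (\<lambda>n. l2_fun (X n) i)"
      unfolding Cauchy_def
    proof (intro allI impI)
      fix e :: real assume "e > 0"
      then obtain M where M: "\<And>m n. m \<ge> M \<Longrightarrow> n \<ge> M \<Longrightarrow> dist (X m) (X n) < e"
        using \<open>Cauchy X\<close> unfolding Cauchy_def by metis
      have "dist (l2_fun (X m) i) (l2_fun (X n) i) < e" if "m \<ge> M" "n \<ge> M" for m n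
        using l2_coord_le[of "X m - X n" i] M[OF that] by (simp add: dist_norm minus_l2.rep_eq)
      then show "\<exists>M. \<forall>m\<ge>M. \<forall>n\<ge>M. dist (l2_fun (X m) i) (l2_fun (X n) i) < e" by blast
    qed
    then show ?thesis using convergent_eq_Cauchy by blast
  qed
  then obtain f where f: "\<And>i. (\<lambda>n. l2_fun (X n) i) \<longlonglongrightarrow> f i" by metis
  have close: "\<exists>M. \<forall>m\<ge>M. \<forall>F. finite F \<longrightarrow> (\<Sum>i\<in>F. (cmod (l2_fun (X m) i - f i))\<^sup>2) \<le> e\<^sup>2" if e: "e > 0" for e :: real
  proof -
    obtain M where M: "\<And>m n. m \<ge> M \<Longrightarrow> n \<ge> M \<Longrightarrow> dist (X m) (X n) < e"
      using \<open>Cauchy X\<close> e unfolding Cauchy_def by metis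
    have "(\<Sum>i\<in>F. (cmod (l2_fun (X m) i - f i))\<^sup>2) \<le> e\<^sup>2" if m: "m \<ge> M" and F: "finite F" for m F
    proof (rule LIMSEQ_le_const2)
      show "(\<lambda>n. \<Sum>i\<in>F. (cmod (l2_fun (X m) i - l2_fun (X n) i))\<^sup>2) \<longlonglongrightarrow> (\<Sum>i\<in>F. (cmod (l2_fun (X m) i - f i))\<^sup>2)"
        by (intro tendsto_intros f)
      have "(\<Sum>i\<in>F. (cmod (l2_fun (X m) i - l2_fun (X n) i))\<^sup>2) \<le> e\<^sup>2" if "n \<ge> M" for n
      proof -
        have "(\<Sum>i\<in>F. (cmod (l2_fun (X m) i - l2_fun (X n) i))\<^sup>2) \<le> (norm (X m - X n))\<^sup>2"
          using sum_l2_le[OF F, of "X m - X n"] by (simp add: minus_l2.rep_eq)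
        also have "\<dots> \<le> e\<^sup>2" using M[OF m that] by (intro power_mono) (auto simp: dist_norm)
        finally show ?thesis .
      qed
      then show "\<exists>N. \<forall>n\<ge>N. (\<Sum>i\<in>F. (cmod (l2_fun (X m) i - l2_fun (X n) i))\<^sup>2) \<le> e\<^sup>2" by blast
    qed
    then show ?thesis by blast
  qed
  obtain M where M: "\<And>F. finite F \<Longrightarrow> (\<Sum>i\<in>F. (cmod (l2_fun (X M) i - f i))\<^sup>2) \<le> 1\<^sup>2"
    using close[of 1] by auto
  have "(\<lambda>i. (cmod (- (l2_fun (X M) i - f i)))\<^sup>2) summable_on UNIV"
    using square_summable_if_bounded[OF M] by (simp add: norm_minus_commute)
  from square_summable_add[OF l2_summable[of "X M"] this]
  have f_sum: "(\<lambda>i. (cmod (f i))\<^sup>2) summable_on UNIV" by simp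
  have lf: "l2_fun (l2_of f) = f" by (rule l2_of_inverse) (use f_sum in simp)
  have "X \<longlonglongrightarrow> l2_of f"
  proof (rule metric_LIMSEQ_I)
    fix e :: real assume e: "e > 0"
    then obtain M where M: "\<And>m F. m \<ge> M \<Longrightarrow> finite F \<Longrightarrow> (\<Sum>i\<in>F. (cmod (l2_fun (X m) i - f i))\<^sup>2) \<le> (e / 2)\<^sup>2"
      using close[of "e / 2"] by auto
    have "norm (X m - l2_of f) \<le> e / 2" if "m \<ge> M" for m
      by (rule norm_l2_le) (use M[OF that] e in \<open>auto simp: minus_l2.rep_eq lf\<close>)
    then have "dist (X m) (l2_of f) < e" if "m \<ge> M" for m
      using that e by (fastforce simp: dist_norm)
    then show "\<exists>no. \<forall>n\<ge>no. dist (X n) (l2_of f) < e" by blast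
  qed
  then show "convergent X" by (auto simp: convergent_def)
qed

instantiation l2 :: (type) complex_hilbert
begin

lift_definition scaleC_l2 :: "complex \<Rightarrow> 'a l2 \<Rightarrow> 'a l2" is "\<lambda>c f i. c * f i"
  by (rule square_summable_scale)

instance
proof
  fix c d :: complex and x y :: "'a l2" and s :: real
  show "scaleC c (x + y) = scaleC c x + scaleC c y" "scaleC (c + d) x = scaleC c x + scaleC d x"
    "scaleC c (scaleC d x) = scaleC (c * d) x" "scaleC (complex_of_real s) x = s *\<^sub>R x"
    by (transfer; simp add: algebra_simps fun_eq_iff)+
  show "norm (scaleC c x) = cmod c * norm x"
  proof (rule power2_eq_imp_eq)
    show "(norm (scaleC c x))\<^sup>2 = (cmod c * norm x)\<^sup>2"
      unfolding norm_l2_sq power_mult_distrib scaleC_l2.rep_eq norm_mult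
      by (intro infsum_cmult_right l2_summable)
  qed auto
qed

end

lemma cinner_l2: "cinner x y = ell2_inner (l2_fun x) (l2_fun y)"
proof -
  have "ell2_inner (l2_fun (scaleC \<i> x)) (l2_fun y) = - \<i> * ell2_inner (l2_fun x) (l2_fun y)"
    unfolding ell2_inner_def scaleC_l2.rep_eq
    using infsum_cmult_right[OF l2_inner_summable[of x y], of "- \<i>"] by (simp add: mult.assoc)
  then show ?thesis by (simp add: cinner_def inner_l2_def complex_eq_iff)
qed

lemma l2_eqI: "(\<And>i. l2_fun x i = l2_fun y i) \<Longrightarrow> x = y"
  by (rule l2_fun_inject[THEN iffD1, OF ext])

lemma l2_fun_plus: "l2_fun (x + y) = l2_fun x + l2_fun y"
  by (simp add: fun_eq_iff plus_l2.rep_eq)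

lemma l2_fun_minus: "l2_fun (x - y) = l2_fun x - l2_fun y"
  by (simp add: fun_eq_iff minus_l2.rep_eq)

lemma l2_fun_zero: "l2_fun 0 = 0"
  by (simp add: fun_eq_iff zero_l2.rep_eq)

lemma l2_fun_scaleC: "l2_fun (scaleC c x) = cscale c (l2_fun x)"
  by (simp add: fun_eq_iff scaleC_l2.rep_eq cscale_def)

lemma l2_fun_sum: "l2_fun (sum f S) = (\<Sum>i\<in>S. l2_fun (f i))"
  by (induction S rule: infinite_finite_induct) (auto simp: l2_fun_plus l2_fun_zero)

section \<open>Vectors supported on an index set\<close>

definition supported_on :: "'i set \<Rightarrow> 'i l2 set" where
  "supported_on I = {x. \<forall>i. i \<notin> I \<longrightarrow> l2_fun x i = 0}"

lemma supported_on_UNIV [simp]: "supported_on UNIV = UNIV"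
  by (simp add: supported_on_def)

lemma csubspace_supported_on: "csubspace (supported_on I)"
  by (auto simp: csubspace_def supported_on_def zero_l2.rep_eq plus_l2.rep_eq scaleC_l2.rep_eq)

lemma bounded_linear_l2_coord: "bounded_linear (\<lambda>x. l2_fun x i)"
  by (rule bounded_linear_intro[where K = 1])
     (auto simp: plus_l2.rep_eq scaleR_l2.rep_eq scaleR_conv_of_real l2_coord_le)

lemma closed_supported_on: "closed (supported_on I)"
proof -
  have "closed {x. l2_fun x i = 0}" for i
    by (intro closed_Collect_eq linear_continuous_on bounded_linear_l2_coord continuous_intros)
  then have "closed (\<Inter>i\<in>-I. {x. l2_fun x i = 0})" by (intro closed_INT ballI)
  also have "(\<Inter>i\<in>-I. {x. l2_fun x i = 0}) = supported_on I" by (auto simp: supported_on_def)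
  finally show ?thesis .
qed

lemma ell2_eq: "ell2 I = l2_fun ` supported_on I"
proof -
  have "(\<lambda>i. (cmod (f i))\<^sup>2) summable_on I \<longleftrightarrow> (\<lambda>i. (cmod (f i))\<^sup>2) summable_on UNIV"
    if "\<forall>i. i \<notin> I \<longrightarrow> f i = 0" for f :: "'a \<Rightarrow> complex"
    by (rule summable_on_cong_neutral) (use that in auto)
  then have "ell2 I = {f. (\<forall>i. i \<notin> I \<longrightarrow> f i = 0) \<and> (\<lambda>i. (cmod (f i))\<^sup>2) summable_on UNIV}"
    unfolding ell2_def by blast
  also have "\<dots> = l2_fun ` supported_on I"
  proof (intro equalityI subsetI)
    fix f :: "'a \<Rightarrow> complex"
    assume f: "f \<in> {f. (\<forall>i. i \<notin> I \<longrightarrow> f i = 0) \<and> (\<lambda>i. (cmod (f i))\<^sup>2) summable_on UNIV}"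
    then have "l2_fun (l2_of f) = f" by (intro l2_of_inverse) simp
    then show "f \<in> l2_fun ` supported_on I"
      using f by (intro image_eqI[of f l2_fun "l2_of f"]) (auto simp: supported_on_def)
  qed (auto simp: supported_on_def l2_summable)
  finally show ?thesis .
qed

text \<open>Complex spans of functions face real spans in \<open>l2\<close>: a complex basis becomes
  a real spanning set once its multiples by \<i> are adjoined.\<close>

lemma finite_dim_iff:
  assumes "csubspace E"
  shows "(\<exists>B. finite B \<and> l2_fun ` E \<subseteq> cfun.span B) \<longleftrightarrow> (\<exists>B. finite B \<and> E \<subseteq> span B)"
proof
  assume "\<exists>B. finite B \<and> l2_fun ` E \<subseteq> cfun.span B"
  then obtain B where B: "finite B" "l2_fun ` E \<subseteq> cfun.span B" by blast
  obtain C where C: "C \<subseteq> l2_fun ` E" "cfun.independent C" "l2_fun ` E \<subseteq> cfun.span C"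
    using cfun.maximal_independent_subset by metis
  then have fin: "finite C" using cfun.independent_span_bound[OF B(1) C(2)] B(2) by blast
  obtain D where D: "D \<subseteq> E" "finite D" "C = l2_fun ` D"
    using finite_subset_image[OF fin C(1)] by blast
  let ?D = "D \<union> scaleC \<i> ` D"
  have "x \<in> span ?D" if x: "x \<in> E" for x
  proof -
    have "l2_fun x \<in> cfun.span C" using C(3) x by blast
    then obtain u where "l2_fun x = (\<Sum>v\<in>C. cscale (u v) v)"
      using fin by (auto simp: cfun.span_finite)
    also have "\<dots> = (\<Sum>y\<in>D. cscale (u (l2_fun y)) (l2_fun y))"
      unfolding D(3) by (intro sum.reindex_cong[OF _ refl]) (auto simp: inj_on_def l2_fun_inject)
    also have "\<dots> = l2_fun (\<Sum>y\<in>D. scaleC (u (l2_fun y)) y)"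
      by (simp add: l2_fun_sum l2_fun_scaleC)
    finally have "x = (\<Sum>y\<in>D. scaleC (u (l2_fun y)) y)" by (simp add: l2_fun_inject)
    also have "\<dots> \<in> span ?D"
    proof (rule span_sum)
      fix y assume "y \<in> D"
      then have "span {y, scaleC \<i> y} \<subseteq> span ?D" by (intro span_mono) auto
      then show "scaleC (u (l2_fun y)) y \<in> span ?D" using scaleC_in_span by blast
    qed
    finally show ?thesis .
  qed
  then show "\<exists>B. finite B \<and> E \<subseteq> span B" using D(2) by (intro exI[of _ ?D]) auto
next
  assume "\<exists>B. finite B \<and> E \<subseteq> span B"
  then obtain B where B: "finite B" "E \<subseteq> span B" by blast
  have "l2_fun x \<in> cfun.span (l2_fun ` B)" if "x \<in> E" for x
  proof -
    have "x \<in> span B" using that B(2) by blast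
    then obtain u where "x = (\<Sum>v\<in>B. u v *\<^sub>R v)"
      unfolding span_finite[OF B(1)] by blast
    then have "l2_fun x = (\<Sum>v\<in>B. cscale (of_real (u v)) (l2_fun v))"
      by (simp add: l2_fun_sum l2_fun_scaleC scaleC_of_real[symmetric])
    then show ?thesis by (simp add: cfun.span_sum cfun.span_scale cfun.span_base)
  qed
  then show "\<exists>B. finite B \<and> l2_fun ` E \<subseteq> cfun.span B" using B(1) by (intro exI[of _ "l2_fun ` B"]) auto
qed

text \<open>T is tied to A only on vectors supported on I, so a single unitary operator of the whole
  space can represent several T on different I.\<close>

locale l2_unitary = unitary_operator A for A :: "'i l2 \<Rightarrow> 'i l2" +
  fixes I :: "'i set" and T :: "('i \<Rightarrow> complex) \<Rightarrow> 'i \<Rightarrow> complex"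
  assumes red: "reducing (supported_on I)"
    and rep: "x \<in> supported_on I \<Longrightarrow> T (l2_fun x) = l2_fun (A x)"
begin

lemma rep_power: "x \<in> supported_on I \<Longrightarrow> (T ^^ n) (l2_fun x) = l2_fun ((A ^^ n) x)"
proof (induction n)
  case (Suc n)
  then show ?case using rep[OF reducing_ipow[OF red, of x "int n"]] by (simp add: ipow_of_nat)
qed simp

text \<open>A bounded inverse gives a lower bound for A - z. Conversely a lower bound c makes A - z
  injective, and surjective by \<open>resolvent_surjective\<close>; the inverse is then linear and
  bounded by 1/c.\<close>

lemma op_spectrum_eq: "op_spectrum (ell2 I) T = approx_spectrum (supported_on I)"
proof -
  let ?H = "supported_on I"
  have sub: "csubspace ?H" by (rule csubspace_supported_on)
  have res: "T (l2_fun x) - cscale z (l2_fun x) = l2_fun (A x - scaleC z x)" if "x \<in> ?H" for x z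
    using that by (simp add: rep l2_fun_minus l2_fun_scaleC)
  have resH: "A x - scaleC z x \<in> ?H" if "x \<in> ?H" for x z
    using that by (intro csubspaceD[OF sub] reducing_A[OF red])
  have no_inv: "z \<notin> approx_spectrum ?H"
    if R: "bounded_operator (ell2 I) R" "\<And>f. f \<in> ell2 I \<Longrightarrow> R (T f - cscale z f) = f" for z R
  proof
    assume z: "z \<in> approx_spectrum ?H"
    obtain C where C: "\<And>f. f \<in> ell2 I \<Longrightarrow> ell2_norm (R f) \<le> C * ell2_norm f"
      using R(1) by (auto simp: bounded_operator_def)
    \<comment> \<open>The threshold is positive whatever the sign of C, and |C|/(1 + |C|) < 1
      contradicts the norm 1 of x.\<close>
    obtain x where x: "x \<in> ?H" "norm x = 1" "norm (A x - scaleC z x) < 1 / (1 + \<bar>C\<bar>)"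
      using z by (auto simp: approx_spectrum_def dest!: spec[of _ "1 / (1 + \<bar>C\<bar>)"])
    have "1 = ell2_norm (R (l2_fun (A x - scaleC z x)))"
      using R(2)[of "l2_fun x"] x(1,2) by (simp add: ell2_eq res norm_l2_eq)
    also have "\<dots> \<le> C * norm (A x - scaleC z x)"
      using C resH[OF x(1)] by (simp add: ell2_eq norm_l2_eq)
    also have "\<dots> \<le> \<bar>C\<bar> * (1 / (1 + \<bar>C\<bar>))"
      using x(3) by (intro mult_mono) auto
    also have "\<dots> < 1" by simp
    finally show False by simp
  qed
  have "\<exists>R. bounded_operator (ell2 I) R \<and>
      (\<forall>f\<in>ell2 I. R (T f - cscale z f) = f \<and> T (R f) - cscale z (R f) = f)"
    if z: "z \<notin> approx_spectrum ?H" for z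
  proof -
    obtain c where c: "c > 0" "\<And>x. x \<in> ?H \<Longrightarrow> c * norm x \<le> norm (A x - scaleC z x)"
      using approx_spectrum_bounded_below[OF sub z] by metis
    have "\<forall>y\<in>?H. \<exists>x\<in>?H. A x - scaleC z x = y"
      using resolvent_surjective[OF red c] by blast
    then obtain R where R: "\<And>y. y \<in> ?H \<Longrightarrow> R y \<in> ?H" "\<And>y. y \<in> ?H \<Longrightarrow> A (R y) - scaleC z (R y) = y" by metis
    have inj: "x = y" if "x \<in> ?H" "y \<in> ?H" "A x - scaleC z x = A y - scaleC z y" for x y
    proof -
      have "A (x - y) - scaleC z (x - y) = 0" using that(3) by (simp add: diff scaleC_diff_right algebra_simps)
      then show ?thesis using c(2)[OF csubspaceD(4)[OF sub that(1,2)]] c(1) by (simp add: mult_le_0_iff)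
    qed
    have R_add: "R (x + y) = R x + R y" if "x \<in> ?H" "y \<in> ?H" for x y
    proof (rule inj)
      have xy: "x + y \<in> ?H" by (rule csubspaceD(2)[OF sub that])
      show "R (x + y) \<in> ?H" by (rule R(1)[OF xy])
      show "R x + R y \<in> ?H" by (rule csubspaceD(2)[OF sub R(1)[OF that(1)] R(1)[OF that(2)]])
      have "A (R x + R y) - scaleC z (R x + R y) = (A (R x) - scaleC z (R x)) + (A (R y) - scaleC z (R y))"
        by (simp add: add scaleC_add_right)
      then show "A (R (x + y)) - scaleC z (R (x + y)) = A (R x + R y) - scaleC z (R x + R y)"
        by (simp only: R(2)[OF xy] R(2)[OF that(1)] R(2)[OF that(2)])
    qed
    have R_scale: "R (scaleC d x) = scaleC d (R x)" if "x \<in> ?H" for x d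
    proof (rule inj)
      have "A (scaleC d (R x)) - scaleC z (scaleC d (R x)) = scaleC d (A (R x) - scaleC z (R x))"
        by (simp add: scale scaleC_diff_right mult.commute)
      then show "A (R (scaleC d x)) - scaleC z (R (scaleC d x)) = A (scaleC d (R x)) - scaleC z (scaleC d (R x))"
        using R that by (simp add: csubspaceD[OF sub])
    qed (use that R(1) csubspaceD(3)[OF sub] in auto)
    have R_inv: "R (A x - scaleC z x) = x" if "x \<in> ?H" for x
      by (rule inj[OF R(1)[OF resH[OF that]] that R(2)[OF resH[OF that]]])
    define R' where "R' f = l2_fun (R (l2_of f))" for f
    have R': "R' (l2_fun x) = l2_fun (R x)" for x by (simp add: R'_def l2_fun_inverse)
    have "bounded_operator (ell2 I) R'"
      unfolding bounded_operator_def linear_between_def ell2_eq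
    proof (intro conjI exI[of _ "1 / c"] ballI allI)
      fix f assume "f \<in> l2_fun ` ?H"
      then obtain x where x: "x \<in> ?H" "f = l2_fun x" by blast
      have "c * norm (R x) \<le> norm x" using c(2)[OF R(1)[OF x(1)]] R(2)[OF x(1)] by simp
      then show "ell2_norm (R' f) \<le> 1 / c * ell2_norm f"
        using c(1) by (simp add: x(2) R' norm_l2_eq[symmetric] field_simps)
    qed (auto simp: R' R R_add R_scale l2_fun_plus[symmetric] l2_fun_scaleC[symmetric] intro!: imageI R)
    moreover have "R' (T f - cscale z f) = f \<and> T (R' f) - cscale z (R' f) = f" if "f \<in> ell2 I" for f
      using that R by (auto simp: ell2_eq res R' R_inv)
    ultimately show ?thesis by blast
  qed
  note inv = this
  show ?thesis
  proof (intro equalityI subsetI)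
    fix z assume z: "z \<in> op_spectrum (ell2 I) T"
    show "z \<in> approx_spectrum ?H"
    proof (rule ccontr)
      assume n: "z \<notin> approx_spectrum ?H"
      show False using z[unfolded op_spectrum_def, THEN CollectD] inv[OF n] by (rule notE)
    qed
  next
    fix z assume z: "z \<in> approx_spectrum ?H"
    show "z \<in> op_spectrum (ell2 I) T"
      unfolding op_spectrum_def mem_Collect_eq
    proof (rule notI, elim exE conjE)
      fix R assume R: "bounded_operator (ell2 I) R"
        "\<forall>f\<in>ell2 I. R (T f - cscale z f) = f \<and> T (R f) - cscale z (R f) = f"
      have "z \<notin> approx_spectrum ?H" using R(2) by (intro no_inv[OF R(1)]) simp
      then show False using z by (rule notE)
    qed
  qed
qed

lemma eigenspace_eq: "eigenspace (ell2 I) T z = l2_fun ` eigenvectors (supported_on I) z"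
  by (auto simp: eigenspace_def eigenvectors_def ell2_eq rep l2_fun_inject l2_fun_scaleC[symmetric])

theorem ess_spectrum_eq: "ess_spectrum (ell2 I) T = {z. singular_at (supported_on I) z}"
proof -
  have "eigenspace (ell2 I) T z \<noteq> {0} \<longleftrightarrow> eigenvectors (supported_on I) z \<noteq> {0}" for z
  proof -
    have "eigenspace (ell2 I) T z = {0} \<longleftrightarrow> l2_fun ` eigenvectors (supported_on I) z = l2_fun ` {0}"
      by (simp add: eigenspace_eq l2_fun_zero)
    also have "\<dots> \<longleftrightarrow> eigenvectors (supported_on I) z = {0}"
      by (intro inj_image_eq_iff) (auto simp: inj_def l2_fun_inject)
    finally show ?thesis by simp
  qed
  moreover have "(\<exists>B. finite B \<and> eigenspace (ell2 I) T z \<subseteq> cfun.span B) \<longleftrightarrow>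
      (\<exists>B. finite B \<and> eigenvectors (supported_on I) z \<subseteq> span B)" for z
    unfolding eigenspace_eq by (intro finite_dim_iff eigenvectors_csubspace csubspace_supported_on)
  ultimately show ?thesis
    unfolding ess_spectrum_def discrete_spectrum_def op_spectrum_eq singular_at_iff[OF red] by auto
qed

text \<open>The two notions of spectral measure correspond: the inclusion of [0, 2 pi) pushes a
  measure forward to the line, and restriction goes back. Null sets match because only their part
  inside [0, 2 pi) carries mass.\<close>

theorem ac_subspace_eq: "ac_subspace (ell2 I) T = l2_fun ` (ac_vectors \<inter> supported_on I)"
proof -
  let ?J = "{0..<2*pi}"
  have "(\<exists>\<mu>. is_spectral_measure T (l2_fun x) \<mu> \<and> absolutely_continuous (restrict_space lborel ?J) \<mu>) \<longleftrightarrow>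
      x \<in> ac_vectors" if x: "x \<in> supported_on I" for x
  proof
    assume "\<exists>\<mu>. is_spectral_measure T (l2_fun x) \<mu> \<and> absolutely_continuous (restrict_space lborel ?J) \<mu>"
    then obtain \<mu> where \<mu>: "is_spectral_measure T (l2_fun x) \<mu>" and ac: "absolutely_continuous (restrict_space lborel ?J) \<mu>"
      by blast
    have fin: "finite_measure \<mu>" and sets: "sets \<mu> = sets (restrict_space borel ?J)"
      using \<mu> by (auto simp: is_spectral_measure_def)
    have space: "space \<mu> = ?J" using sets_eq_imp_space_eq[OF sets] by (simp add: space_restrict_space)
    have id_m: "(\<lambda>t. t) \<in> \<mu> \<rightarrow>\<^sub>M borel"
      by (subst measurable_cong_sets[OF sets refl], rule measurable_restrict_space1) simp
    interpret finite_measure \<mu> by (rule fin)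
    define \<nu> where "\<nu> = distr \<mu> borel (\<lambda>t. t)"
    have "spectral_meas x \<nu>"
      unfolding spectral_meas_def
    proof (intro conjI allI)
      show "finite_measure \<nu>" unfolding \<nu>_def by (rule finite_measure_distr[OF id_m])
      show "AE t in \<nu>. t \<in> ?J" unfolding \<nu>_def by (subst AE_distr_iff[OF id_m]) (auto simp: space)
      show "cinner x ((A ^^ n) x) = (\<integral>t. cis (real n * t) \<partial>\<nu>)" for n
        using \<mu> unfolding \<nu>_def is_spectral_measure_def
        by (subst integral_distr[OF id_m]) (auto simp: rep_power[OF x] cinner_l2)
    qed (simp add: \<nu>_def)
    moreover have "absolutely_continuous lborel \<nu>"
      unfolding absolutely_continuous_def
    proof
      fix N :: "real set" assume N: "N \<in> null_sets lborel"
      then have "N \<inter> ?J \<in> null_sets lborel" by (intro null_set_Int2) auto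
      then have "N \<inter> ?J \<in> null_sets (restrict_space lborel ?J)"
        by (subst null_sets_restrict_space) auto
      then have "N \<inter> ?J \<in> null_sets \<mu>" using ac by (auto simp: absolutely_continuous_def)
      moreover have "emeasure \<nu> N = emeasure \<mu> (N \<inter> ?J)"
        using N unfolding \<nu>_def by (subst emeasure_distr[OF id_m]) (auto simp: space)
      ultimately show "N \<in> null_sets \<nu>" using N by (auto simp: null_sets_def \<nu>_def)
    qed
    ultimately show "x \<in> ac_vectors" by (auto simp: ac_vectors_def)
  next
    assume "x \<in> ac_vectors"
    then obtain \<nu> where \<nu>: "spectral_meas x \<nu>" and ac: "absolutely_continuous lborel \<nu>"
      by (auto simp: ac_vectors_def)
    note sets = spectral_sets[OF \<nu>] and space = spectral_space[OF \<nu>]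
    interpret finite_measure \<nu> by (rule spectral_finite[OF \<nu>])
    define \<mu> where "\<mu> = restrict_space \<nu> ?J"
    have J: "?J \<inter> space \<nu> \<in> sets \<nu>" by (simp add: sets space)
    have "is_spectral_measure T (l2_fun x) \<mu>"
      unfolding is_spectral_measure_def
    proof (intro conjI allI)
      show "finite_measure \<mu>"
        by (intro finite_measureI) (use J in \<open>simp add: \<mu>_def emeasure_restrict_space space_restrict_space\<close>)
      show "sets \<mu> = sets (restrict_space borel ?J)" by (simp add: \<mu>_def sets_restrict_space sets)
      fix n :: nat
      have "(\<integral>t. cis (real n * t) \<partial>\<mu>) = (\<integral>t. indicator ?J t *\<^sub>R cis (real n * t) \<partial>\<nu>)"
        unfolding \<mu>_def by (rule integral_restrict_space[OF J])
      also have "\<dots> = (\<integral>t. cis (real n * t) \<partial>\<nu>)"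
      proof (rule integral_cong_AE)
        show "AE t in \<nu>. indicator ?J t *\<^sub>R cis (real n * t) = cis (real n * t)"
          using spectral_AE[OF \<nu>] by eventually_elim (simp add: indicator_def)
      qed (simp_all add: measurable_cong_sets[OF sets refl])
      also have "\<dots> = cinner x ((A ^^ n) x)" using \<nu> by (simp add: spectral_meas_def)
      finally show "ell2_inner (l2_fun x) ((T ^^ n) (l2_fun x)) = (\<integral>t. cis (real n * t) \<partial>\<mu>)"
        by (simp add: rep_power[OF x] cinner_l2)
    qed
    moreover have "absolutely_continuous (restrict_space lborel ?J) \<mu>"
      using ac unfolding absolutely_continuous_def \<mu>_def
      by (auto simp: null_sets_restrict_space sets)
    ultimately show "\<exists>\<mu>. is_spectral_measure T (l2_fun x) \<mu> \<and> absolutely_continuous (restrict_space lborel ?J) \<mu>"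
      by blast
  qed
  then show ?thesis unfolding ac_subspace_def ell2_eq by auto
qed

end

section \<open>Block operators and decoupling\<close>

lemma unitary_operator_compose:
  assumes "unitary_operator A" "unitary_operator B"
  shows "unitary_operator (A \<circ> B)"
proof -
  interpret A: unitary_operator A by fact
  interpret B: unitary_operator B by fact
  show ?thesis
  proof
    show "surj (A \<circ> B)" by (rule comp_surj[OF B.surj_A A.surj_A])
  qed (simp_all add: A.add B.add A.scale B.scale)
qed

section \<open>Coordinate restrictions\<close>

lift_definition l2_restrict :: "'i set \<Rightarrow> 'i l2 \<Rightarrow> 'i l2" is "\<lambda>I f i. if i \<in> I then f i else 0"
  by (rule summable_on_comparison_test) auto

lemma l2_restrict_supported: "l2_restrict I x \<in> supported_on I"
  by (simp add: supported_on_def l2_restrict.rep_eq)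

lemma l2_restrict_id: "x \<in> supported_on I \<Longrightarrow> l2_restrict I x = x"
  by (rule l2_eqI) (auto simp: supported_on_def l2_restrict.rep_eq)

lemma l2_restrict_add: "l2_restrict I (x + y) = l2_restrict I x + l2_restrict I y"
  by (rule l2_eqI) (simp add: l2_restrict.rep_eq plus_l2.rep_eq)

lemma l2_restrict_diff: "l2_restrict I (x - y) = l2_restrict I x - l2_restrict I y"
  by (rule l2_eqI) (simp add: l2_restrict.rep_eq minus_l2.rep_eq)

lemma l2_restrict_scale: "l2_restrict I (scaleC c x) = scaleC c (l2_restrict I x)"
  by (rule l2_eqI) (simp add: l2_restrict.rep_eq scaleC_l2.rep_eq)

lemma cinner_restrict_right: "cinner (l2_restrict I x) y = cinner (l2_restrict I x) (l2_restrict I y)"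
  unfolding cinner_l2 ell2_inner_def by (rule infsum_cong) (simp add: l2_restrict.rep_eq)

lemma cinner_restrict: "cinner (l2_restrict I x) y = cinner x (l2_restrict I y)"
  unfolding cinner_l2 ell2_inner_def by (rule infsum_cong) (simp add: l2_restrict.rep_eq)

lemma cinner_disjoint:
  assumes "x \<in> supported_on I" "y \<in> supported_on J" "I \<inter> J = {}"
  shows "cinner x y = 0"
proof -
  have "cnj (l2_fun x i) * l2_fun y i = 0" for i
    using assms by (auto simp: supported_on_def)
  then show ?thesis unfolding cinner_l2 ell2_inner_def by (rule infsum_0)
qed

lemma norm_l2_restrict_le: "norm (l2_restrict I x) \<le> norm x"
proof (rule norm_l2_le)
  fix F :: "'a set" assume F: "finite F"
  have "(\<Sum>i\<in>F. (cmod (l2_fun (l2_restrict I x) i))\<^sup>2) \<le> (\<Sum>i\<in>F. (cmod (l2_fun x i))\<^sup>2)"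
    by (rule sum_mono) (simp add: l2_restrict.rep_eq)
  also have "\<dots> \<le> (norm x)\<^sup>2" by (rule sum_l2_le[OF F])
  finally show "(\<Sum>i\<in>F. (cmod (l2_fun (l2_restrict I x) i))\<^sup>2) \<le> (norm x)\<^sup>2" .
qed simp

context unitary_operator
begin

lemma tp_op_commute:
  assumes P: "\<And>x. P (A x) = A (P x)" and add: "\<And>x y. P (x + y) = P x + P y"
    and scale: "\<And>c x. P (scaleC c x) = scaleC c (P x)"
  shows "tp_op p (P x) = P (tp_op p x)"
proof -
  have Ai: "P (Ai x) = Ai (P x)" for x by (metis A_Ai Ai_A P)
  have ip: "ipow n (P x) = P (ipow n x)" for n x
  proof (induction n rule: int_induct[of _ 0])
    case (step1 i)
    then show ?case by (simp add: A_ipow[symmetric] P)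
  next
    case (step2 i)
    then show ?case by (simp add: Ai_ipow[symmetric] Ai)
  qed simp
  have "P 0 = 0" using scale[of 0 0] by simp
  then show ?thesis by (induction p) (auto simp: ip add scale)
qed

end

text \<open>Block diagonality for the partition into I, J and the point i0, expressed by commutation
  with coordinate restrictions.\<close>

locale split_unitary = unitary_operator A for A :: "'i l2 \<Rightarrow> 'i l2" +
  fixes I J :: "'i set" and i0 :: 'i and w :: complex
  assumes disjoint: "I \<inter> J = {}" "i0 \<notin> I" "i0 \<notin> J" and cover: "I \<union> J \<union> {i0} = UNIV"
    and commute_I: "l2_restrict I (A x) = A (l2_restrict I x)"
    and commute_J: "l2_restrict J (A x) = A (l2_restrict J x)"
    and eigen_o: "l2_fun (A x) i0 = w * l2_fun x i0"
begin

lemma reducing_if_commute: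
  assumes "\<And>x. l2_restrict K (A x) = A (l2_restrict K x)"
  shows "reducing (supported_on K)"
  unfolding reducing_def
proof (intro conjI csubspace_supported_on closed_supported_on equalityI subsetI)
  fix x assume "x \<in> A ` supported_on K"
  then obtain y where "y \<in> supported_on K" "x = A y" by blast
  then have "x = l2_restrict K x" using assms[of y] by (simp add: l2_restrict_id)
  then show "x \<in> supported_on K" using l2_restrict_supported[of K x] by simp
next
  fix x assume x: "x \<in> supported_on K"
  obtain y where "x = A y" using surj_A by blast
  then have "x = A (l2_restrict K y)" using assms[of y] x by (simp add: l2_restrict_id)
  then show "x \<in> A ` supported_on K" using l2_restrict_supported by blast
qed

lemma reducing_I: "reducing (supported_on I)"
  by (rule reducing_if_commute) (rule commute_I)

lemma reducing_J: "reducing (supported_on J)"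
  by (rule reducing_if_commute) (rule commute_J)

lemma split: "x = l2_restrict I x + l2_restrict J x + l2_restrict {i0} x"
proof (rule l2_eqI)
  fix i
  have "i \<in> I \<or> i \<in> J \<or> i = i0" using cover by auto
  then show "l2_fun x i = l2_fun (l2_restrict I x + l2_restrict J x + l2_restrict {i0} x) i"
    using disjoint by (auto simp: plus_l2.rep_eq l2_restrict.rep_eq)
qed

lemma norm_split: "(norm x)\<^sup>2 = (norm (l2_restrict I x))\<^sup>2 + (norm (l2_restrict J x))\<^sup>2 + (norm (l2_restrict {i0} x))\<^sup>2"
proof -
  have "inner (l2_restrict K x) (l2_restrict L x) = 0" if "K \<inter> L = {}" for K L
    using cinner_disjoint[OF l2_restrict_supported l2_restrict_supported that, of x x]
    by (metis Re_cinner zero_complex.sel(1))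
  from this[of I J] this[of I "{i0}"] this[of J "{i0}"]
  show ?thesis using disjoint
    by (subst (1) split) (simp add: power2_norm_eq_inner inner_add inner_commute)
qed

lemma commute_o: "A (l2_restrict {i0} x) = scaleC w (l2_restrict {i0} x)"
proof -
  have "A x = A (l2_restrict I x) + A (l2_restrict J x) + A (l2_restrict {i0} x)"
    by (subst split[of x]) (simp add: add)
  moreover have "A x = A (l2_restrict I x) + A (l2_restrict J x) + l2_restrict {i0} (A x)"
    by (subst split[of "A x"]) (simp add: commute_I commute_J)
  ultimately have "A (l2_restrict {i0} x) = l2_restrict {i0} (A x)" by simp
  also have "\<dots> = scaleC w (l2_restrict {i0} x)"
    by (rule l2_eqI) (auto simp: l2_restrict.rep_eq scaleC_l2.rep_eq eigen_o)
  finally show ?thesis .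
qed

text \<open>A test vector acts on vectors supported on K through its restriction to K.\<close>

lemma singular_at_if_part:
  assumes "singular_at (supported_on K) z"
  shows "singular_at UNIV z"
  unfolding singular_at_def
proof (intro allI impI)
  fix F :: "'i l2 set" and e :: real
  assume Fe: "finite F \<and> F \<subseteq> UNIV \<and> 0 < e"
  have "finite (l2_restrict K ` F)" "l2_restrict K ` F \<subseteq> supported_on K"
    using Fe l2_restrict_supported by auto
  then obtain x where x: "x \<in> supported_on K" "norm x = 1"
    "\<And>g. g \<in> l2_restrict K ` F \<Longrightarrow> cmod (cinner g x) < e" "norm (A x - scaleC z x) < e"
    using singular_atD[OF assms, of "l2_restrict K ` F" e] Fe by metis
  have "cmod (cinner g x) < e" if "g \<in> F" for g
    using x(3)[of "l2_restrict K g"] that by (simp add: cinner_restrict l2_restrict_id[OF x(1)])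
  with x show "\<exists>x\<in>UNIV. norm x = 1 \<and> (\<forall>g\<in>F. cmod (cinner g x) < e) \<and> norm (A x - scaleC z x) < e"
    by blast
qed

text \<open>Restriction commutes with A; normalising divides by a norm of at least 1/2, which the
  halved error bounds absorb.\<close>

lemma part_of_approximate_eigenvector:
  assumes K: "\<And>x. l2_restrict K (A x) = A (l2_restrict K x)" and G: "G \<subseteq> supported_on K"
    and x: "norm (A x - scaleC z x) < e / 2" "\<And>g. g \<in> G \<Longrightarrow> cmod (cinner g x) < e / 2"
    and large: "1 / 2 \<le> norm (l2_restrict K x)"
  shows "\<exists>y\<in>supported_on K. norm y = 1 \<and> (\<forall>g\<in>G. cmod (cinner g y) < e) \<and> norm (A y - scaleC z y) < e"
proof -
  let ?n = "norm (l2_restrict K x)"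
  let ?y = "scaleC (of_real (1 / ?n)) (l2_restrict K x)"
  have n: "?n > 0" using large by linarith
  have half: "a / ?n < e" if "a < e / 2" "0 \<le> a" for a
  proof -
    have "e / 2 \<le> e * ?n" using mult_left_mono[OF large, of e] that by simp
    then have "a < e * ?n" using that(1) by linarith
    then show ?thesis using n by (simp add: pos_divide_less_eq)
  qed
  have "norm ?y = 1" using n by (simp add: norm_divide)
  moreover have "cmod (cinner g ?y) < e" if g: "g \<in> G" for g
  proof -
    have "cinner g x = cinner g (l2_restrict K x)"
      using cinner_restrict[of K g x] l2_restrict_id[of g K] g G by (simp add: subset_iff)
    then have "cmod (cinner g ?y) = cmod (cinner g x) / ?n" by (simp add: cinner_scaleC_right norm_divide)
    also have "\<dots> < e"
      by (rule half[OF x(2)[OF g]]) simp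
    finally show ?thesis .
  qed
  moreover have "norm (A ?y - scaleC z ?y) < e"
  proof -
    have "A ?y - scaleC z ?y = scaleC (of_real (1 / ?n)) (l2_restrict K (A x - scaleC z x))"
      by (simp add: scale K l2_restrict_diff l2_restrict_scale scaleC_diff_right mult.commute)
    then have "norm (A ?y - scaleC z ?y) = norm (l2_restrict K (A x - scaleC z x)) / ?n"
      by (simp add: norm_divide)
    also have "\<dots> \<le> norm (A x - scaleC z x) / ?n"
      by (intro divide_right_mono norm_l2_restrict_le) simp
    also have "\<dots> < e"
      by (rule half[OF x(1)]) simp
    finally show ?thesis .
  qed
  moreover have "?y \<in> supported_on K"
    by (intro csubspaceD[OF csubspace_supported_on] l2_restrict_supported)
  ultimately show ?thesis by blast
qed

end

lift_definition l2_basis :: "'i \<Rightarrow> 'i l2" is "\<lambda>k i. if i = k then 1 else 0"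
proof -
  fix k :: 'i
  show "(\<lambda>i. (cmod (if i = k then 1 else 0))\<^sup>2) summable_on UNIV"
    by (rule finite_nonzero_values_imp_summable_on) simp
qed

lemma cinner_l2_basis: "cinner (l2_basis k) x = l2_fun x k"
proof -
  have "(\<Sum>\<^sub>\<infinity>i. cnj (l2_fun (l2_basis k) i) * l2_fun x i) = (\<Sum>\<^sub>\<infinity>i\<in>{k}. l2_fun x i)"
    by (rule infsum_cong_neutral) (auto simp: l2_basis.rep_eq)
  then show ?thesis by (simp add: cinner_l2 ell2_inner_def)
qed

lemma norm_l2_basis: "norm (l2_basis k) = 1"
proof -
  have "complex_of_real ((norm (l2_basis k))\<^sup>2) = 1"
    by (simp only: cinner_self[symmetric] cinner_l2_basis) (simp add: l2_basis.rep_eq)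
  then have "(norm (l2_basis k))\<^sup>2 = 1" by (metis of_real_eq_1_iff)
  then show ?thesis by (simp add: power2_eq_1_iff) (smt (verit) norm_ge_zero)
qed

context split_unitary
begin

text \<open>The basis vector at i0 joins the test vectors. It forces the component at i0 below 1/2,
  so the other two cannot both be short, and one of them normalises to an approximate eigenvector of
  its part.\<close>

lemma singular_at_split:
  "singular_at UNIV z \<longleftrightarrow> singular_at (supported_on I) z \<or> singular_at (supported_on J) z"
proof
  assume sing: "singular_at UNIV z"
  show "singular_at (supported_on I) z \<or> singular_at (supported_on J) z"
  proof (rule ccontr)
    assume "\<not> ?thesis"
    then have "\<not> singular_at (supported_on I) z" "\<not> singular_at (supported_on J) z" by auto
    then obtain F1 e1 F2 e2 where
      F1: "finite F1" "F1 \<subseteq> supported_on I" "0 < e1"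
        "\<not> (\<exists>x\<in>supported_on I. norm x = 1 \<and> (\<forall>g\<in>F1. cmod (cinner g x) < e1) \<and> norm (A x - scaleC z x) < e1)"
      and F2: "finite F2" "F2 \<subseteq> supported_on J" "0 < e2"
        "\<not> (\<exists>x\<in>supported_on J. norm x = 1 \<and> (\<forall>g\<in>F2. cmod (cinner g x) < e2) \<and> norm (A x - scaleC z x) < e2)"
      unfolding singular_at_def by blast
    define e where "e = min (1/2) (min (e1 / 2) (e2 / 2))"
    have e: "e > 0" "e \<le> 1 / 2" "e \<le> e1 / 2" "e \<le> e2 / 2" using F1(3) F2(3) by (auto simp: e_def)
    obtain x where x: "norm x = 1" "\<And>g. g \<in> insert (l2_basis i0) (F1 \<union> F2) \<Longrightarrow> cmod (cinner g x) < e"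
      "norm (A x - scaleC z x) < e"
      using singular_atD[OF sing, of "insert (l2_basis i0) (F1 \<union> F2)" e] F1(1) F2(1) e(1) by auto
    have "l2_restrict {i0} x = scaleC (l2_fun x i0) (l2_basis i0)"
      by (rule l2_eqI) (simp add: l2_restrict.rep_eq scaleC_l2.rep_eq l2_basis.rep_eq)
    then have "norm (l2_restrict {i0} x) < 1 / 2"
      using x(2)[of "l2_basis i0"] e(2) by (simp add: cinner_l2_basis norm_l2_basis)
    then have "(norm (l2_restrict {i0} x))\<^sup>2 < (1 / 2)\<^sup>2" by (intro power_strict_mono) auto
    then have large: "1 / 2 \<le> (norm (l2_restrict I x))\<^sup>2 + (norm (l2_restrict J x))\<^sup>2"
      using norm_split[of x] x(1) by (simp add: power2_eq_square)
    have "1 / 2 \<le> norm (l2_restrict I x) \<or> 1 / 2 \<le> norm (l2_restrict J x)"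
    proof (rule ccontr)
      assume "\<not> ?thesis"
      then have "(norm (l2_restrict I x))\<^sup>2 < (1 / 2)\<^sup>2" "(norm (l2_restrict J x))\<^sup>2 < (1 / 2)\<^sup>2"
        by (intro power_strict_mono; simp)+
      then show False using large by (simp add: power2_eq_square)
    qed
    then show False
    proof
      assume "1 / 2 \<le> norm (l2_restrict I x)"
      then have "\<exists>y\<in>supported_on I. norm y = 1 \<and> (\<forall>g\<in>F1. cmod (cinner g y) < e1) \<and> norm (A y - scaleC z y) < e1"
        using x e by (intro part_of_approximate_eigenvector[OF commute_I F1(2), of x]) fastforce+
      with F1(4) show False by (rule notE)
    next
      assume "1 / 2 \<le> norm (l2_restrict J x)"
      then have "\<exists>y\<in>supported_on J. norm y = 1 \<and> (\<forall>g\<in>F2. cmod (cinner g y) < e2) \<and> norm (A y - scaleC z y) < e2"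
        using x e by (intro part_of_approximate_eigenvector[OF commute_J F2(2), of x]) fastforce+
      with F2(4) show False by (rule notE)
    qed
  qed
qed (use singular_at_if_part in blast)

lemma tp_op_restrict:
  assumes "\<And>x. l2_restrict K (A x) = A (l2_restrict K x)"
  shows "tp_op p (l2_restrict K x) = l2_restrict K (tp_op p x)"
  by (rule tp_op_commute) (simp_all add: assms l2_restrict_add l2_restrict_scale)

lemma ac_vectors_restrict:
  assumes "\<And>x. l2_restrict K (A x) = A (l2_restrict K x)" "x \<in> ac_vectors"
  shows "l2_restrict K x \<in> ac_vectors"
  by (rule ac_vectors_le[OF assms(2)]) (simp add: tp_op_restrict[OF assms(1)] norm_l2_restrict_le)

text \<open>The component at i0 is absolutely continuous and satisfies the eigenvalue equation,
  hence it is zero.\<close>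

lemma ac_vectors_split:
  assumes "x \<in> ac_vectors"
  shows "l2_restrict I x \<in> ac_vectors \<inter> supported_on I" "l2_restrict J x \<in> ac_vectors \<inter> supported_on J"
    "x = l2_restrict I x + l2_restrict J x"
proof -
  show "l2_restrict I x \<in> ac_vectors \<inter> supported_on I" "l2_restrict J x \<in> ac_vectors \<inter> supported_on J"
    using ac_vectors_restrict[OF commute_I assms] ac_vectors_restrict[OF commute_J assms] l2_restrict_supported
    by auto
  have "l2_restrict {i0} (A y) = A (l2_restrict {i0} y)" for y
    unfolding commute_o by (rule l2_eqI) (auto simp: l2_restrict.rep_eq scaleC_l2.rep_eq eigen_o)
  then have "l2_restrict {i0} x \<in> ac_vectors" using assms by (rule ac_vectors_restrict)
  then have "l2_restrict {i0} x = 0" using commute_o by (rule ac_vectors_eigenvector)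
  then show "x = l2_restrict I x + l2_restrict J x" using split[of x] by simp
qed

lemma ac_vectors_combine:
  assumes "x \<in> ac_vectors \<inter> supported_on I" "y \<in> ac_vectors \<inter> supported_on J"
  shows "x + y \<in> ac_vectors"
proof (rule ac_vectors_add)
  show "cinner (tp_op p x) (tp_op p y) = 0" for p
    using assms disjoint reducing_tp_op[OF reducing_I] reducing_tp_op[OF reducing_J]
    by (intro cinner_disjoint[where I = I and J = J]) auto
qed (use assms in auto)

end

section \<open>Unitarity of the block operators\<close>

definition l2_lift :: "(('i \<Rightarrow> complex) \<Rightarrow> 'i \<Rightarrow> complex) \<Rightarrow> 'i l2 \<Rightarrow> 'i l2" where
  "l2_lift T x = l2_of (T (l2_fun x))"

text \<open>Lets a squared norm be computed block by block, where \<open>S_isometry\<close>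
  applies.\<close>

lemma infsum_int_pairs:
  fixes h :: "int \<Rightarrow> real"
  assumes h: "h summable_on UNIV" and p: "p = 0 \<or> p = 1"
  shows "infsum h UNIV = (\<Sum>\<^sub>\<infinity>j\<in>{j. j mod 2 = p}. h j + h (j + 1))"
proof -
  let ?E = "{j::int. j mod 2 = p}"
  have comp: "(\<lambda>j. j + 1) ` ?E = - ?E"
  proof (intro equalityI subsetI)
    fix j assume "j \<in> - ?E"
    then have "j - 1 \<in> ?E" using p by auto presburger+
    then show "j \<in> (\<lambda>j. j + 1) ` ?E" by (intro image_eqI[of _ _ "j - 1"]) auto
  next
    fix j assume "j \<in> (\<lambda>j. j + 1) ` ?E"
    then show "j \<in> - ?E" using p by auto presburger+
  qed
  have E: "h summable_on ?E" and E': "h summable_on - ?E"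
    using summable_on_subset_banach[OF h] by auto
  have inj: "inj_on (\<lambda>j::int. j + 1) ?E" by (auto simp: inj_on_def)
  have s: "(h \<circ> (\<lambda>j. j + 1)) summable_on ?E"
    using E' summable_on_reindex[OF inj, of h] by (simp add: comp)
  have "infsum h UNIV = infsum h (?E \<union> - ?E)" by simp
  also have "\<dots> = infsum h ?E + infsum h (- ?E)"
    by (rule infsum_Un_disjoint[OF E E']) auto
  also have "infsum h (- ?E) = infsum (h \<circ> (\<lambda>j. j + 1)) ?E"
    using infsum_reindex[OF inj, of h] by (simp add: comp)
  finally show ?thesis using infsum_add[OF E s] by simp
qed

lemma summable_on_int_shift:
  fixes h :: "int \<Rightarrow> real"
  assumes "h summable_on UNIV"
  shows "(\<lambda>j. h (j + d)) summable_on UNIV"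
proof -
  have "bij_betw (\<lambda>j::int. j + d) UNIV UNIV"
    by (rule bij_betw_byWitness[of _ "\<lambda>j. j - d"]) auto
  from summable_on_reindex_bij_betw[OF this, of h] show ?thesis using assms by simp
qed

text \<open>With \<open>S_snd\<close>, the two components of \<open>S_mat\<close> applied to the
  vector (x, y), the real coefficients being split off from the unimodular phases.\<close>

definition S_fst :: "(int \<Rightarrow> real) \<Rightarrow> (int \<Rightarrow> real) \<Rightarrow> (int \<Rightarrow> real) \<Rightarrow> (int \<Rightarrow> real) \<Rightarrow> (int \<Rightarrow> real) \<Rightarrow>
    int \<Rightarrow> complex \<Rightarrow> complex \<Rightarrow> complex" where
  "S_fst \<theta> \<alpha> \<gamma> t r k x y = cis (- \<theta> k) * (of_real (r k) * (cis (- \<alpha> k) * x) + of_real (t k) * (\<i> * cis (\<gamma> k) * y))"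

definition S_snd :: "(int \<Rightarrow> real) \<Rightarrow> (int \<Rightarrow> real) \<Rightarrow> (int \<Rightarrow> real) \<Rightarrow> (int \<Rightarrow> real) \<Rightarrow> (int \<Rightarrow> real) \<Rightarrow>
    int \<Rightarrow> complex \<Rightarrow> complex \<Rightarrow> complex" where
  "S_snd \<theta> \<alpha> \<gamma> t r k x y = cis (- \<theta> k) * (of_real (t k) * (\<i> * cis (- \<gamma> k) * x) + of_real (r k) * (cis (\<alpha> k) * y))"

lemma block_op_S_mat:
  "block_op p (S_mat \<theta> \<alpha> \<gamma> t r) f j =
     (if j mod 2 = p then S_fst \<theta> \<alpha> \<gamma> t r j (f j) (f (j + 1)) else S_snd \<theta> \<alpha> \<gamma> t r (j - 1) (f (j - 1)) (f j))"
  by (simp add: block_op_def S_mat_def S_fst_def S_snd_def matrix_vector_mult_def sum_2 vector_2 Let_def algebra_simps)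

lemma S_isometry:
  assumes rt: "(r k)\<^sup>2 + (t k)\<^sup>2 = 1"
  shows "(cmod (S_fst \<theta> \<alpha> \<gamma> t r k x y))\<^sup>2 + (cmod (S_snd \<theta> \<alpha> \<gamma> t r k x y))\<^sup>2 = (cmod x)\<^sup>2 + (cmod y)\<^sup>2"
proof -
  define a g R T where "a = cis (\<alpha> k)" and "g = cis (\<gamma> k)" and "R = complex_of_real (r k)" and "T = complex_of_real (t k)"
  have a: "a * cnj a = 1" and g: "g * cnj g = 1" by (simp_all add: a_def g_def cis_cnj cis_mult)
  have RT: "R * R + T * T = 1"
    using rt by (simp add: R_def T_def power2_eq_square flip: of_real_mult of_real_add)
  have i: "\<i> * \<i> = -1" by simp
  let ?u = "R * (cnj a * x) + T * (\<i> * g * y)" and ?v = "T * (\<i> * cnj g * x) + R * (a * y)"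
  have "?u * cnj ?u + ?v * cnj ?v = x * cnj x + y * cnj y"
  proof -
    have "cnj R = R" "cnj T = T" by (simp_all add: R_def T_def)
    then have "?u * cnj ?u + ?v * cnj ?v =
      (R * (cnj a * x) + T * (\<i> * g * y)) * (R * (a * cnj x) + T * (- \<i> * cnj g * cnj y)) +
      (T * (\<i> * cnj g * x) + R * (a * y)) * (T * (- \<i> * g * cnj x) + R * (cnj a * cnj y))" by simp
    also have "\<dots> = x * cnj x + y * cnj y" using a g RT i by algebra
    finally show ?thesis .
  qed
  then have "complex_of_real ((cmod ?u)\<^sup>2 + (cmod ?v)\<^sup>2) = complex_of_real ((cmod x)\<^sup>2 + (cmod y)\<^sup>2)"
    by (simp only: of_real_add complex_norm_square)
  then have "(cmod ?u)\<^sup>2 + (cmod ?v)\<^sup>2 = (cmod x)\<^sup>2 + (cmod y)\<^sup>2" by (simp only: of_real_eq_iff)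
  moreover have "cmod (S_fst \<theta> \<alpha> \<gamma> t r k x y) = cmod ?u" "cmod (S_snd \<theta> \<alpha> \<gamma> t r k x y) = cmod ?v"
    by (simp_all add: S_fst_def S_snd_def norm_mult a_def g_def R_def T_def cis_cnj)
  ultimately show ?thesis by simp
qed

text \<open>The inverse of a block is its adjoint, a matrix of the same form with \<theta>, \<alpha>
  and t negated and \<gamma> kept. The inverse of a block operator is thus again a block
  operator.\<close>

lemma S_inverse:
  fixes \<theta> \<alpha> \<gamma> t r :: "int \<Rightarrow> real" and x y :: complex
  assumes rt: "(r k)\<^sup>2 + (t k)\<^sup>2 = 1"
  defines "u \<equiv> S_fst (- \<theta>) (- \<alpha>) \<gamma> (- t) r k x y" and "v \<equiv> S_snd (- \<theta>) (- \<alpha>) \<gamma> (- t) r k x y"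
  shows "S_fst \<theta> \<alpha> \<gamma> t r k u v = x" "S_snd \<theta> \<alpha> \<gamma> t r k u v = y"
proof -
  define a g h R T where "a = cis (\<alpha> k)" and "g = cis (\<gamma> k)" and "h = cis (\<theta> k)"
    and "R = complex_of_real (r k)" and "T = complex_of_real (t k)"
  have a: "a * cnj a = 1" and g: "g * cnj g = 1" and h: "h * cnj h = 1"
    by (simp_all add: a_def g_def h_def cis_cnj cis_mult)
  have RT: "R * R + T * T = 1"
    using rt by (simp add: R_def T_def power2_eq_square flip: of_real_mult of_real_add)
  have i: "\<i> * \<i> = -1" by simp
  have uv: "u = h * (R * (a * x) + (- T) * (\<i> * g * y))" "v = h * ((- T) * (\<i> * cnj g * x) + R * (cnj a * y))"
    by (simp_all add: u_def v_def S_fst_def S_snd_def a_def g_def h_def R_def T_def cis_cnj)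
  have "S_fst \<theta> \<alpha> \<gamma> t r k u v = cnj h * (R * (cnj a * u) + T * (\<i> * g * v))"
    by (simp add: S_fst_def a_def g_def h_def R_def T_def cis_cnj)
  also have "\<dots> = x" unfolding uv using a g h RT i by algebra
  finally show "S_fst \<theta> \<alpha> \<gamma> t r k u v = x" .
  have "S_snd \<theta> \<alpha> \<gamma> t r k u v = cnj h * (T * (\<i> * cnj g * u) + R * (a * v))"
    by (simp add: S_snd_def a_def g_def h_def R_def T_def cis_cnj)
  also have "\<dots> = y" unfolding uv using a g h RT i by algebra
  finally show "S_snd \<theta> \<alpha> \<gamma> t r k u v = y" .
qed

lemma block_op_inverse:
  assumes rt: "\<And>k. (r k)\<^sup>2 + (t k)\<^sup>2 = 1" and p: "p = 0 \<or> p = 1"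
  shows "block_op p (S_mat \<theta> \<alpha> \<gamma> t r) (block_op p (S_mat (- \<theta>) (- \<alpha>) \<gamma> (- t) r) f) = f"
proof
  fix j :: int
  have 1: "(j + 1) mod 2 \<noteq> p" if "j mod 2 = p" using that by presburger
  have 2: "(j - 1) mod 2 = p" if "j mod 2 \<noteq> p" using that p by presburger
  show "block_op p (S_mat \<theta> \<alpha> \<gamma> t r) (block_op p (S_mat (- \<theta>) (- \<alpha>) \<gamma> (- t) r) f) j = f j"
    using S_inverse[where r = r and t = t, OF rt] 1 2 by (simp add: block_op_S_mat)
qed

lemma block_op_pair_isometry:
  assumes "\<And>k. (r k)\<^sup>2 + (t k)\<^sup>2 = 1" "j mod 2 = p"
  shows "(cmod (block_op p (S_mat \<theta> \<alpha> \<gamma> t r) f j))\<^sup>2 + (cmod (block_op p (S_mat \<theta> \<alpha> \<gamma> t r) f (j + 1)))\<^sup>2 =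
    (cmod (f j))\<^sup>2 + (cmod (f (j + 1)))\<^sup>2"
proof -
  have 1: "(j + 1) mod 2 \<noteq> p" using assms(2) by presburger
  then show ?thesis using S_isometry[of r j t \<theta> \<alpha> \<gamma> "f j" "f (j + 1)"] assms
    by (simp add: block_op_S_mat)
qed

lemma block_op_square_summable:
  assumes rt: "\<And>k. (r k)\<^sup>2 + (t k)\<^sup>2 = 1" and p: "p = 0 \<or> p = 1"
    and f: "(\<lambda>j. (cmod (f j))\<^sup>2) summable_on UNIV"
  shows "(\<lambda>j. (cmod (block_op p (S_mat \<theta> \<alpha> \<gamma> t r) f j))\<^sup>2) summable_on UNIV"
proof (rule summable_on_comparison_test)
  show "(\<lambda>j. (cmod (f (j + - 1)))\<^sup>2 + (cmod (f j))\<^sup>2 + (cmod (f (j + 1)))\<^sup>2) summable_on UNIV"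
    by (intro summable_on_add f summable_on_int_shift[OF f])
  fix j :: int
  let ?g = "block_op p (S_mat \<theta> \<alpha> \<gamma> t r) f"
  show "(cmod (?g j))\<^sup>2 \<le> (cmod (f (j + - 1)))\<^sup>2 + (cmod (f j))\<^sup>2 + (cmod (f (j + 1)))\<^sup>2"
  proof (cases "j mod 2 = p")
    case True
    have "(cmod (?g j))\<^sup>2 \<le> (cmod (?g j))\<^sup>2 + (cmod (?g (j + 1)))\<^sup>2" by simp
    also have "\<dots> = (cmod (f j))\<^sup>2 + (cmod (f (j + 1)))\<^sup>2" by (rule block_op_pair_isometry[OF rt True])
    finally show ?thesis using zero_le_power2[of "cmod (f (j + - 1))"] by linarith
  next
    case False
    then have 2: "(j - 1) mod 2 = p" using p by presburger
    have "(cmod (?g j))\<^sup>2 \<le> (cmod (?g (j - 1)))\<^sup>2 + (cmod (?g (j - 1 + 1)))\<^sup>2" by simp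
    also have "\<dots> = (cmod (f (j - 1)))\<^sup>2 + (cmod (f (j - 1 + 1)))\<^sup>2" by (rule block_op_pair_isometry[OF rt 2])
    finally show ?thesis by (simp add: add_increasing2)
  qed
qed simp

lemma l2_fun_lift_block:
  assumes "\<And>k. (r k)\<^sup>2 + (t k)\<^sup>2 = 1" "p = 0 \<or> p = 1"
  shows "l2_fun (l2_lift (block_op p (S_mat \<theta> \<alpha> \<gamma> t r)) x) = block_op p (S_mat \<theta> \<alpha> \<gamma> t r) (l2_fun x)"
  unfolding l2_lift_def
  by (rule l2_of_inverse) (use block_op_square_summable[OF assms l2_summable] in simp)

lemma unitary_lift_block:
  assumes rt: "\<And>k. (r k)\<^sup>2 + (t k)\<^sup>2 = 1" and p: "p = 0 \<or> p = 1"
  shows "unitary_operator (l2_lift (block_op p (S_mat \<theta> \<alpha> \<gamma> t r)))"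
proof
  let ?B = "block_op p (S_mat \<theta> \<alpha> \<gamma> t r)"
  note lf = l2_fun_lift_block[OF rt p]
  fix x y :: "int l2" and c :: complex
  show "l2_lift ?B (x + y) = l2_lift ?B x + l2_lift ?B y"
    by (rule l2_eqI) (simp add: lf plus_l2.rep_eq block_op_S_mat S_fst_def S_snd_def algebra_simps)
  show "l2_lift ?B (scaleC c x) = scaleC c (l2_lift ?B x)"
    by (rule l2_eqI) (simp add: lf scaleC_l2.rep_eq block_op_S_mat S_fst_def S_snd_def algebra_simps)
  have "(norm (l2_lift ?B x))\<^sup>2 = (norm x)\<^sup>2"
  proof -
    have "(norm (l2_lift ?B x))\<^sup>2 = (\<Sum>\<^sub>\<infinity>j\<in>{j. j mod 2 = p}.
        (cmod (l2_fun (l2_lift ?B x) j))\<^sup>2 + (cmod (l2_fun (l2_lift ?B x) (j + 1)))\<^sup>2)"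
      unfolding norm_l2_sq by (rule infsum_int_pairs[OF l2_summable p])
    also have "\<dots> = (\<Sum>\<^sub>\<infinity>j\<in>{j. j mod 2 = p}. (cmod (l2_fun x j))\<^sup>2 + (cmod (l2_fun x (j + 1)))\<^sup>2)"
      by (rule infsum_cong) (simp add: lf block_op_pair_isometry[OF rt])
    also have "\<dots> = (norm x)\<^sup>2"
      unfolding norm_l2_sq by (rule infsum_int_pairs[OF l2_summable p, symmetric])
    finally show ?thesis .
  qed
  then show "norm (l2_lift ?B x) = norm x" by (rule power2_eq_imp_eq) auto
next
  let ?B = "block_op p (S_mat \<theta> \<alpha> \<gamma> t r)" and ?C = "block_op p (S_mat (- \<theta>) (- \<alpha>) \<gamma> (- t) r)"
  have rt': "(r k)\<^sup>2 + ((- t) k)\<^sup>2 = 1" for k using rt by simp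
  show "surj (l2_lift ?B)"
  proof (rule surjI)
    show "l2_lift ?B (l2_lift ?C x) = x" for x
      by (rule l2_eqI) (simp only: l2_fun_lift_block[OF rt p] l2_fun_lift_block[OF rt' p] block_op_inverse[OF rt p])
  qed
qed

definition U_l2 where
  "U_l2 \<theta> \<alpha> \<gamma> t r = l2_lift (block_op 1 (S_mat \<theta> \<alpha> \<gamma> t r)) \<circ> l2_lift (block_op 0 (S_mat \<theta> \<alpha> \<gamma> t r))"

lemma unitary_U_l2:
  assumes "\<And>k. (r k)\<^sup>2 + (t k)\<^sup>2 = 1"
  shows "unitary_operator (U_l2 \<theta> \<alpha> \<gamma> t r)"
  unfolding U_l2_def by (intro unitary_operator_compose unitary_lift_block assms) auto

lemma l2_fun_U_l2:
  assumes "\<And>k. (r k)\<^sup>2 + (t k)\<^sup>2 = 1"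
  shows "l2_fun (U_l2 \<theta> \<alpha> \<gamma> t r x) = U_full (S_mat \<theta> \<alpha> \<gamma> t r) (l2_fun x)"
  by (simp add: U_l2_def U_full_def l2_fun_lift_block[OF assms])

section \<open>Band perturbations\<close>

lemma summable_on_finite_sum:
  fixes f :: "'i \<Rightarrow> 'k \<Rightarrow> real"
  assumes "\<And>i. i \<in> S \<Longrightarrow> f i summable_on A"
  shows "(\<lambda>k. \<Sum>i\<in>S. f i k) summable_on A \<and> infsum (\<lambda>k. \<Sum>i\<in>S. f i k) A = (\<Sum>i\<in>S. infsum (f i) A)"
  using assms
  by (induction S rule: infinite_finite_induct) (auto simp: summable_on_add infsum_add)

text \<open>Each of the two factors of U couples nearest neighbours only, so row j of U reaches at
  most from j - 2 to j + 2.\<close>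

definition neighbour_sum :: "(int \<Rightarrow> complex) \<Rightarrow> int \<Rightarrow> real" where
  "neighbour_sum f j = (\<Sum>d\<in>{-2..2}. cmod (f (j + d)))"

lemma neighbour_sum_eq:
  "neighbour_sum f j = cmod (f (j - 2)) + cmod (f (j - 1)) + cmod (f j) + cmod (f (j + 1)) + cmod (f (j + 2))"
proof -
  have "{-2..2::int} = {-2, -1, 0, 1, 2}" by auto
  then show ?thesis by (simp add: neighbour_sum_def)
qed

lemma neighbour_sum_nonneg: "0 \<le> neighbour_sum f j"
  by (simp add: neighbour_sum_def sum_nonneg)

lemma neighbour_sum_sq_le: "(neighbour_sum f j)\<^sup>2 \<le> 5 * (\<Sum>d\<in>{-2..2}. (cmod (f (j + d)))\<^sup>2)"
proof -
  have "(\<Sum>d\<in>{-2..2::int}. 1 * cmod (f (j + d)))\<^sup>2 \<le> (\<Sum>d\<in>{-2..2::int}. 1\<^sup>2) * (\<Sum>d\<in>{-2..2}. (cmod (f (j + d)))\<^sup>2)"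
    by (rule Cauchy_Schwarz_ineq_sum)
  then show ?thesis by (simp add: neighbour_sum_def)
qed

lemma sum_shift_le:
  fixes h :: "int \<Rightarrow> real"
  assumes "finite F" and "\<And>G. finite G \<Longrightarrow> sum h G \<le> B"
  shows "(\<Sum>j\<in>F. h (j + d)) \<le> B"
proof -
  have "(\<Sum>j\<in>F. h (j + d)) = sum h ((\<lambda>j. j + d) ` F)"
    by (subst sum.reindex) (auto simp: inj_on_def)
  then show ?thesis using assms by simp
qed

text \<open>Far out the rows of T are uniformly small; the finitely many rows near the origin see
  only coordinates in [-N-2, N+2], which the basis vectors in F make small.\<close>

lemma band_compact:
  fixes T :: "int l2 \<Rightarrow> int l2"
  assumes bound: "\<And>x j. cmod (l2_fun (T x) j) \<le> c j * neighbour_sum (l2_fun x) j"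
    and c: "\<And>j. 0 \<le> c j" "\<And>j. c j \<le> B"
    and lim: "\<And>\<eta>. \<eta> > 0 \<Longrightarrow> \<exists>N. \<forall>j. N < \<bar>j\<bar> \<longrightarrow> c j < \<eta>"
    and e: "(e::real) > 0"
  shows "\<exists>F d. finite F \<and> d > 0 \<and>
     (\<forall>x. norm x = 1 \<and> (\<forall>g\<in>F. cmod (cinner g x) < d) \<longrightarrow> norm (T x) < e)"
proof -
  \<comment> \<open>Five shifts and the factor 5 of Cauchy-Schwarz give 25 \<eta>^2 = e^2/4 for the
    outer rows; the choice of d gives e^2/4 for the inner ones, and e^2/2 \<le> (3 e/4)^2.\<close>
  define \<eta> where "\<eta> = e / 10"
  have \<eta>: "\<eta> > 0" using e by (simp add: \<eta>_def)
  obtain N0 where N0: "\<And>j. N0 < \<bar>j\<bar> \<Longrightarrow> c j < \<eta>" using lim[OF \<eta>] by blast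
  define N where "N = max 0 N0"
  have N: "0 \<le> N" "\<And>j. N < \<bar>j\<bar> \<Longrightarrow> c j < \<eta>" using N0 by (auto simp: N_def)
  \<comment> \<open>The number 2 N + 1 of inner rows will be bounded by its square, so that the
    inner estimate is the perfect square (5 K d)^2.\<close>
  define K where "K = max 1 B * real_of_int (2 * N + 1)"
  have K: "K \<ge> 1" unfolding K_def using N(1) mult_mono[of 1 "max 1 B" 1 "real_of_int (2 * N + 1)"] by simp
  define d where "d = e / (10 * K)"
  have d: "d > 0" using e K by (simp add: d_def)
  let ?F = "l2_basis ` {-N-2..N+2}"
  have "norm (T x) < e" if x: "norm x = 1" "\<forall>g\<in>?F. cmod (cinner g x) < d" for x
  proof -
    let ?f = "l2_fun x"
    have small: "cmod (?f k) < d" if "k \<in> {-N-2..N+2}" for k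
      using x(2) that by (auto simp: cinner_l2_basis)
    have pointwise: "(cmod (l2_fun (T x) j))\<^sup>2 \<le> (if j \<in> {-N..N} then (5 * B * d)\<^sup>2 else 0) + \<eta>\<^sup>2 * (neighbour_sum ?f j)\<^sup>2" for j
    proof (cases "j \<in> {-N..N}")
      case True
      have "neighbour_sum ?f j \<le> (\<Sum>k\<in>{-2..2::int}. d)"
        unfolding neighbour_sum_def using True by (intro sum_mono less_imp_le small) auto
      then have "c j * neighbour_sum ?f j \<le> B * (5 * d)"
        using c[of j] neighbour_sum_nonneg[of ?f j] by (intro mult_mono) auto
      then have "cmod (l2_fun (T x) j) \<le> 5 * B * d" using bound[of x j] by simp
      then have "(cmod (l2_fun (T x) j))\<^sup>2 \<le> (5 * B * d)\<^sup>2" by (intro power_mono) auto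
      then show ?thesis using True by (simp add: add_increasing2)
    next
      case False
      then have "N < \<bar>j\<bar>" by auto
      then have "c j \<le> \<eta>" using N(2)[of j] by simp
      then have "cmod (l2_fun (T x) j) \<le> \<eta> * neighbour_sum ?f j"
        using bound[of x j] mult_right_mono[OF _ neighbour_sum_nonneg, of "c j" \<eta> ?f j] by linarith
      then have "(cmod (l2_fun (T x) j))\<^sup>2 \<le> (\<eta> * neighbour_sum ?f j)\<^sup>2" by (intro power_mono) auto
      then show ?thesis by (simp only: if_not_P[OF False] power_mult_distrib add_0)
    qed
    have "norm (T x) \<le> 3 / 4 * e"
    proof (rule norm_l2_le)
      fix F :: "int set" assume F: "finite F"
      have "(\<Sum>j\<in>F. (cmod (l2_fun (T x) j))\<^sup>2) \<le>
          (\<Sum>j\<in>F. if j \<in> {-N..N} then (5 * B * d)\<^sup>2 else 0) + \<eta>\<^sup>2 * (\<Sum>j\<in>F. (neighbour_sum ?f j)\<^sup>2)"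
        unfolding sum_distrib_left sum.distrib[symmetric] by (intro sum_mono pointwise)
      also have "(\<Sum>j\<in>F. if j \<in> {-N..N} then (5 * B * d)\<^sup>2 else 0) \<le> e\<^sup>2 / 4"
      proof -
        have "(\<Sum>j\<in>F. if j \<in> {-N..N} then (5 * B * d)\<^sup>2 else 0) = (\<Sum>j\<in>F \<inter> {-N..N}. (5 * B * d)\<^sup>2)"
          by (rule sum.inter_restrict[OF F, symmetric])
        also have "\<dots> \<le> (\<Sum>j\<in>{-N..N}. (5 * B * d)\<^sup>2)" by (intro sum_mono2) auto
        also have "\<dots> = real_of_int (2 * N + 1) * (5 * B * d)\<^sup>2" using N(1) by simp
        also have "\<dots> \<le> (real_of_int (2 * N + 1))\<^sup>2 * (5 * max 1 B * d)\<^sup>2"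
        proof (rule mult_mono)
          show "real_of_int (2 * N + 1) \<le> (real_of_int (2 * N + 1))\<^sup>2"
            using N(1) mult_left_mono[of 1 "real_of_int (2 * N + 1)" "real_of_int (2 * N + 1)"] by (simp add: power2_eq_square)
          show "(5 * B * d)\<^sup>2 \<le> (5 * max 1 B * d)\<^sup>2"
            using d order_trans[OF c(1) c(2)] by (intro power_mono mult_right_mono) auto
        qed auto
        also have "\<dots> = (5 * K * d)\<^sup>2" by (simp only: K_def power_mult_distrib mult_ac)
        also have "\<dots> = e\<^sup>2 / 4" using K by (simp add: d_def power_divide)
        finally show ?thesis .
      qed
      also have "(\<Sum>j\<in>F. (neighbour_sum ?f j)\<^sup>2) \<le> 25"
      proof -
        have "(\<Sum>j\<in>F. (neighbour_sum ?f j)\<^sup>2) \<le> (\<Sum>j\<in>F. 5 * (\<Sum>d\<in>{-2..2}. (cmod (?f (j + d)))\<^sup>2))"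
          by (intro sum_mono neighbour_sum_sq_le)
        also have "\<dots> = 5 * (\<Sum>d\<in>{-2..2}. \<Sum>j\<in>F. (cmod (?f (j + d)))\<^sup>2)"
          unfolding sum_distrib_left[symmetric] by (subst sum.swap) simp
        also have "\<dots> \<le> 5 * (\<Sum>d\<in>{-2..2::int}. (norm x)\<^sup>2)"
          by (intro mult_left_mono sum_mono sum_shift_le[OF F, of "\<lambda>k. (cmod (?f k))\<^sup>2"] sum_l2_le) auto
        finally show ?thesis using x(1) by simp
      qed
      also have "e\<^sup>2 / 4 + \<eta>\<^sup>2 * 25 \<le> (3 / 4 * e)\<^sup>2"
        by (simp add: \<eta>_def power2_eq_square)
      finally show "(\<Sum>j\<in>F. (cmod (l2_fun (T x) j))\<^sup>2) \<le> (3 / 4 * e)\<^sup>2" by (simp add: mult_left_mono)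
    qed (use e in auto)
    then show ?thesis using e by simp
  qed
  then show ?thesis using d by (intro exI[of _ ?F] exI[of _ d]) auto
qed

text \<open>The weight \<open>w\<^sub>k\<close> of the form collects the coefficients of all rows that involve \<open>x\<^sub>k\<close>.\<close>

lemma band_trace_class:
  assumes UV: "unitary_pair U V"
    and bound: "\<And>x j. cmod (l2_fun (U x - V x) j) \<le> c j * neighbour_sum (l2_fun x) j"
    and c: "\<And>j. 0 \<le> c j" "c summable_on UNIV"
  shows "\<exists>\<alpha> D. trace_class_perturbation U V \<alpha> D"
proof -
  interpret unitary_pair U V by (rule UV)
  \<comment> \<open>The factor 5 is the one in \<open>neighbour_sum_sq_le\<close>.\<close>
  define w where "w k = 5 * (\<Sum>d\<in>{-2..2}. c (k - d))" for k
  have w0: "0 \<le> w k" for k by (simp add: w_def sum_nonneg c(1))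
  have cw: "c k \<le> w k" for k
  proof -
    have "c (k - 0) \<le> (\<Sum>d\<in>{-2..2}. c (k - d))"
      by (rule member_le_sum) (auto simp: c(1))
    also have "\<dots> \<le> w k" by (simp add: w_def sum_nonneg c(1))
    finally show ?thesis by simp
  qed
  have w_sum: "w summable_on UNIV"
    unfolding w_def[abs_def]
    using summable_on_int_shift[OF c(2), of "- d" for d]
    by (intro summable_on_cmult_right conjunct1[OF summable_on_finite_sum]) simp
  define \<alpha> where "\<alpha> x = (\<Sum>\<^sub>\<infinity>k. w k * (cmod (l2_fun x k))\<^sup>2)" for x
  define D where "D = infsum w UNIV"
  have \<alpha>_sum: "(\<lambda>k. w k * (cmod (l2_fun x k))\<^sup>2) summable_on UNIV" for x
  proof (rule summable_on_comparison_test)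
    show "(\<lambda>k. w k * (norm x)\<^sup>2) summable_on UNIV" by (intro summable_on_cmult_left w_sum)
    show "w k * (cmod (l2_fun x k))\<^sup>2 \<le> w k * (norm x)\<^sup>2" for k
      by (intro mult_left_mono power_mono l2_coord_le w0) auto
  qed (simp add: w0)
  have \<alpha>_ge: "(\<Sum>k\<in>F. w k * (cmod (l2_fun x k))\<^sup>2) \<le> \<alpha> x" if "finite F" for F x
    unfolding \<alpha>_def by (rule finite_sum_le_infsum[OF \<alpha>_sum that]) (auto simp: w0)
  have "trace_class_perturbation U V \<alpha> D"
  proof unfold_locales
    show "0 \<le> \<alpha> x" for x unfolding \<alpha>_def by (intro infsum_nonneg) (simp add: w0)
  next
    fix x y :: "int l2"
    let ?T = "l2_fun (U y - V y)" and ?x = "l2_fun x" and ?y = "l2_fun y"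
    have fin: "(\<Sum>j\<in>F. cmod (cnj (?x j) * ?T j)) \<le> sqrt (\<alpha> x) * sqrt (\<alpha> y)" if F: "finite F" for F :: "int set"
    proof -
      \<comment> \<open>Half of the coefficient \<open>c j\<close>, as a square root, goes to each
        factor before Cauchy-Schwarz.\<close>
      have "(\<Sum>j\<in>F. cmod (cnj (?x j) * ?T j)) \<le>
          (\<Sum>j\<in>F. sqrt (c j * (cmod (?x j))\<^sup>2) * sqrt (c j * (neighbour_sum ?y j)\<^sup>2))"
      proof (rule sum_mono)
        fix j
        have "cmod (cnj (?x j) * ?T j) \<le> cmod (?x j) * (c j * neighbour_sum ?y j)"
          unfolding norm_mult by (simp add: mult_left_mono bound)
        also have "\<dots> = (sqrt (c j) * sqrt (c j)) * (cmod (?x j) * neighbour_sum ?y j)"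
          by (simp add: c(1))
        also have "\<dots> = sqrt (c j * (cmod (?x j))\<^sup>2) * sqrt (c j * (neighbour_sum ?y j)\<^sup>2)"
          by (simp only: real_sqrt_mult real_sqrt_abs abs_norm_cancel abs_of_nonneg[OF neighbour_sum_nonneg] mult_ac)
        finally show "cmod (cnj (?x j) * ?T j) \<le> sqrt (c j * (cmod (?x j))\<^sup>2) * sqrt (c j * (neighbour_sum ?y j)\<^sup>2)" .
      qed
      also have "\<dots> \<le> sqrt (\<alpha> x) * sqrt (\<alpha> y)"
      proof (rule sum_mult_sqrt_le)
        have "(\<Sum>j\<in>F. c j * (cmod (?x j))\<^sup>2) \<le> (\<Sum>j\<in>F. w j * (cmod (?x j))\<^sup>2)"
          by (intro sum_mono mult_right_mono cw) auto
        also have "\<dots> \<le> \<alpha> x" by (rule \<alpha>_ge[OF F])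
        finally show "(\<Sum>j\<in>F. c j * (cmod (?x j))\<^sup>2) \<le> \<alpha> x" .
        define G where "G = (\<Union>d\<in>{-2..2}. (\<lambda>j. j + d) ` F)"
        have G: "finite G" unfolding G_def using F by auto
        have "(\<Sum>j\<in>F. c j * (neighbour_sum ?y j)\<^sup>2) \<le> (\<Sum>j\<in>F. c j * (5 * (\<Sum>d\<in>{-2..2}. (cmod (?y (j + d)))\<^sup>2)))"
          by (intro sum_mono mult_left_mono neighbour_sum_sq_le c(1))
        also have "\<dots> = 5 * (\<Sum>d\<in>{-2..2}. \<Sum>j\<in>F. c (j + d - d) * (cmod (?y (j + d)))\<^sup>2)"
          by (subst sum.swap) (simp add: sum_distrib_left mult_ac)
        also have "\<dots> \<le> 5 * (\<Sum>d\<in>{-2..2}. \<Sum>k\<in>G. c (k - d) * (cmod (?y k))\<^sup>2)"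
        proof (intro mult_left_mono sum_mono)
          fix d :: int assume d: "d \<in> {-2..2}"
          have "(\<Sum>j\<in>F. c (j + d - d) * (cmod (?y (j + d)))\<^sup>2) = (\<Sum>k\<in>(\<lambda>j. j + d) ` F. c (k - d) * (cmod (?y k))\<^sup>2)"
            by (subst sum.reindex) (auto simp: inj_on_def)
          also have "\<dots> \<le> (\<Sum>k\<in>G. c (k - d) * (cmod (?y k))\<^sup>2)"
            using d by (intro sum_mono2[OF G]) (auto simp: G_def c(1))
          finally show "(\<Sum>j\<in>F. c (j + d - d) * (cmod (?y (j + d)))\<^sup>2) \<le> (\<Sum>k\<in>G. c (k - d) * (cmod (?y k))\<^sup>2)" .
        qed simp
        also have "\<dots> = (\<Sum>k\<in>G. w k * (cmod (?y k))\<^sup>2)"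
          by (subst sum.swap) (simp add: w_def sum_distrib_left sum_distrib_right mult_ac)
        also have "\<dots> \<le> \<alpha> y" by (rule \<alpha>_ge[OF G])
        finally show "(\<Sum>j\<in>F. c j * (neighbour_sum ?y j)\<^sup>2) \<le> \<alpha> y" .
      qed (auto simp: c(1))
      finally show ?thesis .
    qed
    have abs: "(\<lambda>j. cmod (cnj (?x j) * ?T j)) summable_on UNIV"
      by (rule square_summable_inner[OF l2_summable l2_summable])
    have "cmod (cinner x (U y - V y)) \<le> (\<Sum>\<^sub>\<infinity>j. cmod (cnj (?x j) * ?T j))"
      unfolding cinner_l2 ell2_inner_def by (rule norm_infsum_bound[OF abs])
    also have "\<dots> \<le> sqrt (\<alpha> x) * sqrt (\<alpha> y)"
      by (rule infsum_le_finite_sums[OF abs]) (rule fin)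
    finally show "cmod (cinner x (U y - V y)) \<le> sqrt (\<alpha> x) * sqrt (\<alpha> y)" .
  next
    fix u :: "nat \<Rightarrow> int l2" and N :: nat and C :: real
    assume u: "\<And>y. (\<Sum>n<N. (cmod (cinner y (u n)))\<^sup>2) \<le> C * (norm y)\<^sup>2"
    have "(\<Sum>n<N. \<alpha> (u n)) = (\<Sum>\<^sub>\<infinity>k. \<Sum>n<N. w k * (cmod (l2_fun (u n) k))\<^sup>2)"
      unfolding \<alpha>_def by (rule conjunct2[OF summable_on_finite_sum, symmetric]) (rule \<alpha>_sum)
    also have "\<dots> \<le> (\<Sum>\<^sub>\<infinity>k. C * w k)"
    proof (rule infsum_mono)
      show "(\<lambda>k. \<Sum>n<N. w k * (cmod (l2_fun (u n) k))\<^sup>2) summable_on UNIV"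
        by (rule conjunct1[OF summable_on_finite_sum]) (rule \<alpha>_sum)
      show "(\<lambda>k. C * w k) summable_on UNIV" by (intro summable_on_cmult_right w_sum)
      fix k
      \<comment> \<open>With the sum over n inside, the orbit bound is used on each unit vector
        \<open>l2_basis k\<close>, and the weights sum to D.\<close>
      have "(\<Sum>n<N. w k * (cmod (l2_fun (u n) k))\<^sup>2) = w k * (\<Sum>n<N. (cmod (cinner (l2_basis k) (u n)))\<^sup>2)"
        by (simp add: sum_distrib_left cinner_l2_basis)
      also have "\<dots> \<le> w k * (C * (norm (l2_basis k))\<^sup>2)" by (intro mult_left_mono u w0)
      finally show "(\<Sum>n<N. w k * (cmod (l2_fun (u n) k))\<^sup>2) \<le> C * w k" by (simp add: norm_l2_basis mult.commute)
    qed
    also have "\<dots> = C * D" unfolding D_def by (rule infsum_cmult_right) (rule w_sum)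
    finally show "(\<Sum>n<N. \<alpha> (u n)) \<le> C * D" .
  qed
  then show ?thesis by blast
qed

section \<open>Matrix entries of U and their differences\<close>

lemma four_term_bound:
  assumes "\<bar>a1\<bar> \<le> c" "\<bar>a2\<bar> \<le> c" "\<bar>a3\<bar> \<le> c" "\<bar>a4\<bar> \<le> c"
    and "cmod E1 = 1" "cmod E2 = 1" "cmod E3 = 1" "cmod E4 = 1"
  shows "cmod (of_real a1 * (E1 * x1) + of_real a2 * (E2 * x2) + of_real a3 * (E3 * x3) + of_real a4 * (E4 * x4))
     \<le> c * (cmod x1 + cmod x2 + cmod x3 + cmod x4)"
proof -
  have "cmod (of_real a * (E * x)) \<le> c * cmod x" if "\<bar>a\<bar> \<le> c" "cmod E = 1" for a E x
    using that by (simp add: norm_mult mult_right_mono)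
  note b = this[OF assms(1,5)] this[OF assms(2,6)] this[OF assms(3,7)] this[OF assms(4,8)]
  have "cmod (of_real a1 * (E1 * x1) + of_real a2 * (E2 * x2) + of_real a3 * (E3 * x3) + of_real a4 * (E4 * x4))
    \<le> cmod (of_real a1 * (E1 * x1)) + cmod (of_real a2 * (E2 * x2)) + cmod (of_real a3 * (E3 * x3)) + cmod (of_real a4 * (E4 * x4))"
    by (intro order_trans[OF norm_triangle_ineq] add_right_mono order_refl)
  also have "\<dots> \<le> c * cmod x1 + c * cmod x2 + c * cmod x3 + c * cmod x4" by (intro add_mono b)
  finally show ?thesis by (simp add: algebra_simps)
qed

text \<open>The phases E are fixed before t, r and f, so two operators with the same phases differ
  only in the products of adjacent coefficients.\<close>

lemma U_full_odd:
  fixes \<theta> \<alpha> \<gamma> :: "int \<Rightarrow> real"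
  assumes j: "j mod 2 = 1"
  obtains E1 E2 E3 E4 where "cmod E1 = 1" "cmod E2 = 1" "cmod E3 = 1" "cmod E4 = 1"
    "\<And>t r f. U_full (S_mat \<theta> \<alpha> \<gamma> t r) f j =
       of_real (r j * t (j - 1)) * (E1 * f (j - 1)) + of_real (r j * r (j - 1)) * (E2 * f j) +
       of_real (t j * r (j + 1)) * (E3 * f (j + 1)) + of_real (t j * t (j + 1)) * (E4 * f (j + 2))"
proof
  have m: "(j + 1) mod 2 = 0" using j by presburger
  show "U_full (S_mat \<theta> \<alpha> \<gamma> t r) f j =
       of_real (r j * t (j - 1)) * ((cis (- \<theta> j) * cis (- \<alpha> j) * cis (- \<theta> (j - 1)) * (\<i> * cis (- \<gamma> (j - 1)))) * f (j - 1)) +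
       of_real (r j * r (j - 1)) * ((cis (- \<theta> j) * cis (- \<alpha> j) * cis (- \<theta> (j - 1)) * cis (\<alpha> (j - 1))) * f j) +
       of_real (t j * r (j + 1)) * ((cis (- \<theta> j) * (\<i> * cis (\<gamma> j)) * cis (- \<theta> (j + 1)) * cis (- \<alpha> (j + 1))) * f (j + 1)) +
       of_real (t j * t (j + 1)) * ((cis (- \<theta> j) * (\<i> * cis (\<gamma> j)) * cis (- \<theta> (j + 1)) * (\<i> * cis (\<gamma> (j + 1)))) * f (j + 2))"
    for t r f
    using j m by (simp add: U_full_def block_op_S_mat S_fst_def S_snd_def algebra_simps)
qed (simp_all add: norm_mult)

lemma U_full_even:
  fixes \<theta> \<alpha> \<gamma> :: "int \<Rightarrow> real"
  assumes j: "j mod 2 = 0"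
  obtains E1 E2 E3 E4 where "cmod E1 = 1" "cmod E2 = 1" "cmod E3 = 1" "cmod E4 = 1"
    "\<And>t r f. U_full (S_mat \<theta> \<alpha> \<gamma> t r) f j =
       of_real (t (j - 1) * t (j - 2)) * (E1 * f (j - 2)) + of_real (t (j - 1) * r (j - 2)) * (E2 * f (j - 1)) +
       of_real (r (j - 1) * r j) * (E3 * f j) + of_real (r (j - 1) * t j) * (E4 * f (j + 1))"
proof
  have m: "(j - 1) mod 2 \<noteq> 0" "j mod 2 \<noteq> 1" using j by presburger+
  show "U_full (S_mat \<theta> \<alpha> \<gamma> t r) f j =
       of_real (t (j - 1) * t (j - 2)) * ((cis (- \<theta> (j - 1)) * (\<i> * cis (- \<gamma> (j - 1))) * cis (- \<theta> (j - 2)) * (\<i> * cis (- \<gamma> (j - 2)))) * f (j - 2)) +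
       of_real (t (j - 1) * r (j - 2)) * ((cis (- \<theta> (j - 1)) * (\<i> * cis (- \<gamma> (j - 1))) * cis (- \<theta> (j - 2)) * cis (\<alpha> (j - 2))) * f (j - 1)) +
       of_real (r (j - 1) * r j) * ((cis (- \<theta> (j - 1)) * cis (\<alpha> (j - 1)) * cis (- \<theta> j) * cis (- \<alpha> j)) * f j) +
       of_real (r (j - 1) * t j) * ((cis (- \<theta> (j - 1)) * cis (\<alpha> (j - 1)) * cis (- \<theta> j) * (\<i> * cis (\<gamma> j))) * f (j + 1))"
    for t r f
    using j m by (simp add: U_full_def block_op_S_mat S_fst_def S_snd_def algebra_simps)
qed (simp_all add: norm_mult)

text \<open>The four differences inside \<open>delta_plus\<close>, with the products of the limits
  replaced by those of the comparison coefficients and the maximum by a sum. The coefficient of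
  every entry of U is one of these products at a suitable index.\<close>

definition coeff_gap :: "(int \<Rightarrow> real) \<Rightarrow> (int \<Rightarrow> real) \<Rightarrow> (int \<Rightarrow> real) \<Rightarrow> (int \<Rightarrow> real) \<Rightarrow> int \<Rightarrow> real" where
  "coeff_gap t r t' r' k = \<bar>r k * r (k - 1) - r' k * r' (k - 1)\<bar> + \<bar>t k * t (k - 1) - t' k * t' (k - 1)\<bar> +
     \<bar>t k * r (k + 1) - t' k * r' (k + 1)\<bar> + \<bar>t k * r (k - 1) - t' k * r' (k - 1)\<bar>"

lemma coeff_gap_nonneg: "0 \<le> coeff_gap t r t' r' k"
  by (simp add: coeff_gap_def)

lemma coeff_gap_ge:
  "\<bar>r k * r (k - 1) - r' k * r' (k - 1)\<bar> \<le> coeff_gap t r t' r' k"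
  "\<bar>t k * t (k - 1) - t' k * t' (k - 1)\<bar> \<le> coeff_gap t r t' r' k"
  "\<bar>t k * r (k + 1) - t' k * r' (k + 1)\<bar> \<le> coeff_gap t r t' r' k"
  "\<bar>t k * r (k - 1) - t' k * r' (k - 1)\<bar> \<le> coeff_gap t r t' r' k"
  by (simp_all add: coeff_gap_def)

text \<open>The rows with |j| < 4 include all those reached by the altered blocks at -1 and 0, where
  the phases differ too; there 2 stands for the bound 1 on each of the two operators.\<close>

definition row_gap :: "(int \<Rightarrow> real) \<Rightarrow> (int \<Rightarrow> real) \<Rightarrow> (int \<Rightarrow> real) \<Rightarrow> (int \<Rightarrow> real) \<Rightarrow> int \<Rightarrow> real" where
  "row_gap t r t' r' j = (if \<bar>j\<bar> < 4 then 2
     else coeff_gap t r t' r' (j - 1) + coeff_gap t r t' r' j + coeff_gap t r t' r' (j + 1))"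

lemma row_gap_nonneg: "0 \<le> row_gap t r t' r' j"
  by (simp add: row_gap_def coeff_gap_nonneg)

text \<open>The products in row j are based at j - 1, j or j + 1: in an odd row, r_j t_{j-1} is the
  third product of \<open>coeff_gap\<close> at j - 1, and t_j t_{j+1} the second at j + 1.\<close>

lemma U_full_diff_same_phases:
  fixes \<theta> \<alpha> \<gamma> t r t' r' :: "int \<Rightarrow> real"
  assumes c: "\<And>k. k \<in> {j - 1, j, j + 1} \<Longrightarrow> coeff_gap t r t' r' k \<le> c"
  shows "cmod (U_full (S_mat \<theta> \<alpha> \<gamma> t r) f j - U_full (S_mat \<theta> \<alpha> \<gamma> t' r') f j) \<le> c * neighbour_sum f j"
proof -
  have c0: "0 \<le> c" using c[of j] coeff_gap_nonneg[of t r t' r' j] by simp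
  note ge = coeff_gap_ge[where t = t and r = r and t' = t' and r' = r']
  show ?thesis
  proof (cases "j mod 2 = 1")
    case True
    obtain E1 E2 E3 E4 where E: "cmod E1 = 1" "cmod E2 = 1" "cmod E3 = 1" "cmod E4 = 1"
      and eq: "\<And>t r f. U_full (S_mat \<theta> \<alpha> \<gamma> t r) f j =
       of_real (r j * t (j - 1)) * (E1 * f (j - 1)) + of_real (r j * r (j - 1)) * (E2 * f j) +
       of_real (t j * r (j + 1)) * (E3 * f (j + 1)) + of_real (t j * t (j + 1)) * (E4 * f (j + 2))"
      by (rule U_full_odd[OF True, where \<theta> = \<theta> and \<alpha> = \<alpha> and \<gamma> = \<gamma>]) (rule that)
    have diff: "U_full (S_mat \<theta> \<alpha> \<gamma> t r) f j - U_full (S_mat \<theta> \<alpha> \<gamma> t' r') f j =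
      of_real (r j * t (j - 1) - r' j * t' (j - 1)) * (E1 * f (j - 1)) + of_real (r j * r (j - 1) - r' j * r' (j - 1)) * (E2 * f j) +
       of_real (t j * r (j + 1) - t' j * r' (j + 1)) * (E3 * f (j + 1)) + of_real (t j * t (j + 1) - t' j * t' (j + 1)) * (E4 * f (j + 2))"
      unfolding eq of_real_diff by (simp only: left_diff_distrib) simp
    have "cmod (U_full (S_mat \<theta> \<alpha> \<gamma> t r) f j - U_full (S_mat \<theta> \<alpha> \<gamma> t' r') f j) \<le> c * (cmod (f (j - 1)) + cmod (f j) + cmod (f (j + 1)) + cmod (f (j + 2)))"
      unfolding diff
    proof (rule four_term_bound[OF _ _ _ _ E])
      show "\<bar>r j * t (j - 1) - r' j * t' (j - 1)\<bar> \<le> c"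
        using order_trans[OF ge(3)[of "j - 1"] c[of "j - 1"]] by (simp add: mult.commute)
      show "\<bar>r j * r (j - 1) - r' j * r' (j - 1)\<bar> \<le> c" using order_trans[OF ge(1)[of j] c[of j]] by simp
      show "\<bar>t j * r (j + 1) - t' j * r' (j + 1)\<bar> \<le> c" using order_trans[OF ge(3)[of j] c[of j]] by simp
      show "\<bar>t j * t (j + 1) - t' j * t' (j + 1)\<bar> \<le> c"
        using order_trans[OF ge(2)[of "j + 1"] c[of "j + 1"]] by (simp add: mult.commute)
    qed
    also have "\<dots> \<le> c * neighbour_sum f j" unfolding neighbour_sum_eq by (intro mult_left_mono c0) simp
    finally show ?thesis .
  next
    case False
    then have even: "j mod 2 = 0" by presburger
    obtain E1 E2 E3 E4 where E: "cmod E1 = 1" "cmod E2 = 1" "cmod E3 = 1" "cmod E4 = 1"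
      and eq: "\<And>t r f. U_full (S_mat \<theta> \<alpha> \<gamma> t r) f j =
       of_real (t (j - 1) * t (j - 2)) * (E1 * f (j - 2)) + of_real (t (j - 1) * r (j - 2)) * (E2 * f (j - 1)) +
       of_real (r (j - 1) * r j) * (E3 * f j) + of_real (r (j - 1) * t j) * (E4 * f (j + 1))"
      by (rule U_full_even[OF even, where \<theta> = \<theta> and \<alpha> = \<alpha> and \<gamma> = \<gamma>]) (rule that)
    have diff: "U_full (S_mat \<theta> \<alpha> \<gamma> t r) f j - U_full (S_mat \<theta> \<alpha> \<gamma> t' r') f j =
       of_real (t (j - 1) * t (j - 2) - t' (j - 1) * t' (j - 2)) * (E1 * f (j - 2)) +
       of_real (t (j - 1) * r (j - 2) - t' (j - 1) * r' (j - 2)) * (E2 * f (j - 1)) +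
       of_real (r (j - 1) * r j - r' (j - 1) * r' j) * (E3 * f j) +
       of_real (r (j - 1) * t j - r' (j - 1) * t' j) * (E4 * f (j + 1))"
      unfolding eq of_real_diff by (simp only: left_diff_distrib) simp
    have "cmod (U_full (S_mat \<theta> \<alpha> \<gamma> t r) f j - U_full (S_mat \<theta> \<alpha> \<gamma> t' r') f j) \<le> c * (cmod (f (j - 2)) + cmod (f (j - 1)) + cmod (f j) + cmod (f (j + 1)))"
      unfolding diff
    proof (rule four_term_bound[OF _ _ _ _ E])
      show "\<bar>t (j - 1) * t (j - 2) - t' (j - 1) * t' (j - 2)\<bar> \<le> c"
        using order_trans[OF ge(2)[of "j - 1"] c[of "j - 1"]] by simp
      show "\<bar>t (j - 1) * r (j - 2) - t' (j - 1) * r' (j - 2)\<bar> \<le> c"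
        using order_trans[OF ge(4)[of "j - 1"] c[of "j - 1"]] by simp
      show "\<bar>r (j - 1) * r j - r' (j - 1) * r' j\<bar> \<le> c"
        using order_trans[OF ge(1)[of j] c[of j]] by (simp add: mult.commute)
      show "\<bar>r (j - 1) * t j - r' (j - 1) * t' j\<bar> \<le> c"
        using order_trans[OF ge(4)[of j] c[of j]] by (simp add: mult.commute)
    qed
    also have "\<dots> \<le> c * neighbour_sum f j" unfolding neighbour_sum_eq by (intro mult_left_mono c0) simp
    finally show ?thesis .
  qed
qed

lemma U_full_bound:
  fixes \<theta> \<alpha> \<gamma> t r :: "int \<Rightarrow> real"
  assumes rt: "\<And>k. (r k)\<^sup>2 + (t k)\<^sup>2 = 1"
  shows "cmod (U_full (S_mat \<theta> \<alpha> \<gamma> t r) f j) \<le> neighbour_sum f j"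
proof -
  have "(r k)\<^sup>2 \<le> 1" "(t k)\<^sup>2 \<le> 1" for k
    using rt[of k] zero_le_power2[of "r k"] zero_le_power2[of "t k"] by linarith+
  then have "\<bar>r k\<bar> \<le> 1" "\<bar>t k\<bar> \<le> 1" for k
    by (simp_all add: abs_square_le_1)
  then have p: "\<bar>r k * r l\<bar> \<le> 1" "\<bar>r k * t l\<bar> \<le> 1" "\<bar>t k * r l\<bar> \<le> 1" "\<bar>t k * t l\<bar> \<le> 1" for k l
    by (simp_all add: abs_mult mult_le_one)
  show ?thesis
  proof (cases "j mod 2 = 1")
    case True
    obtain E1 E2 E3 E4 where E: "cmod E1 = 1" "cmod E2 = 1" "cmod E3 = 1" "cmod E4 = 1"
      and eq: "\<And>t r f. U_full (S_mat \<theta> \<alpha> \<gamma> t r) f j =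
       of_real (r j * t (j - 1)) * (E1 * f (j - 1)) + of_real (r j * r (j - 1)) * (E2 * f j) +
       of_real (t j * r (j + 1)) * (E3 * f (j + 1)) + of_real (t j * t (j + 1)) * (E4 * f (j + 2))"
      by (rule U_full_odd[OF True, where \<theta> = \<theta> and \<alpha> = \<alpha> and \<gamma> = \<gamma>]) (rule that)
    have "cmod (U_full (S_mat \<theta> \<alpha> \<gamma> t r) f j) \<le> 1 * (cmod (f (j - 1)) + cmod (f j) + cmod (f (j + 1)) + cmod (f (j + 2)))"
      unfolding eq by (rule four_term_bound[OF p(2) p(1) p(3) p(4) E])
    also have "\<dots> \<le> neighbour_sum f j" unfolding neighbour_sum_eq by simp
    finally show ?thesis .
  next
    case False
    then have even: "j mod 2 = 0" by presburger
    obtain E1 E2 E3 E4 where E: "cmod E1 = 1" "cmod E2 = 1" "cmod E3 = 1" "cmod E4 = 1"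
      and eq: "\<And>t r f. U_full (S_mat \<theta> \<alpha> \<gamma> t r) f j =
       of_real (t (j - 1) * t (j - 2)) * (E1 * f (j - 2)) + of_real (t (j - 1) * r (j - 2)) * (E2 * f (j - 1)) +
       of_real (r (j - 1) * r j) * (E3 * f j) + of_real (r (j - 1) * t j) * (E4 * f (j + 1))"
      by (rule U_full_even[OF even, where \<theta> = \<theta> and \<alpha> = \<alpha> and \<gamma> = \<gamma>]) (rule that)
    have "cmod (U_full (S_mat \<theta> \<alpha> \<gamma> t r) f j) \<le> 1 * (cmod (f (j - 2)) + cmod (f (j - 1)) + cmod (f j) + cmod (f (j + 1)))"
      unfolding eq by (rule four_term_bound[OF p(4) p(3) p(1) p(2) E])
    also have "\<dots> \<le> neighbour_sum f j" unfolding neighbour_sum_eq by simp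
    finally show ?thesis .
  qed
qed

lemma S_cong:
  "\<alpha> k = \<alpha>' k \<Longrightarrow> t k = t' k \<Longrightarrow> r k = r' k \<Longrightarrow> S_fst \<theta> \<alpha> \<gamma> t r k = S_fst \<theta> \<alpha>' \<gamma> t' r' k"
  "\<alpha> k = \<alpha>' k \<Longrightarrow> t k = t' k \<Longrightarrow> r k = r' k \<Longrightarrow> S_snd \<theta> \<alpha> \<gamma> t r k = S_snd \<theta> \<alpha>' \<gamma> t' r' k"
  by (simp_all add: S_fst_def S_snd_def fun_eq_iff)

lemma U_full_diff:
  fixes \<theta> \<alpha> \<alpha>' \<gamma> t r t' r' :: "int \<Rightarrow> real"
  assumes rt: "\<And>k. (r k)\<^sup>2 + (t k)\<^sup>2 = 1" and rt': "\<And>k. (r' k)\<^sup>2 + (t' k)\<^sup>2 = 1"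
    and \<alpha>: "\<And>k. k \<noteq> 0 \<Longrightarrow> k \<noteq> -1 \<Longrightarrow> \<alpha>' k = \<alpha> k"
  shows "cmod (U_full (S_mat \<theta> \<alpha> \<gamma> t r) f j - U_full (S_mat \<theta> \<alpha>' \<gamma> t' r') f j)
    \<le> row_gap t r t' r' j * neighbour_sum f j"
proof (cases "\<bar>j\<bar> < 4")
  case True
  have "cmod (U_full (S_mat \<theta> \<alpha> \<gamma> t r) f j - U_full (S_mat \<theta> \<alpha>' \<gamma> t' r') f j) \<le> neighbour_sum f j + neighbour_sum f j"
    by (intro order_trans[OF norm_triangle_ineq4] add_mono U_full_bound rt rt')
  then show ?thesis using True by (simp add: row_gap_def)
next
  case False
  have "\<alpha>' (j - 2) = \<alpha> (j - 2)" "\<alpha>' (j - 1) = \<alpha> (j - 1)" "\<alpha>' j = \<alpha> j" "\<alpha>' (j + 1) = \<alpha> (j + 1)"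
    using False by (auto intro!: \<alpha>)
  then have "U_full (S_mat \<theta> \<alpha>' \<gamma> t' r') f j = U_full (S_mat \<theta> \<alpha> \<gamma> t' r') f j"
    by (simp add: U_full_def block_op_S_mat S_cong[of \<alpha>' _ \<alpha>])
  moreover have "cmod (U_full (S_mat \<theta> \<alpha> \<gamma> t r) f j - U_full (S_mat \<theta> \<alpha> \<gamma> t' r') f j)
    \<le> row_gap t r t' r' j * neighbour_sum f j"
    using False coeff_gap_nonneg[of t r t' r' "j - 1"] coeff_gap_nonneg[of t r t' r' j] coeff_gap_nonneg[of t r t' r' "j + 1"]
    by (intro U_full_diff_same_phases) (auto simp: row_gap_def)
  ultimately show ?thesis by simp
qed

section \<open>The operators \<open>U\<close> and \<open>U\<^sup>+ \<oplus> U\<^sup>-\<close>\<close>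

lemma filterlim_int_shift: "filterlim (\<lambda>k::int. k + d) at_top at_top" "filterlim (\<lambda>k::int. k + d) at_bot at_bot"
proof -
  show "filterlim (\<lambda>k::int. k + d) at_top at_top"
    unfolding filterlim_at_top
  proof
    fix Z :: int
    show "\<forall>\<^sub>F k in at_top. Z \<le> k + d" using eventually_ge_at_top[of "Z - d"] by eventually_elim simp
  qed
  show "filterlim (\<lambda>k::int. k + d) at_bot at_bot"
    unfolding filterlim_at_bot
  proof
    fix Z :: int
    show "\<forall>\<^sub>F k in at_bot. k + d \<le> Z" using eventually_le_at_bot[of "Z - d"] by eventually_elim simp
  qed
qed

lemma coeff_gap_tendsto:
  fixes t r t' r' :: "int \<Rightarrow> real"
  assumes shift: "\<And>d. filterlim (\<lambda>k::int. k + d) F F"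
    and "(t \<longlongrightarrow> a) F" "(r \<longlongrightarrow> b) F" "(t' \<longlongrightarrow> a) F" "(r' \<longlongrightarrow> b) F"
  shows "(coeff_gap t r t' r' \<longlongrightarrow> 0) F"
proof -
  have s: "((\<lambda>k. f (k + d)) \<longlongrightarrow> l) F" if "(f \<longlongrightarrow> l) F" for f :: "int \<Rightarrow> real" and l d
    by (rule filterlim_compose[OF that shift])
  have p: "((\<lambda>k. f k * g (k + d)) \<longlongrightarrow> l * m) F" if "(f \<longlongrightarrow> l) F" "(g \<longlongrightarrow> m) F" for f g :: "int \<Rightarrow> real" and l m d
    by (intro tendsto_mult that s)
  have "(coeff_gap t r t' r' \<longlongrightarrow> \<bar>b * b - b * b\<bar> + \<bar>a * a - a * a\<bar> + \<bar>a * b - a * b\<bar> + \<bar>a * b - a * b\<bar>) F"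
    unfolding coeff_gap_def[abs_def]
    using p[of _ _ _ _ "-1"] p[of _ _ _ _ 1] assms
    by (intro tendsto_add tendsto_rabs tendsto_diff) auto
  then show ?thesis by simp
qed

lemma row_gap_small:
  assumes "(coeff_gap t r t' r' \<longlongrightarrow> 0) at_top" "(coeff_gap t r t' r' \<longlongrightarrow> 0) at_bot" "\<eta> > 0"
  shows "\<exists>N. \<forall>j. N < \<bar>j\<bar> \<longrightarrow> row_gap t r t' r' j < \<eta>"
proof -
  have "\<forall>\<^sub>F k in at_top. coeff_gap t r t' r' k < \<eta> / 3" "\<forall>\<^sub>F k in at_bot. coeff_gap t r t' r' k < \<eta> / 3"
    using order_tendstoD(2)[OF assms(1), of "\<eta> / 3"] order_tendstoD(2)[OF assms(2), of "\<eta> / 3"] assms(3) by simp_all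
  then obtain A B where A: "\<And>k. k \<ge> A \<Longrightarrow> coeff_gap t r t' r' k < \<eta> / 3" and B: "\<And>k. k \<le> B \<Longrightarrow> coeff_gap t r t' r' k < \<eta> / 3"
    by (auto simp: eventually_at_top_linorder eventually_at_bot_linorder)
  have "row_gap t r t' r' j < \<eta>" if j: "\<bar>A\<bar> + \<bar>B\<bar> + 4 < \<bar>j\<bar>" for j
  proof -
    have "coeff_gap t r t' r' k < \<eta> / 3" if "k \<in> {j - 1, j, j + 1}" for k
    proof (cases "j > 0")
      case True
      then show ?thesis using that j by (intro A) auto
    next
      case False
      then show ?thesis using that j by (intro B) auto
    qed
    from this[of "j - 1"] this[of j] this[of "j + 1"]
    have small: "coeff_gap t r t' r' (j - 1) + coeff_gap t r t' r' j + coeff_gap t r t' r' (j + 1) < \<eta>" by simp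
    have "\<not> \<bar>j\<bar> < 4" using j by linarith
    with small show ?thesis by (simp add: row_gap_def)
  qed
  then show ?thesis by blast
qed

text \<open>In either direction the shift by 4 skips the rows with the constant value 2; the others
  are sums of three shifts of a summable sequence.\<close>

lemma row_gap_summable:
  assumes p: "summable (\<lambda>n. coeff_gap t r t' r' (int n))" and m: "summable (\<lambda>n. coeff_gap t r t' r' (- int n))"
  shows "row_gap t r t' r' summable_on UNIV"
proof -
  let ?q = "coeff_gap t r t' r'" and ?c = "row_gap t r t' r'"
  note init = summable_ignore_initial_segment
  have "summable (\<lambda>n. ?q (int (n + 3)) + ?q (int (n + 4)) + ?q (int (n + 5)))"
    by (intro summable_add init[OF p])
  moreover have "?c (int (n + 4)) = ?q (int (n + 3)) + ?q (int (n + 4)) + ?q (int (n + 5))" for n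
    by (simp add: row_gap_def algebra_simps)
  ultimately have "summable (\<lambda>n. ?c (int (n + 4)))" by simp
  then have "summable (\<lambda>n. ?c (int n))" by (simp only: summable_iff_shift[of "\<lambda>n. ?c (int n)"])
  then have P: "(?c \<circ> int) summable_on UNIV"
    unfolding o_def by (rule summable_nonneg_imp_summable_on) (rule row_gap_nonneg)
  have "summable (\<lambda>n. ?q (- int (n + 5)) + ?q (- int (n + 4)) + ?q (- int (n + 3)))"
    by (intro summable_add init[OF m])
  moreover have "?c (- int (n + 4)) = ?q (- int (n + 5)) + ?q (- int (n + 4)) + ?q (- int (n + 3))" for n
    by (simp add: row_gap_def algebra_simps)
  ultimately have "summable (\<lambda>n. ?c (- int (n + 4)))" by simp
  then have "summable (\<lambda>n. ?c (- int n))" by (simp only: summable_iff_shift[of "\<lambda>n. ?c (- int n)"])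
  then have M: "(?c \<circ> (\<lambda>n. - int n)) summable_on UNIV"
    unfolding o_def by (rule summable_nonneg_imp_summable_on) (rule row_gap_nonneg)
  have "?c summable_on range int" using P by (subst summable_on_reindex) auto
  moreover have "?c summable_on range (\<lambda>n. - int n)" using M by (subst summable_on_reindex) (auto simp: inj_def)
  then have "?c summable_on (range (\<lambda>n. - int n) - range int)"
    by (rule summable_on_subset_banach) auto
  ultimately have "?c summable_on (range int \<union> (range (\<lambda>n. - int n) - range int))"
    by (rule summable_on_Un_disjoint) auto
  also have "range int \<union> (range (\<lambda>n. - int n) - range int) = (UNIV :: int set)"
  proof (intro equalityI subsetI UNIV_I)
    fix k :: int
    have "k = int (nat k) \<or> k = - int (nat (- k))" by auto
    then show "k \<in> range int \<union> (range (\<lambda>n. - int n) - range int)" by blast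
  qed
  finally show ?thesis .
qed

text \<open>Comparison with the series of j^{-2 \<epsilon>}, which converges as 2 \<epsilon> >
  1.\<close>

lemma summable_if_powr_bounded:
  fixes g :: "nat \<Rightarrow> real"
  assumes bdd: "bdd_above (range (\<lambda>j::nat. g j * real j powr (2 * \<epsilon>)))" and \<epsilon>: "\<epsilon> > 1/2" and g: "\<And>j. 0 \<le> g j"
  shows "summable g"
proof -
  obtain M where M: "\<And>j. g j * real j powr (2 * \<epsilon>) \<le> M" using bdd by (auto simp: bdd_above_def)
  have "summable (\<lambda>j. M * real j powr (- (2 * \<epsilon>)))"
    using \<epsilon> by (intro summable_mult) (simp add: summable_real_powr_iff)
  moreover have "\<forall>\<^sub>F j in sequentially. norm (g j) \<le> M * real j powr (- (2 * \<epsilon>))"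
    \<comment> \<open>The index 0 is left out because \<open>0 powr (2 * \<epsilon>)\<close> is 0
      and cannot be divided by.\<close>
    using eventually_gt_at_top[of 0]
  proof eventually_elim
    case (elim j)
    then have "real j powr (2 * \<epsilon>) > 0" by simp
    then show ?case using M[of j] g[of j] by (simp add: powr_minus field_simps)
  qed
  ultimately show ?thesis by (rule summable_comparison_test_ev[rotated])
qed

lemma delta_plus_ge:
  "\<bar>r (int n) * r (int n - 1) - rp\<^sup>2\<bar> \<le> delta_plus t r tp rp n" "\<bar>t (int n) * t (int n - 1) - tp\<^sup>2\<bar> \<le> delta_plus t r tp rp n"
  "\<bar>t (int n) * r (int n + 1) - rp * tp\<bar> \<le> delta_plus t r tp rp n" "\<bar>t (int n) * r (int n - 1) - rp * tp\<bar> \<le> delta_plus t r tp rp n"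
  unfolding delta_plus_def Let_def by (simp_all add: le_max_iff_disj)

lemma delta_minus_ge:
  "\<bar>r (- int n) * r (- int n + 1) - rm\<^sup>2\<bar> \<le> delta_minus t r tm rm n" "\<bar>t (- int n) * t (- int n + 1) - tm\<^sup>2\<bar> \<le> delta_minus t r tm rm n"
  "\<bar>t (- int n) * r (- int n - 1) - rm * tm\<bar> \<le> delta_minus t r tm rm n" "\<bar>t (- int n) * r (- int n + 1) - rm * tm\<bar> \<le> delta_minus t r tm rm n"
  unfolding delta_minus_def Let_def by (simp_all add: le_max_iff_disj)

text \<open>
  With \<open>t = 0\<close>, \<open>r = 1\<close> and \<open>\<alpha> = 0\<close> at \<open>k = -1\<close> and \<open>k = 0\<close>, the full-line operator becomes the direct
  sum of the two half-line operators and a one-dimensional operator on \<open>\<phi>\<^sub>0\<close>.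
\<close>

definition decoupled :: "real \<Rightarrow> real \<Rightarrow> real \<Rightarrow> int \<Rightarrow> real" where
  "decoupled am a0 ap k = (if 1 \<le> k then ap else if k \<le> -2 then am else a0)"

text \<open>On \<phi>_1 the diagonal block at 0 acts by e^{-i \<theta>_0} e^{i \<alpha>_0}, while
  the half-line operator prescribes e^{-i \<theta>_0}; hence the phase 0. The same happens on
  \<phi>_{-1} with the block at -1.\<close>

definition decoupled_phase :: "(int \<Rightarrow> real) \<Rightarrow> int \<Rightarrow> real" where
  "decoupled_phase \<alpha> k = (if k = 0 \<or> k = -1 then 0 else \<alpha> k)"

section \<open>The decoupled operator on the two half-lines\<close>

context
  fixes \<theta> \<alpha> \<gamma> :: "int \<Rightarrow> real" and tp tm rp rm :: real
begin

abbreviation "decS \<equiv> S_mat \<theta> (decoupled_phase \<alpha>) \<gamma> (decoupled tm 0 tp) (decoupled rm 1 rp)"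

text \<open>Right of the origin the only altered block in reach is the one at 0. Its second
  component is the boundary phase of \<open>Ue_plus\<close> at 1; all other blocks have the limit
  coefficients.\<close>

lemma decoupled_plus:
  assumes "1 \<le> j"
  shows "U_full decS f j = U_plus_lim \<theta> \<alpha> \<gamma> tp rp f j"
proof -
  let ?S = "S_mat \<theta> \<alpha> \<gamma> (\<lambda>_. tp) (\<lambda>_. rp)"
  have c: "S_fst \<theta> (decoupled_phase \<alpha>) \<gamma> (decoupled tm 0 tp) (decoupled rm 1 rp) k = S_fst \<theta> \<alpha> \<gamma> (\<lambda>_. tp) (\<lambda>_. rp) k"
    "S_snd \<theta> (decoupled_phase \<alpha>) \<gamma> (decoupled tm 0 tp) (decoupled rm 1 rp) k = S_snd \<theta> \<alpha> \<gamma> (\<lambda>_. tp) (\<lambda>_. rp) k"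
    if "1 \<le> k" for k
    by (rule S_cong; use that in \<open>simp add: decoupled_def decoupled_phase_def\<close>)+
  have e: "block_op 0 decS f i = Ue_plus \<theta> ?S f i" if "1 \<le> i" for i
  proof (cases "i = 1")
    case True
    then show ?thesis
      by (simp add: Ue_plus_def block_op_S_mat S_snd_def decoupled_def decoupled_phase_def)
  next
    case False
    then have "2 \<le> i" using that by simp
    moreover have "1 \<le> i - 1" using \<open>2 \<le> i\<close> by simp
    ultimately show ?thesis using that c by (simp add: Ue_plus_def block_op_S_mat)
  qed
  have "U_full decS f j = block_op 1 decS (block_op 0 decS f) j" by (simp add: U_full_def)
  also have "\<dots> = block_op 1 ?S (Ue_plus \<theta> ?S f) j"
  proof (cases "j mod 2 = 1")
    case True
    then show ?thesis using assms c e by (simp add: block_op_S_mat[of 1])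
  next
    case False
    then have "1 \<le> j - 1" using assms by presburger
    then show ?thesis using False assms c e by (simp add: block_op_S_mat[of 1])
  qed
  also have "\<dots> = U_plus_lim \<theta> \<alpha> \<gamma> tp rp f j"
    using assms by (simp add: U_plus_lim_def U_plus_def Uo_plus_def)
  finally show ?thesis .
qed

text \<open>Here the altered block in reach is the one at -1, in the odd factor; its first component
  is the boundary phase of \<open>Uo_minus\<close>.\<close>

lemma decoupled_minus:
  assumes "j \<le> -1"
  shows "U_full decS f j = U_minus_lim \<theta> \<alpha> \<gamma> tm rm f j"
proof -
  let ?S = "S_mat \<theta> \<alpha> \<gamma> (\<lambda>_. tm) (\<lambda>_. rm)"
  have c: "S_fst \<theta> (decoupled_phase \<alpha>) \<gamma> (decoupled tm 0 tp) (decoupled rm 1 rp) k = S_fst \<theta> \<alpha> \<gamma> (\<lambda>_. tm) (\<lambda>_. rm) k"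
    "S_snd \<theta> (decoupled_phase \<alpha>) \<gamma> (decoupled tm 0 tp) (decoupled rm 1 rp) k = S_snd \<theta> \<alpha> \<gamma> (\<lambda>_. tm) (\<lambda>_. rm) k"
    if "k \<le> -2" for k
    by (rule S_cong; use that in \<open>simp add: decoupled_def decoupled_phase_def\<close>)+
  have e: "block_op 0 decS f i = Ue_minus ?S f i" if i: "i \<le> -1" for i
  proof (cases "i mod 2 = 0")
    case True
    then have "i \<le> -2" using i by presburger
    then show ?thesis using True i c by (simp add: Ue_minus_def block_op_S_mat)
  next
    case False
    then show ?thesis using i c by (simp add: Ue_minus_def block_op_S_mat)
  qed
  have "U_full decS f j = block_op 1 decS (block_op 0 decS f) j" by (simp add: U_full_def)
  also have "\<dots> = Uo_minus \<theta> ?S (Ue_minus ?S f) j"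
  proof (cases "j = -1")
    case True
    then show ?thesis using e[of "-1"]
      by (simp add: Uo_minus_def block_op_S_mat[of 1] S_fst_def decoupled_def decoupled_phase_def)
  next
    case False
    then have j: "j \<le> -2" using assms by simp
    show ?thesis
    proof (cases "j mod 2 = 1")
      case True
      then have "j + 1 \<le> -1" using j by presburger
      then show ?thesis using True j c e by (simp add: Uo_minus_def block_op_S_mat[of 1])
    next
      case False
      then show ?thesis using j c e by (simp add: Uo_minus_def block_op_S_mat[of 1])
    qed
  qed
  finally show ?thesis by (simp add: U_minus_lim_def U_minus_def)
qed

text \<open>One phase comes from the block at 0 in the even factor, the other from the block at -1
  in the odd factor.\<close>

lemma decoupled_zero: "U_full decS f 0 = cis (- \<theta> (-1)) * cis (- \<theta> 0) * f 0"
  by (simp add: U_full_def block_op_S_mat S_fst_def S_snd_def decoupled_def decoupled_phase_def)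

lemma U_plus_lim_outside: "j \<le> 0 \<Longrightarrow> U_plus_lim \<theta> \<alpha> \<gamma> tp rp f j = 0"
  by (simp add: U_plus_lim_def U_plus_def Uo_plus_def)

lemma U_minus_lim_outside: "0 \<le> j \<Longrightarrow> U_minus_lim \<theta> \<alpha> \<gamma> tm rm f j = 0"
  by (simp add: U_minus_lim_def U_minus_def Uo_minus_def)

lemma U_plus_lim_cong:
  assumes "\<And>i. 1 \<le> i \<Longrightarrow> f i = g i"
  shows "U_plus_lim \<theta> \<alpha> \<gamma> tp rp f = U_plus_lim \<theta> \<alpha> \<gamma> tp rp g"
proof -
  have "Ue_plus \<theta> S f = Ue_plus \<theta> S g" for S
    using assms by (auto simp: fun_eq_iff Ue_plus_def block_op_def)
  then show ?thesis by (simp add: U_plus_lim_def U_plus_def)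
qed

lemma U_minus_lim_cong:
  assumes "\<And>i. i \<le> -1 \<Longrightarrow> f i = g i"
  shows "U_minus_lim \<theta> \<alpha> \<gamma> tm rm f = U_minus_lim \<theta> \<alpha> \<gamma> tm rm g"
proof -
  have "block_op 0 S f j = block_op 0 S g j" if "j \<le> -1" for S j
  proof (cases "j mod 2 = 0")
    case True
    then have "j + 1 \<le> -1" using that by presburger
    then show ?thesis using assms that by (simp add: block_op_def)
  qed (use assms that in \<open>simp add: block_op_def\<close>)
  then have "Ue_minus S f = Ue_minus S g" for S
    by (auto simp: fun_eq_iff Ue_minus_def)
  then show ?thesis by (simp add: U_minus_lim_def U_minus_def)
qed

lemma U_plus_lim_zero: "U_plus_lim \<theta> \<alpha> \<gamma> tp rp (\<lambda>_. 0) j = 0"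
  by (simp add: U_plus_lim_def U_plus_def Uo_plus_def Ue_plus_def block_op_S_mat S_fst_def S_snd_def)

lemma U_minus_lim_zero: "U_minus_lim \<theta> \<alpha> \<gamma> tm rm (\<lambda>_. 0) j = 0"
  by (simp add: U_minus_lim_def U_minus_def Uo_minus_def Ue_minus_def block_op_S_mat S_fst_def S_snd_def)

end

section \<open>Both claims for the given coefficients\<close>

locale band_operator =
  fixes \<theta> \<alpha> \<gamma> t r :: "int \<Rightarrow> real" and tp tm rp rm :: real
  assumes rt: "\<And>k. (r k)\<^sup>2 + (t k)\<^sup>2 = 1"
    and lim: "(t \<longlongrightarrow> tp) at_top" "(t \<longlongrightarrow> tm) at_bot" "(r \<longlongrightarrow> rp) at_top" "(r \<longlongrightarrow> rm) at_bot"
begin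

text \<open>The constraint passes to the limits, which makes V unitary.\<close>

lemma rt_lim: "rp\<^sup>2 + tp\<^sup>2 = 1" "rm\<^sup>2 + tm\<^sup>2 = 1"
proof -
  have "((\<lambda>k. (r k)\<^sup>2 + (t k)\<^sup>2) \<longlongrightarrow> rp\<^sup>2 + tp\<^sup>2) at_top" by (intro tendsto_intros lim)
  then show "rp\<^sup>2 + tp\<^sup>2 = 1" by (simp add: rt tendsto_const_iff)
  have "((\<lambda>k. (r k)\<^sup>2 + (t k)\<^sup>2) \<longlongrightarrow> rm\<^sup>2 + tm\<^sup>2) at_bot" by (intro tendsto_intros lim)
  then show "rm\<^sup>2 + tm\<^sup>2 = 1" by (simp add: rt tendsto_const_iff)
qed

abbreviation "t' \<equiv> decoupled tm 0 tp"
abbreviation "r' \<equiv> decoupled rm 1 rp"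

lemma rt': "(r' k)\<^sup>2 + (t' k)\<^sup>2 = 1"
  using rt_lim by (simp add: decoupled_def)

definition "U = U_l2 \<theta> \<alpha> \<gamma> t r"
definition "V = U_l2 \<theta> (decoupled_phase \<alpha>) \<gamma> t' r'"

lemma l2_fun_U: "l2_fun (U x) = U_full (S_mat \<theta> \<alpha> \<gamma> t r) (l2_fun x)"
  unfolding U_def by (rule l2_fun_U_l2[OF rt])

lemma l2_fun_V: "l2_fun (V x) = U_full (decS \<theta> \<alpha> \<gamma> tp tm rp rm) (l2_fun x)"
  unfolding V_def by (rule l2_fun_U_l2[OF rt'])

sublocale unitary_pair U V
  unfolding unitary_pair_def U_def V_def by (intro conjI unitary_U_l2 rt rt')

lemma l2_fun_V_cases:
  "l2_fun (V x) j = (if 1 \<le> j then U_plus_lim \<theta> \<alpha> \<gamma> tp rp (l2_fun x) j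
     else if j \<le> -1 then U_minus_lim \<theta> \<alpha> \<gamma> tm rm (l2_fun x) j
     else cis (- \<theta> (-1)) * cis (- \<theta> 0) * l2_fun x 0)"
proof -
  consider "1 \<le> j" | "j \<le> -1" | "j = 0" by linarith
  then show ?thesis
    by cases (simp_all add: l2_fun_V decoupled_plus decoupled_minus decoupled_zero)
qed

lemma l2_restrict_V_plus: "l2_restrict {1..} (V x) = V (l2_restrict {1..} x)"
proof (rule l2_eqI)
  fix j
  have "U_plus_lim \<theta> \<alpha> \<gamma> tp rp (l2_fun (l2_restrict {1..} x)) = U_plus_lim \<theta> \<alpha> \<gamma> tp rp (l2_fun x)"
    by (rule U_plus_lim_cong) (simp add: l2_restrict.rep_eq)
  moreover have "U_minus_lim \<theta> \<alpha> \<gamma> tm rm (l2_fun (l2_restrict {1..} x)) = U_minus_lim \<theta> \<alpha> \<gamma> tm rm (\<lambda>_. 0)"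
    by (rule U_minus_lim_cong) (simp add: l2_restrict.rep_eq)
  ultimately show "l2_fun (l2_restrict {1..} (V x)) j = l2_fun (V (l2_restrict {1..} x)) j"
    unfolding l2_restrict.rep_eq[of _ "V x"] l2_fun_V_cases by (simp add: U_minus_lim_zero l2_restrict.rep_eq)
qed

lemma l2_restrict_V_minus: "l2_restrict {..-1} (V x) = V (l2_restrict {..-1} x)"
proof (rule l2_eqI)
  fix j
  have "U_plus_lim \<theta> \<alpha> \<gamma> tp rp (l2_fun (l2_restrict {..-1} x)) = U_plus_lim \<theta> \<alpha> \<gamma> tp rp (\<lambda>_. 0)"
    by (rule U_plus_lim_cong) (simp add: l2_restrict.rep_eq)
  moreover have "U_minus_lim \<theta> \<alpha> \<gamma> tm rm (l2_fun (l2_restrict {..-1} x)) = U_minus_lim \<theta> \<alpha> \<gamma> tm rm (l2_fun x)"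
    by (rule U_minus_lim_cong) (simp add: l2_restrict.rep_eq)
  ultimately show "l2_fun (l2_restrict {..-1} (V x)) j = l2_fun (V (l2_restrict {..-1} x)) j"
    unfolding l2_restrict.rep_eq[of _ "V x"] l2_fun_V_cases by (simp add: U_plus_lim_zero l2_restrict.rep_eq)
qed

sublocale V: split_unitary V "{1..}" "{..-1}" 0 "cis (- \<theta> (-1)) * cis (- \<theta> 0)"
  by unfold_locales (auto simp: l2_restrict_V_plus l2_restrict_V_minus l2_fun_V_cases)

lemma rep_plus: "x \<in> supported_on {1..} \<Longrightarrow> U_plus_lim \<theta> \<alpha> \<gamma> tp rp (l2_fun x) = l2_fun (V x)"
  using V.reducing_A[OF V.reducing_I, of x]
  by (auto simp: fun_eq_iff l2_fun_V_cases[of x] U_plus_lim_outside supported_on_def)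

lemma rep_minus: "x \<in> supported_on {..-1} \<Longrightarrow> U_minus_lim \<theta> \<alpha> \<gamma> tm rm (l2_fun x) = l2_fun (V x)"
  using V.reducing_A[OF V.reducing_J, of x]
  by (auto simp: fun_eq_iff l2_fun_V_cases[of x] U_minus_lim_outside supported_on_def)

sublocale full: l2_unitary U UNIV "U_full (S_mat \<theta> \<alpha> \<gamma> t r)"
  by unfold_locales (auto simp: l2_fun_U)

sublocale plus: l2_unitary V "{1..}" "U_plus_lim \<theta> \<alpha> \<gamma> tp rp"
  by unfold_locales (auto simp: rep_plus V.reducing_I)

sublocale minus: l2_unitary V "{..-1}" "U_minus_lim \<theta> \<alpha> \<gamma> tm rm"
  by unfold_locales (auto simp: rep_minus V.reducing_J)

lemma diff_bound: "cmod (l2_fun (U x - V x) j) \<le> row_gap t r t' r' j * neighbour_sum (l2_fun x) j"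
  unfolding minus_l2.rep_eq l2_fun_U l2_fun_V
  by (rule U_full_diff[OF rt rt']) (simp add: decoupled_phase_def)

lemma coeff_gap_lim: "(coeff_gap t r t' r' \<longlongrightarrow> 0) at_top" "(coeff_gap t r t' r' \<longlongrightarrow> 0) at_bot"
proof -
  have "(decoupled am a0 ap \<longlongrightarrow> ap) at_top" for am a0 ap
    by (rule tendsto_eventually) (use eventually_ge_at_top[of 1] in \<open>eventually_elim, simp add: decoupled_def\<close>)
  then show "(coeff_gap t r t' r' \<longlongrightarrow> 0) at_top"
    by (intro coeff_gap_tendsto[OF _ lim(1,3)] filterlim_int_shift)
  have "(decoupled am a0 ap \<longlongrightarrow> am) at_bot" for am a0 ap
    by (rule tendsto_eventually) (use eventually_le_at_bot[of "-2"] in \<open>eventually_elim, simp add: decoupled_def\<close>)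
  then show "(coeff_gap t r t' r' \<longlongrightarrow> 0) at_bot"
    by (intro coeff_gap_tendsto[OF _ lim(2,4)] filterlim_int_shift)
qed

lemma row_gap_bounded: "\<exists>B. \<forall>j. row_gap t r t' r' j \<le> B"
proof -
  obtain N where N: "\<And>j. N < \<bar>j\<bar> \<Longrightarrow> row_gap t r t' r' j < 1"
    using row_gap_small[OF coeff_gap_lim, of 1] by auto
  define B where "B = Max (insert 1 (row_gap t r t' r' ` {-N..N}))"
  have "row_gap t r t' r' j \<le> B" for j
  proof (cases "N < \<bar>j\<bar>")
    case True
    then have "row_gap t r t' r' j \<le> 1" using N by (simp add: less_imp_le)
    also have "1 \<le> B" unfolding B_def by (rule Max_ge) auto
    finally show ?thesis .
  next
    case False
    then have "j \<in> {-N..N}" by auto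
    then show ?thesis unfolding B_def by (intro Max_ge) auto
  qed
  then show ?thesis by blast
qed

lemma compact_difference:
  assumes "e > 0"
  shows "\<exists>F d. finite F \<and> d > 0 \<and>
     (\<forall>x. norm x = 1 \<and> (\<forall>g\<in>F. cmod (cinner g x) < d) \<longrightarrow> norm (U x - V x) < e)"
proof -
  obtain B where B: "\<And>j. row_gap t r t' r' j \<le> B" using row_gap_bounded by blast
  show ?thesis
    by (rule band_compact[OF diff_bound row_gap_nonneg B row_gap_small[OF coeff_gap_lim] assms])
qed

theorem ess_spectrum_eq:
  "ess_spectrum (ell2 UNIV) (U_full (S_mat \<theta> \<alpha> \<gamma> t r)) =
     ess_spectrum (ell2 {1..}) (U_plus_lim \<theta> \<alpha> \<gamma> tp rp) \<union>
     ess_spectrum (ell2 {..-1}) (U_minus_lim \<theta> \<alpha> \<gamma> tm rm)"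
proof -
  interpret VU: unitary_pair V U by (rule swap)
  have "U.singular_at UNIV z \<longleftrightarrow> V.singular_at UNIV z" for z
  proof
    assume "U.singular_at UNIV z"
    then show "V.singular_at UNIV z"
    proof (rule VU.singular_at_compact_perturbation)
      fix e :: real assume "e > 0"
      then show "\<exists>F d. finite F \<and> d > 0 \<and>
         (\<forall>x. norm x = 1 \<and> (\<forall>g\<in>F. cmod (cinner g x) < d) \<longrightarrow> norm (V x - U x) < e)"
        using compact_difference by (subst norm_minus_commute)
    qed
  next
    assume "V.singular_at UNIV z"
    then show "U.singular_at UNIV z"
      by (rule singular_at_compact_perturbation) (rule compact_difference)
  qed
  then show ?thesis
    unfolding full.ess_spectrum_eq plus.ess_spectrum_eq minus.ess_spectrum_eq
    by (auto simp: V.singular_at_split)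
qed

text \<open>On the left the indices are mirrored: the first two products of \<open>coeff_gap\<close>
  at -n pair -n with -n - 1, whereas those of \<open>delta_minus\<close> at n pair -n with -n + 1.
  They are therefore read off at \<open>Suc n\<close>; the mixed products stay at n.\<close>

lemma coeff_gap_summable:
  assumes p: "summable (delta_plus t r tp rp)" and m: "summable (delta_minus t r tm rm)"
  shows "summable (\<lambda>n. coeff_gap t r t' r' (int n))" "summable (\<lambda>n. coeff_gap t r t' r' (- int n))"
proof -
  show "summable (\<lambda>n. coeff_gap t r t' r' (int n))"
  proof (rule summable_comparison_test_ev)
    show "\<forall>\<^sub>F n in sequentially. norm (coeff_gap t r t' r' (int n)) \<le> 4 * delta_plus t r tp rp n"
      \<comment> \<open>From n = 2 on, n - 1 is at least 1, where \<open>decoupled\<close> has its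
        limit value.\<close>
      using eventually_ge_at_top[of 2]
    proof eventually_elim
      case (elim n)
      then have "1 \<le> int n" "1 \<le> int n - 1" "1 \<le> int n + 1" by auto
      then show ?case
        using delta_plus_ge[where n = n and t = t and r = r and tp = tp and rp = rp] coeff_gap_nonneg[of t r t' r' "int n"]
        by (simp add: coeff_gap_def decoupled_def power2_eq_square mult.commute)
    qed
  qed (intro summable_mult p)
  show "summable (\<lambda>n. coeff_gap t r t' r' (- int n))"
  proof (rule summable_comparison_test_ev)
    show "\<forall>\<^sub>F n in sequentially. norm (coeff_gap t r t' r' (- int n)) \<le> 2 * delta_minus t r tm rm n + 2 * delta_minus t r tm rm (Suc n)"
      \<comment> \<open>Now -n + 1 has to be at most -2, hence 3.\<close>
      using eventually_ge_at_top[of 3]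
    proof eventually_elim
      case (elim n)
      then have d: "t' (- int n) = tm" "r' (- int n) = rm" "t' (- int n - 1) = tm" "r' (- int n - 1) = rm"
          "t' (- int n + 1) = tm" "r' (- int n + 1) = rm"
        by (auto simp: decoupled_def)
      have s: "- int (Suc n) = - int n - 1" "- int (Suc n) + 1 = - int n" by auto
      have "\<bar>r (- int n) * r (- int n - 1) - rm * rm\<bar> \<le> delta_minus t r tm rm (Suc n)"
        "\<bar>t (- int n) * t (- int n - 1) - tm * tm\<bar> \<le> delta_minus t r tm rm (Suc n)"
        using delta_minus_ge(1,2)[where n = "Suc n" and t = t and r = r and tm = tm and rm = rm]
        unfolding s by (simp_all add: power2_eq_square mult.commute)
      moreover have "\<bar>t (- int n) * r (- int n + 1) - tm * rm\<bar> \<le> delta_minus t r tm rm n"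
        "\<bar>t (- int n) * r (- int n - 1) - tm * rm\<bar> \<le> delta_minus t r tm rm n"
        using delta_minus_ge(3,4)[where n = n and t = t and r = r and tm = tm and rm = rm]
        by (simp_all add: mult.commute)
      ultimately have "coeff_gap t r t' r' (- int n) \<le> 2 * delta_minus t r tm rm n + 2 * delta_minus t r tm rm (Suc n)"
        unfolding coeff_gap_def d by linarith
      then show ?case using coeff_gap_nonneg[of t r t' r' "- int n"] by simp
    qed
    have "summable (\<lambda>n. delta_minus t r tm rm (Suc n))" using m by (simp add: summable_Suc_iff)
    then show "summable (\<lambda>n. 2 * delta_minus t r tm rm n + 2 * delta_minus t r tm rm (Suc n))"
      by (intro summable_add summable_mult m)
  qed
qed

text \<open>The equivalence is the wave operator from U to V followed by the splitting J at the
  origin. Absolutely continuous vectors of V have no component at 0, so J loses nothing on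
  them.\<close>

theorem ac_unitarily_equivalent:
  assumes \<epsilon>: "\<epsilon> > 1/2" and p: "bdd_above (range (\<lambda>j::nat. delta_plus t r tp rp j * real j powr (2 * \<epsilon>)))"
    and m: "bdd_above (range (\<lambda>j::nat. delta_minus t r tm rm j * real j powr (2 * \<epsilon>)))"
  shows "unitarily_equivalent
      (ac_subspace (ell2 UNIV) (U_full (S_mat \<theta> \<alpha> \<gamma> t r))) (U_full (S_mat \<theta> \<alpha> \<gamma> t r))
      (direct_sum_space (ac_subspace (ell2 {1..}) (U_plus_lim \<theta> \<alpha> \<gamma> tp rp))
                        (ac_subspace (ell2 {..-1}) (U_minus_lim \<theta> \<alpha> \<gamma> tm rm)))
      (direct_sum_op (U_plus_lim \<theta> \<alpha> \<gamma> tp rp) (U_minus_lim \<theta> \<alpha> \<gamma> tm rm))"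
proof -
  have "0 \<le> delta_plus t r tp rp j" "0 \<le> delta_minus t r tm rm j" for j
    using order_trans[OF abs_ge_zero delta_plus_ge(1)] order_trans[OF abs_ge_zero delta_minus_ge(1)] by auto
  then have "summable (delta_plus t r tp rp)" "summable (delta_minus t r tm rm)"
    using summable_if_powr_bounded[OF p \<epsilon>] summable_if_powr_bounded[OF m \<epsilon>] by auto
  then have "row_gap t r t' r' summable_on UNIV"
    by (intro row_gap_summable coeff_gap_summable)
  then obtain \<alpha>0 D where tc: "trace_class_perturbation U V \<alpha>0 D"
    using band_trace_class[OF unitary_pair_axioms diff_bound row_gap_nonneg] by blast
  interpret UV: trace_class_perturbation U V \<alpha>0 D by (rule tc)
  interpret VU: trace_class_perturbation V U \<alpha>0 D by (rule UV.swap_trace_class)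
  define W where "W = wave V U"
  have dom: "x \<in> VU.wave_domain" if "x \<in> U.ac_vectors" for x
    using VU.ac_vectors_wave_domain that by blast
  have W_ac: "W x \<in> V.ac_vectors" if "x \<in> U.ac_vectors" for x
    unfolding W_def using dom[OF that] that by (rule VU.wave_ac_vectors)
  have W_split: "l2_restrict {1..} (W x) \<in> V.ac_vectors \<inter> supported_on {1..}"
    "l2_restrict {..-1} (W x) \<in> V.ac_vectors \<inter> supported_on {..-1}"
    "W x = l2_restrict {1..} (W x) + l2_restrict {..-1} (W x)" if "x \<in> U.ac_vectors" for x
    using V.ac_vectors_split[OF W_ac[OF that]] by auto
  \<comment> \<open>The preimage is given by the wave operator in the other direction, which exists
    because the trace class condition is symmetric in U and V.\<close>
  have W_surj: "\<exists>x\<in>U.ac_vectors. W x = y" if y: "y \<in> V.ac_vectors" for y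
  proof -
    have yd: "y \<in> wave_domain" using UV.ac_vectors_wave_domain y by blast
    then show ?thesis unfolding W_def
      by (intro bexI[of _ "wave U V y"] wave_inverse wave_ac_vectors y)
  qed
  have W_inner: "cinner (W x) (W y) = cinner x y" if "x \<in> U.ac_vectors" "y \<in> U.ac_vectors" for x y
    unfolding W_def using that by (intro VU.cinner_wave dom)
  have W_add: "W (x + y) = W x + W y" if "x \<in> U.ac_vectors" "y \<in> U.ac_vectors" for x y
    unfolding W_def using VU.wave_add[OF dom[OF that(1)] dom[OF that(2)]] by simp
  have W_scale: "W (scaleC c x) = scaleC c (W x)" if "x \<in> U.ac_vectors" for x c
    unfolding W_def using VU.wave_scale[OF dom[OF that]] by simp
  have W_U: "W (U x) = V (W x)" if "x \<in> U.ac_vectors" for x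
    unfolding W_def using VU.wave_intertwines[OF dom[OF that]] by simp
  define J where "J w = case_sum (l2_fun (l2_restrict {1..} w)) (l2_fun (l2_restrict {..-1} w))" for w :: "int l2"
  define W' where "W' f = J (W (l2_of f))" for f
  have W': "W' (l2_fun x) = J (W x)" for x by (simp add: W'_def l2_fun_inverse)
  \<comment> \<open>J drops the component at 0. A condition on v alone is enough, since the inner
    product with such a v ignores that component of w.\<close>
  have J_inner: "ell2_inner (J v) (J w) = cinner v w"
    if "v = l2_restrict {1..} v + l2_restrict {..-1} v" for v w
  proof -
    have "ell2_inner (J v) (J w) =
        cinner (l2_restrict {1..} v) (l2_restrict {1..} w) + cinner (l2_restrict {..-1} v) (l2_restrict {..-1} w)"
    proof -
      let ?h = "\<lambda>s. cnj (J v s) * J w s"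
      have l: "?h \<circ> Inl = (\<lambda>i. cnj (l2_fun (l2_restrict {1..} v) i) * l2_fun (l2_restrict {1..} w) i)"
        and r: "?h \<circ> Inr = (\<lambda>i. cnj (l2_fun (l2_restrict {..-1} v) i) * l2_fun (l2_restrict {..-1} w) i)"
        by (auto simp: J_def fun_eq_iff)
      have sl: "?h summable_on range Inl"
        unfolding summable_on_reindex[OF inj_Inl] l by (rule l2_inner_summable)
      have sr: "?h summable_on range Inr"
        unfolding summable_on_reindex[OF inj_Inr] r by (rule l2_inner_summable)
      have "infsum ?h UNIV = infsum ?h (range Inl \<union> range Inr)" by (simp only: UNIV_sum)
      also have "\<dots> = infsum ?h (range Inl) + infsum ?h (range Inr)"
        by (rule infsum_Un_disjoint[OF sl sr]) auto
      also have "\<dots> = infsum (?h \<circ> Inl) UNIV + infsum (?h \<circ> Inr) UNIV"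
        by (simp only: infsum_reindex[OF inj_Inl] infsum_reindex[OF inj_Inr])
      finally show ?thesis unfolding l r by (simp only: ell2_inner_def cinner_l2)
    qed
    also have "\<dots> = cinner v w"
      by (simp only: cinner_restrict_right[symmetric] cinner_add_left[symmetric] that[symmetric])
    finally show ?thesis .
  qed
  have J_add: "J (v + w) = J v + J w" for v w
    by (auto simp: J_def fun_eq_iff l2_restrict_add plus_l2.rep_eq split: sum.splits)
  have J_scale: "J (scaleC c v) = cscale c (J v)" for c v
    by (auto simp: J_def fun_eq_iff l2_restrict_scale scaleC_l2.rep_eq cscale_def split: sum.splits)
  let ?M = "l2_fun ` U.ac_vectors"
  let ?N = "direct_sum_space (l2_fun ` (V.ac_vectors \<inter> supported_on {1..})) (l2_fun ` (V.ac_vectors \<inter> supported_on {..-1}))"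
  have "unitarily_equivalent ?M (U_full (S_mat \<theta> \<alpha> \<gamma> t r)) ?N
     (direct_sum_op (U_plus_lim \<theta> \<alpha> \<gamma> tp rp) (U_minus_lim \<theta> \<alpha> \<gamma> tm rm))"
    unfolding unitarily_equivalent_def
  proof (intro exI[of _ W'] conjI ballI)
    have maps: "W' f \<in> ?N" if "f \<in> ?M" for f
    proof -
      obtain x where x: "x \<in> U.ac_vectors" "f = l2_fun x" using \<open>f \<in> ?M\<close> by blast
      show ?thesis
        unfolding x(2) W' J_def direct_sum_space_def
        by (intro CollectI exI conjI, rule refl) (rule imageI, rule W_split[OF x(1)])+
    qed
    have add: "W' (f + g) = W' f + W' g" if "f \<in> ?M" "g \<in> ?M" for f g
      using that by (auto simp: W' W_add J_add l2_fun_plus[symmetric])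
    have scale: "W' (cscale c f) = cscale c (W' f)" if "f \<in> ?M" for f c
      using that by (auto simp: W' W_scale J_scale l2_fun_scaleC[symmetric])
    show "linear_between ?M ?N W'"
      unfolding linear_between_def using maps add scale by blast
    show inner: "ell2_inner (W' f) (W' g) = ell2_inner f g" if "f \<in> ?M" "g \<in> ?M" for f g
    proof -
      obtain x y where xy: "x \<in> U.ac_vectors" "y \<in> U.ac_vectors" "f = l2_fun x" "g = l2_fun y"
        using \<open>f \<in> ?M\<close> \<open>g \<in> ?M\<close> by blast
      then show ?thesis by (simp add: W' J_inner[OF W_split(3)] W_inner cinner_l2[symmetric])
    qed
    show "bij_betw W' ?M ?N"
      unfolding bij_betw_def
    proof
      show "inj_on W' ?M"
      proof (rule inj_onI)
        fix f g assume fg: "f \<in> ?M" "g \<in> ?M" "W' f = W' g"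
        then obtain x y where xy: "x \<in> U.ac_vectors" "y \<in> U.ac_vectors" "f = l2_fun x" "g = l2_fun y" by blast
        have "l2_restrict {1..} (W x) = l2_restrict {1..} (W y)" "l2_restrict {..-1} (W x) = l2_restrict {..-1} (W y)"
          using arg_cong[OF fg(3), of "\<lambda>h. h \<circ> Inl"] arg_cong[OF fg(3), of "\<lambda>h. h \<circ> Inr"]
          by (simp_all add: xy W' J_def case_sum_o_inj l2_fun_inject)
        then have "W x = W y" using W_split(3)[OF xy(1)] W_split(3)[OF xy(2)] by simp
        then have "wave U V (W x) = wave U V (W y)" by simp
        then have "x = y" using VU.wave_inverse[OF dom[OF xy(1)]] VU.wave_inverse[OF dom[OF xy(2)]] by (simp add: W_def)
        then show "f = g" using xy by simp
      qed
      show "W' ` ?M = ?N"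
      proof (intro equalityI subsetI)
        fix h assume "h \<in> W' ` ?M"
        then show "h \<in> ?N" using maps by blast
      next
        fix h assume "h \<in> ?N"
        then obtain u v where uv: "u \<in> V.ac_vectors \<inter> supported_on {1..}" "v \<in> V.ac_vectors \<inter> supported_on {..-1}"
          and h: "h = case_sum (l2_fun u) (l2_fun v)"
          by (auto simp: direct_sum_space_def)
        obtain x where x: "x \<in> U.ac_vectors" "W x = u + v"
          using W_surj[OF V.ac_vectors_combine[OF uv]] by blast
        \<comment> \<open>Each summand lives on one half-line, so J takes u + v to the pair (u,
          v).\<close>
        have "l2_restrict {1..} v = 0" "l2_restrict {..-1} u = 0"
          using uv by (auto intro!: l2_eqI simp: l2_restrict.rep_eq zero_l2.rep_eq supported_on_def)
        then have "J (W x) = h"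
          using uv by (simp add: x(2) h J_def l2_restrict_add l2_restrict_id)
        then show "h \<in> W' ` ?M" using x(1) W'[of x] by (metis imageI)
      qed
    qed
    show "W' (U_full (S_mat \<theta> \<alpha> \<gamma> t r) f) =
        direct_sum_op (U_plus_lim \<theta> \<alpha> \<gamma> tp rp) (U_minus_lim \<theta> \<alpha> \<gamma> tm rm) (W' f)" if "f \<in> ?M" for f
    proof -
      obtain x where x: "x \<in> U.ac_vectors" "f = l2_fun x" using \<open>f \<in> ?M\<close> by blast
      have "W' (U_full (S_mat \<theta> \<alpha> \<gamma> t r) f) = J (V (W x))"
        by (simp add: x l2_fun_U[symmetric] W' W_U)
      also have "\<dots> = case_sum (U_plus_lim \<theta> \<alpha> \<gamma> tp rp (l2_fun (l2_restrict {1..} (W x))))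
          (U_minus_lim \<theta> \<alpha> \<gamma> tm rm (l2_fun (l2_restrict {..-1} (W x))))"
        by (simp add: J_def l2_restrict_V_plus l2_restrict_V_minus rep_plus rep_minus l2_restrict_supported)
      also have "\<dots> = direct_sum_op (U_plus_lim \<theta> \<alpha> \<gamma> tp rp) (U_minus_lim \<theta> \<alpha> \<gamma> tm rm) (W' f)"
        by (simp add: x(2) W' J_def direct_sum_op_def case_sum_o_inj)
      finally show ?thesis .
    qed
  qed
  then show ?thesis
    unfolding full.ac_subspace_eq plus.ac_subspace_eq minus.ac_subspace_eq supported_on_UNIV Int_UNIV_right .
qed

end

theorem theorem3p2:
  fixes \<theta> \<alpha> \<gamma> t r :: "int \<Rightarrow> real" and tp tm rp rm :: real
  assumes "\<And>k. (r k)\<^sup>2 + (t k)\<^sup>2 = 1"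
    and "(t \<longlongrightarrow> tp) at_top" and "(t \<longlongrightarrow> tm) at_bot"
    and "(r \<longlongrightarrow> rp) at_top" and "(r \<longlongrightarrow> rm) at_bot"
  shows "ess_spectrum (ell2 UNIV) (U_full (S_mat \<theta> \<alpha> \<gamma> t r)) =
           ess_spectrum (ell2 {1..}) (U_plus_lim \<theta> \<alpha> \<gamma> tp rp) \<union>
           ess_spectrum (ell2 {..-1}) (U_minus_lim \<theta> \<alpha> \<gamma> tm rm)
       \<and> ((\<exists>\<epsilon>>1/2. bdd_above (range (\<lambda>j::nat. delta_plus t r tp rp j * real j powr (2 * \<epsilon>))) \<and>
                     bdd_above (range (\<lambda>j::nat. delta_minus t r tm rm j * real j powr (2 * \<epsilon>))))
          \<longrightarrow> unitarily_equivalent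
                (ac_subspace (ell2 UNIV) (U_full (S_mat \<theta> \<alpha> \<gamma> t r)))
                (U_full (S_mat \<theta> \<alpha> \<gamma> t r))
                (direct_sum_space
                   (ac_subspace (ell2 {1..}) (U_plus_lim \<theta> \<alpha> \<gamma> tp rp))
                   (ac_subspace (ell2 {..-1}) (U_minus_lim \<theta> \<alpha> \<gamma> tm rm)))
                (direct_sum_op (U_plus_lim \<theta> \<alpha> \<gamma> tp rp) (U_minus_lim \<theta> \<alpha> \<gamma> tm rm)))"
proof -
  interpret band_operator \<theta> \<alpha> \<gamma> t r tp tm rp rm
    by unfold_locales (rule assms)+
  show ?thesis
    using ess_spectrum_eq ac_unitarily_equivalent by blast
qed

end
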